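(* Let $K$ be an algebraically closed field of positive characteristic, let $f_1,f_2,f_3\in K[x,y,z]$ be homogeneous elements of degrees $d_1,d_2,d_3$ and let $g_1,g_2,g_3\in K[x,y,z]$ be primary homogeneous elements of degrees $e_1,e_2,e_3$ such that $m=e_i+d_i$ for $i=1,2,3$ and $2m\geq d_1+d_2+d_3$. Set $F=f_1g_1+f_2g_2+f_3g_3$ and $R=K[x,y,z]/(F)$ and suppose that $R$ is normal and that the $f_i$ are pairwise primary in $R$. Then $$R_{\geq m}\subseteq (f_1,f_2,f_3)^{+\mathrm{gr}}.$$
   Context: $K[x,y,z]$ has the standard grading. For a standard graded $K$-algebra $S=\bigoplus_{k\ge0}S_k$ with irrelevant ideal $S_+=\bigoplus_{k\ge1}S_k$, homogeneous elements $h_1,\dots,h_r$ are called primary if $S_+$ is contained in the radical of $(h_1,\dots,h_r)$; $f_1,f_2,f_3$ are pairwise primary in $R$ if (the images in $R$ of) each pair $f_i,f_j$ ($i\neq j$) is primary. $R_{\ge m}=\bigoplus_{k\ge m}R_k$. Normal means integrally closed domain. An element $f_0\in R$ belongs to $(f_1,f_2,f_3)^{+\mathrm{gr}}$ if there exists a finite graded extension $R\subseteq R'$ with $f_0\in(f_1,f_2,f_3)R'$. *)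

theory Defs
  imports
    "HOL-Library.Poly_Mapping"
    "HOL-Library.Numeral_Type"
    "HOL-Algebra.Algebra"
    "HOL-Algebra.Algebraic_Closure_Type"
begin

section \<open>The polynomial ring in three variables\<close>

text \<open>A monomial is an exponent vector indexed by the three-element type \<^typ>\<open>3\<close>; a polynomial is a
  finitely supported coefficient function on monomials, with the convolution product.\<close>

type_synonym 'k poly3 = "(3 \<Rightarrow>\<^sub>0 nat) \<Rightarrow>\<^sub>0 'k"

abbreviation poly3_ring :: "('k::field) poly3 ring" where
  "poly3_ring \<equiv> ring_of_type_algebra"

definition homogeneous_polys :: "nat \<Rightarrow> ('k::field) poly3 set" where
  "homogeneous_polys d = {p. \<forall>t \<in> Poly_Mapping.keys p. (\<Sum>i\<in>UNIV. Poly_Mapping.lookup t i) = d}"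


section \<open>Graded rings\<close>

definition decomposes ::
  "('a, 'm) ring_scheme \<Rightarrow> (nat \<Rightarrow> 'a set) \<Rightarrow> 'a \<Rightarrow> (nat \<Rightarrow> 'a) \<Rightarrow> bool" where
  "decomposes S G x c \<longleftrightarrow>
     (\<forall>k. c k \<in> G k) \<and> finite {k. c k \<noteq> \<zero>\<^bsub>S\<^esub>} \<and> x = finsum S c {k. c k \<noteq> \<zero>\<^bsub>S\<^esub>}"

locale graded_ring = cring S for S (structure) +
  fixes G :: "nat \<Rightarrow> 'a set"
  assumes component: "additive_subgroup (G k) S"
    and component_mult: "x \<in> G i \<Longrightarrow> y \<in> G j \<Longrightarrow> x \<otimes> y \<in> G (i + j)"
    and one_component: "\<one> \<in> G 0"
    and decomposition: "x \<in> carrier S \<Longrightarrow> \<exists>!c. decomposes S G x c"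

text \<open>\<open>degree_ge S G n\<close> is \<open>\<Oplus>\<^sub>k\<^sub>\<ge>\<^sub>n S\<^sub>k\<close>.\<close>

definition degree_ge ::
  "('a, 'm) ring_scheme \<Rightarrow> (nat \<Rightarrow> 'a set) \<Rightarrow> nat \<Rightarrow> 'a set" where
  "degree_ge S G n = {x. \<exists>c. decomposes S G x c \<and> (\<forall>k<n. c k = \<zero>\<^bsub>S\<^esub>)}"

abbreviation irrelevant_ideal ::
  "('a, 'm) ring_scheme \<Rightarrow> (nat \<Rightarrow> 'a set) \<Rightarrow> 'a set" where
  "irrelevant_ideal S G \<equiv> degree_ge S G 1"

definition quotient_grading ::
  "('a, 'm) ring_scheme \<Rightarrow> (nat \<Rightarrow> 'a set) \<Rightarrow> 'a set \<Rightarrow> nat \<Rightarrow> 'a set set" where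
  "quotient_grading S G I k = (\<lambda>x. I +>\<^bsub>S\<^esub> x) ` G k"

definition radical :: "('a, 'm) ring_scheme \<Rightarrow> 'a set \<Rightarrow> 'a set" where
  "radical S I = {x \<in> carrier S. \<exists>n::nat. n \<ge> 1 \<and> x [^]\<^bsub>S\<^esub> n \<in> I}"

text \<open>\<open>H\<close> is meant to be a finite set of homogeneous elements.\<close>

definition primary ::
  "('a, 'm) ring_scheme \<Rightarrow> (nat \<Rightarrow> 'a set) \<Rightarrow> 'a set \<Rightarrow> bool" where
  "primary S G H \<longleftrightarrow> irrelevant_ideal S G \<subseteq> radical S (Idl\<^bsub>S\<^esub> H)"


section \<open>Fraction field and normality\<close>

definition frac_rel :: "('a, 'm) ring_scheme \<Rightarrow> (('a \<times> 'a) \<times> ('a \<times> 'a)) set" where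
  "frac_rel R = {((a, b), (c, d)). a \<in> carrier R \<and> b \<in> carrier R - {\<zero>\<^bsub>R\<^esub>} \<and>
     c \<in> carrier R \<and> d \<in> carrier R - {\<zero>\<^bsub>R\<^esub>} \<and> a \<otimes>\<^bsub>R\<^esub> d = c \<otimes>\<^bsub>R\<^esub> b}"

definition fraction :: "('a, 'm) ring_scheme \<Rightarrow> 'a \<Rightarrow> 'a \<Rightarrow> ('a \<times> 'a) set" where
  "fraction R a b = frac_rel R `` {(a, b)}"

definition fraction_field :: "('a, 'm) ring_scheme \<Rightarrow> ('a \<times> 'a) set ring" where
  "fraction_field R =
     \<lparr>carrier = (carrier R \<times> (carrier R - {\<zero>\<^bsub>R\<^esub>})) // frac_rel R,
      monoid.mult = (\<lambda>A B. \<Union>p\<in>A. \<Union>q\<in>B. fraction R (fst p \<otimes>\<^bsub>R\<^esub> fst q) (snd p \<otimes>\<^bsub>R\<^esub> snd q)),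
      one = fraction R \<one>\<^bsub>R\<^esub> \<one>\<^bsub>R\<^esub>,
      ring.zero = fraction R \<zero>\<^bsub>R\<^esub> \<one>\<^bsub>R\<^esub>,
      add = (\<lambda>A B. \<Union>p\<in>A. \<Union>q\<in>B.
               fraction R (fst p \<otimes>\<^bsub>R\<^esub> snd q \<oplus>\<^bsub>R\<^esub> fst q \<otimes>\<^bsub>R\<^esub> snd p) (snd p \<otimes>\<^bsub>R\<^esub> snd q))\<rparr>"

definition to_frac :: "('a, 'm) ring_scheme \<Rightarrow> 'a \<Rightarrow> ('a \<times> 'a) set" where
  "to_frac R a = fraction R a \<one>\<^bsub>R\<^esub>"

text \<open>Univariate polynomials of \<open>HOL-Algebra\<close> are coefficient lists, leading coefficient first.\<close>

definition integral_over :: "('a, 'm) ring_scheme \<Rightarrow> 'a set \<Rightarrow> 'a \<Rightarrow> bool" where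
  "integral_over L A x \<longleftrightarrow>
     (\<exists>p \<in> carrier (A[X]\<^bsub>L\<^esub>). p \<noteq> [] \<and> hd p = \<one>\<^bsub>L\<^esub> \<and> ring.eval L p x = \<zero>\<^bsub>L\<^esub>)"

definition normal_ring :: "('a, 'm) ring_scheme \<Rightarrow> bool" where
  "normal_ring R \<longleftrightarrow> domain R \<and>
     (\<forall>x \<in> carrier (fraction_field R).
        integral_over (fraction_field R) (to_frac R ` carrier R) x \<longrightarrow> x \<in> to_frac R ` carrier R)"


section \<open>Graded plus closure\<close>

text \<open>Degree-preserving injective homomorphism making \<open>S\<close> a finitely generated \<open>R\<close>-module.\<close>

definition finite_graded_extension ::
  "('a, 'm) ring_scheme \<Rightarrow> (nat \<Rightarrow> 'a set) \<Rightarrow> ('b, 'n) ring_scheme \<Rightarrow> (nat \<Rightarrow> 'b set) \<Rightarrow>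
     ('a \<Rightarrow> 'b) \<Rightarrow> bool" where
  "finite_graded_extension R G S G' \<phi> \<longleftrightarrow>
     graded_ring R G \<and> graded_ring S G' \<and>
     \<phi> \<in> ring_hom R S \<and> inj_on \<phi> (carrier R) \<and> (\<forall>k. \<phi> ` G k \<subseteq> G' k) \<and>
     (\<exists>Us. set Us \<subseteq> carrier S \<and> ring.Span S (\<phi> ` carrier R) Us = carrier S)"

text \<open>HOL cannot quantify over the type carrying the extension ring. No generality is lost by
  taking it to be \<^typ>\<open>'a list\<close>: a finite extension of \<open>R\<close> is a quotient set of some
  \<open>R\<^sup>n\<close>, so it has an isomorphic copy whose carrier consists of lists over \<open>R\<close>.\<close>

definition graded_plus_closure ::
  "('a, 'm) ring_scheme \<Rightarrow> (nat \<Rightarrow> 'a set) \<Rightarrow> 'a set \<Rightarrow> 'a set" where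
  "graded_plus_closure R G H = {x \<in> carrier R.
     \<exists>(S :: 'a list ring) G' \<phi>. finite_graded_extension R G S G' \<phi> \<and> \<phi> x \<in> Idl\<^bsub>S\<^esub> (\<phi> ` H)}"


section \<open>Well-definedness of the fraction field\<close>

context domain
begin

lemma equiv_frac_rel: "equiv (carrier R \<times> (carrier R - {\<zero>})) (frac_rel R)"
proof (rule equivI)
  show "frac_rel R \<subseteq> (carrier R \<times> (carrier R - {\<zero>})) \<times> (carrier R \<times> (carrier R - {\<zero>}))"
    by (auto simp: frac_rel_def)
  show "refl_on (carrier R \<times> (carrier R - {\<zero>})) (frac_rel R)"
    by (auto simp: refl_on_def frac_rel_def)
  show "sym (frac_rel R)"
    by (auto simp: sym_def frac_rel_def)
  show "trans (frac_rel R)"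
  proof (rule transI, clarify)
    fix a b c d u v
    assume 1: "((a, b), (c, d)) \<in> frac_rel R" and 2: "((c, d), (u, v)) \<in> frac_rel R"
    have mem: "a \<in> carrier R" "b \<in> carrier R" "c \<in> carrier R" "d \<in> carrier R" "u \<in> carrier R"
      "v \<in> carrier R" "d \<noteq> \<zero>"
      using 1 2 by (auto simp: frac_rel_def)
    have e1: "a \<otimes> d = c \<otimes> b" and e2: "c \<otimes> v = u \<otimes> d"
      using 1 2 by (auto simp: frac_rel_def)
    have "d \<otimes> (a \<otimes> v) = (a \<otimes> d) \<otimes> v" using mem by (simp add: m_ac)
    also have "\<dots> = (c \<otimes> v) \<otimes> b" using mem e1 by (simp add: m_ac)
    also have "\<dots> = d \<otimes> (u \<otimes> b)" using mem e2 by (simp add: m_ac)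
    finally have "a \<otimes> v = u \<otimes> b" using mem m_lcancel by simp
    with 1 2 show "((a, b), (u, v)) \<in> frac_rel R" by (auto simp: frac_rel_def)
  qed
qed

lemma frac_eq_iff:
  assumes "a \<in> carrier R" "b \<in> carrier R - {\<zero>}" "c \<in> carrier R" "d \<in> carrier R - {\<zero>}"
  shows "fraction R a b = fraction R c d \<longleftrightarrow> a \<otimes> d = c \<otimes> b"
  using eq_equiv_class_iff[OF equiv_frac_rel, of "(a, b)" "(c, d)"] assms
  by (auto simp: fraction_def frac_rel_def)

lemma frac_closed:
  "a \<in> carrier R \<Longrightarrow> b \<in> carrier R - {\<zero>} \<Longrightarrow> fraction R a b \<in> carrier (fraction_field R)"
  by (auto simp: fraction_field_def fraction_def intro: quotientI)

lemma fraction_fieldE: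
  assumes "x \<in> carrier (fraction_field R)"
  obtains a b where "a \<in> carrier R" "b \<in> carrier R - {\<zero>}" "x = fraction R a b"
  using assms by (auto simp: fraction_field_def fraction_def elim!: quotientE)

lemma mult_frac:
  assumes "a \<in> carrier R" "b \<in> carrier R - {\<zero>}" "c \<in> carrier R" "d \<in> carrier R - {\<zero>}"
  shows "fraction R a b \<otimes>\<^bsub>fraction_field R\<^esub> fraction R c d = fraction R (a \<otimes> c) (b \<otimes> d)"
proof -
  have "congruent2 (frac_rel R) (frac_rel R)
          (\<lambda>p q. fraction R (fst p \<otimes> fst q) (snd p \<otimes> snd q))"
  proof (rule congruent2I', clarsimp)
    fix a b a' b' c d c' d'
    assume 1: "((a, b), (a', b')) \<in> frac_rel R" and 2: "((c, d), (c', d')) \<in> frac_rel R"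
    have mem: "a \<in> carrier R" "b \<in> carrier R" "c \<in> carrier R" "d \<in> carrier R"
      "a' \<in> carrier R" "b' \<in> carrier R" "c' \<in> carrier R" "d' \<in> carrier R"
      "b \<noteq> \<zero>" "d \<noteq> \<zero>" "b' \<noteq> \<zero>" "d' \<noteq> \<zero>"
      using 1 2 by (auto simp: frac_rel_def)
    have e: "a \<otimes> b' = a' \<otimes> b" "c \<otimes> d' = c' \<otimes> d"
      using 1 2 by (auto simp: frac_rel_def)
    have "(a \<otimes> c) \<otimes> (b' \<otimes> d') = (a \<otimes> b') \<otimes> (c \<otimes> d')" using mem by (simp add: m_ac)
    also have "\<dots> = (a' \<otimes> c') \<otimes> (b \<otimes> d)" using mem unfolding e by (simp add: m_ac)
    finally show "fraction R (a \<otimes> c) (b \<otimes> d) = fraction R (a' \<otimes> c') (b' \<otimes> d')"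
      using mem by (subst frac_eq_iff) (auto simp: integral_iff)
  qed
  from UN_equiv_class2[OF equiv_frac_rel equiv_frac_rel this, of "(a, b)" "(c, d)"] assms
  show ?thesis by (simp add: fraction_field_def fraction_def)
qed

lemma add_frac:
  assumes "a \<in> carrier R" "b \<in> carrier R - {\<zero>}" "c \<in> carrier R" "d \<in> carrier R - {\<zero>}"
  shows "fraction R a b \<oplus>\<^bsub>fraction_field R\<^esub> fraction R c d = fraction R (a \<otimes> d \<oplus> c \<otimes> b) (b \<otimes> d)"
proof -
  have "congruent2 (frac_rel R) (frac_rel R)
          (\<lambda>p q. fraction R (fst p \<otimes> snd q \<oplus> fst q \<otimes> snd p) (snd p \<otimes> snd q))"
  proof (rule congruent2I', clarsimp)
    fix a b a' b' c d c' d'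
    assume 1: "((a, b), (a', b')) \<in> frac_rel R" and 2: "((c, d), (c', d')) \<in> frac_rel R"
    have mem: "a \<in> carrier R" "b \<in> carrier R" "c \<in> carrier R" "d \<in> carrier R"
      "a' \<in> carrier R" "b' \<in> carrier R" "c' \<in> carrier R" "d' \<in> carrier R"
      "b \<noteq> \<zero>" "d \<noteq> \<zero>" "b' \<noteq> \<zero>" "d' \<noteq> \<zero>"
      using 1 2 by (auto simp: frac_rel_def)
    have e: "a \<otimes> b' = a' \<otimes> b" "c \<otimes> d' = c' \<otimes> d"
      using 1 2 by (auto simp: frac_rel_def)
    have "(a \<otimes> d \<oplus> c \<otimes> b) \<otimes> (b' \<otimes> d') = (a \<otimes> b') \<otimes> (d \<otimes> d') \<oplus> (c \<otimes> d') \<otimes> (b \<otimes> b')"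
      using mem by (simp add: l_distr r_distr m_ac)
    also have "\<dots> = (a' \<otimes> d' \<oplus> c' \<otimes> b') \<otimes> (b \<otimes> d)"
      using mem unfolding e by (simp add: l_distr r_distr m_ac)
    finally show "fraction R (a \<otimes> d \<oplus> c \<otimes> b) (b \<otimes> d) = fraction R (a' \<otimes> d' \<oplus> c' \<otimes> b') (b' \<otimes> d')"
      using mem by (subst frac_eq_iff) (auto simp: integral_iff)
  qed
  from UN_equiv_class2[OF equiv_frac_rel equiv_frac_rel this, of "(a, b)" "(c, d)"] assms
  show ?thesis by (simp add: fraction_field_def fraction_def)
qed

lemma one_frac: "\<one>\<^bsub>fraction_field R\<^esub> = fraction R \<one> \<one>"
  and zero_frac: "\<zero>\<^bsub>fraction_field R\<^esub> = fraction R \<zero> \<one>"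
  by (simp_all add: fraction_field_def)

lemma field_fraction_field: "field (fraction_field R)"
proof (rule cring.cring_fieldI2)
  show "cring (fraction_field R)"
  proof (rule cringI)
    show "abelian_group (fraction_field R)"
    proof (rule abelian_groupI)
      fix x assume "x \<in> carrier (fraction_field R)"
      then obtain a b where ab: "a \<in> carrier R" "b \<in> carrier R - {\<zero>}" "x = fraction R a b"
        by (rule fraction_fieldE)
      have "fraction R (\<ominus> a) b \<oplus>\<^bsub>fraction_field R\<^esub> x = \<zero>\<^bsub>fraction_field R\<^esub>"
        using ab by (simp add: add_frac zero_frac frac_eq_iff integral_iff l_minus l_neg)
      moreover have "fraction R (\<ominus> a) b \<in> carrier (fraction_field R)"
        using ab by (intro frac_closed) auto
      ultimately show "\<exists>y\<in>carrier (fraction_field R).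
          y \<oplus>\<^bsub>fraction_field R\<^esub> x = \<zero>\<^bsub>fraction_field R\<^esub>" by blast
    next
      show "\<zero>\<^bsub>fraction_field R\<^esub> \<in> carrier (fraction_field R)"
        by (simp add: zero_frac frac_closed)
    next
      fix x y assume "x \<in> carrier (fraction_field R)" "y \<in> carrier (fraction_field R)"
      then show "x \<oplus>\<^bsub>fraction_field R\<^esub> y \<in> carrier (fraction_field R)"
        by (elim fraction_fieldE) (simp add: add_frac frac_closed integral_iff)
    qed (elim fraction_fieldE, simp add: add_frac zero_frac integral_iff
           l_distr r_distr m_ac a_ac)+
    show "comm_monoid (fraction_field R)"
    proof (rule comm_monoidI)
      show "\<one>\<^bsub>fraction_field R\<^esub> \<in> carrier (fraction_field R)"
        by (simp add: one_frac frac_closed)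
    next
      fix x y assume "x \<in> carrier (fraction_field R)" "y \<in> carrier (fraction_field R)"
      then show "x \<otimes>\<^bsub>fraction_field R\<^esub> y \<in> carrier (fraction_field R)"
        by (elim fraction_fieldE) (simp add: mult_frac frac_closed integral_iff)
    qed (elim fraction_fieldE, simp add: mult_frac one_frac integral_iff m_ac)+
  qed (elim fraction_fieldE, simp add: add_frac mult_frac frac_eq_iff integral_iff
         l_distr r_distr m_ac)
  show "\<zero>\<^bsub>fraction_field R\<^esub> \<noteq> \<one>\<^bsub>fraction_field R\<^esub>"
    by (simp add: one_frac zero_frac frac_eq_iff)
  fix x assume x: "x \<in> carrier (fraction_field R)" "x \<noteq> \<zero>\<^bsub>fraction_field R\<^esub>"
  from x(1) obtain a b where ab: "a \<in> carrier R" "b \<in> carrier R - {\<zero>}" "x = fraction R a b"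
    by (rule fraction_fieldE)
  with x(2) have "a \<noteq> \<zero>" by (auto simp: zero_frac frac_eq_iff)
  with ab have "x \<otimes>\<^bsub>fraction_field R\<^esub> fraction R b a = \<one>\<^bsub>fraction_field R\<^esub>"
    by (simp add: mult_frac one_frac frac_eq_iff integral_iff m_ac)
  moreover have "fraction R b a \<in> carrier (fraction_field R)"
    using ab \<open>a \<noteq> \<zero>\<close> by (intro frac_closed) auto
  ultimately show "\<exists>y\<in>carrier (fraction_field R). x \<otimes>\<^bsub>fraction_field R\<^esub> y = \<one>\<^bsub>fraction_field R\<^esub>"
    by blast
qed

lemma to_frac_hom: "to_frac R \<in> ring_hom R (fraction_field R)"
  by (rule ring_hom_memI)
    (auto simp: to_frac_def mult_frac add_frac one_frac intro: frac_closed)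

lemma inj_on_to_frac: "inj_on (to_frac R) (carrier R)"
  by (auto simp: inj_on_def to_frac_def frac_eq_iff)

end

end

(* The relation g = (g1, g2, g3) of f = (f1, f2, f3) has no common zero on the curve, so the syzygy
   bundle Syz(f)(m) is an extension of the line bundle O(2m - d1 - d2 - d3), of nonnegative degree,
   by the structure sheaf. An element f0 of degree m defines a class in the first cohomology of
   Syz(f)(m), and f0 lies in the ideal (f) as soon as this class vanishes. A class c in H^1(O(l)) with
   l >= 0 can be killed by a finite extension: H^1(O(l)) has finite dimension and is zero for large
   l, so c satisfies an additive equation P(c) = c^q + ... = 0 (Artin-Schreier for l = 0, a power
   of Frobenius for l > 0), that is P(c) = u - v for local sections u and v; a root T of P(T) = u is
   integral, and c = T - (T - c) becomes a coboundary. Doing this for the quotient line bundle and then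
   for the structure sheaf kills the class of f0.

   Everything takes place inside an algebraically closed field, which contains the fractions of degree
   0 of the curve: a graded ring is the family of its homogeneous components, dehomogenized. *)

theory Submission
  imports Defs "Jordan_Normal_Form.Char_Poly"
begin

section \<open>Graded algebras inside a field\<close>

text \<open>Two of the forms, called \<open>x\<close> and \<open>y\<close> below, generate the
  irrelevant ideal up to radical, so their two charts compute the cohomology: a class is one
  fraction modulo V_x + V_y, and finiteness over K[x,y] controls it. The obstacle is that the
  intermediate extensions are not known to be normal. An element regular on both charts need not lie
  in the algebra, and a root \<open>T\<close> of the additive equation is known to be integral only
  over the x-chart. Hence \<open>T\<close> is never adjoined; what is adjoined are corrected
  multiples \<open>\<gamma> * T + w\<close>, integral over both charts, and each only after the
  constant term of its monic equation, whose own integrality comes from Cayley-Hamilton on a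
  truncation. Every coordinate of a section costs a new extension, so killing a class is formulated
  uniformly in all later extensions. Inside one field these are increasing families of subspaces,
  and no quotients or compatibility maps appear. The price is paid at both ends: R has to be
  embedded through a generic point of the curve, and the last family has to be turned back into an
  abstract graded ring.\<close>

locale scalar_embedding =
  fixes \<kappa> :: "'k::field \<Rightarrow> 'o::alg_closed_field"
  assumes \<kappa>_add: "\<kappa> (u + v) = \<kappa> u + \<kappa> v"
    and \<kappa>_mult: "\<kappa> (u * v) = \<kappa> u * \<kappa> v"
    and \<kappa>_one [simp]: "\<kappa> 1 = 1"
begin

sublocale vs: Vector_Spaces.vector_space "\<lambda>c w. \<kappa> c * w"
  by unfold_locales (simp_all add: \<kappa>_add \<kappa>_mult algebra_simps)

lemma \<kappa>_zero [simp]: "\<kappa> 0 = 0"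
  using \<kappa>_add[of 0 0] by (metis add.right_neutral add_left_cancel)

lemma \<kappa>_minus: "\<kappa> (- u) = - \<kappa> u"
  using \<kappa>_add[of u "- u"] by (simp add: eq_neg_iff_add_eq_0 add.commute)

lemma subspaceI:
  assumes "0 \<in> S" "\<And>u v. u \<in> S \<Longrightarrow> v \<in> S \<Longrightarrow> u + v \<in> S" "\<And>c u. u \<in> S \<Longrightarrow> \<kappa> c * u \<in> S"
  shows "vs.subspace S"
  using assms by (auto simp: vs.subspace_def)

lemma subspace_vimage_mult:
  assumes "vs.subspace S"
  shows "vs.subspace {v. v * w \<in> S}"
  using vs.subspace_add[OF assms] vs.subspace_scale[OF assms] vs.subspace_0[OF assms]
  by (intro subspaceI) (auto simp: distrib_right mult.assoc)

lemma span_times: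
  assumes "v \<in> vs.span S" "vs.subspace T" "\<And>s. s \<in> S \<Longrightarrow> s * w \<in> T"
  shows "v * w \<in> T"
  using vs.span_minimal[OF _ subspace_vimage_mult[OF assms(2)], of S w] assms by blast

text \<open>Otherwise all initial segments are independent, and one of length
  \<open>Suc (card E)\<close> exceeds the dimension bound. The first dependence among the cohomology
  parts of the Frobenius powers of a class is what gives a monic additive equation.\<close>

lemma dependent_sequence:
  assumes "finite E" "\<And>i::nat. e i \<in> vs.span E"
  obtains n where "e n \<in> vs.span (e ` {..<n})"
proof -
  have "\<exists>n. e n \<in> vs.span (e ` {..<n})"
  proof (rule ccontr)
    assume *: "\<nexists>n. e n \<in> vs.span (e ` {..<n})"
    have "vs.independent (e ` {..<n}) \<and> card (e ` {..<n}) = n" for n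
    proof (induction n)
      case (Suc n)
      have "e n \<notin> e ` {..<n}" 
      proof
        assume "e n \<in> e ` {..<n}"
        then have "e n \<in> vs.span (e ` {..<n})" by (rule vs.span_base)
        with * show False by simp
      qed
      moreover have "vs.independent (insert (e n) (e ` {..<n}))"
        using Suc * by (intro vs.independent_insertI) auto
      ultimately show ?case using Suc by (simp add: lessThan_Suc)
    qed (simp add: vs.independent_empty)
    from this[of "Suc (card E)"] vs.independent_span_bound[OF assms(1), of "e ` {..<Suc (card E)}"]
    show False using assms(2) by auto
  qed
  with that show ?thesis by blast
qed

lemma span_image_lessThan:
  assumes "v \<in> vs.span (e ` {..<n::nat})"
  shows "\<exists>l. v = (\<Sum>i<n. \<kappa> (l i) * e i)"
  using assms
proof (induction n arbitrary: v)
  case (Suc n)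
  then obtain c where "v - \<kappa> c * e n \<in> vs.span (e ` {..<n})"
    by (auto simp: lessThan_Suc vs.span_breakdown_eq)
  with Suc.IH obtain l where l: "v - \<kappa> c * e n = (\<Sum>i<n. \<kappa> (l i) * e i)" by blast
  have "v = (\<Sum>i<Suc n. \<kappa> ((l(n := c)) i) * e i)"
    using l by (simp add: diff_eq_eq)
  then show ?case by blast
qed simp

text \<open>Components may overlap inside the field; the degree is carried by the index alone.
  Integer indices with zero components below 0 make shifts such as \<open>m - int dx\<close>
  meaningful without side conditions.\<close>

definition graded_algebra :: "(int \<Rightarrow> 'o set) \<Rightarrow> bool" where
  "graded_algebra V \<longleftrightarrow> (\<forall>k. vs.subspace (V k)) \<and> (\<forall>k<0. V k = {0}) \<and> 1 \<in> V 0 \<and>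
     (\<forall>i j. \<forall>u\<in>V i. \<forall>v\<in>V j. u * v \<in> V (i + j))"

text \<open>The degree \<open>k\<close> part of V[1/z] for \<open>z\<close> of degree
  \<open>d\<close>, that is, the sections of a twist over the chart where \<open>z\<close> is
  invertible.\<close>

definition localized :: "(int \<Rightarrow> 'o set) \<Rightarrow> 'o \<Rightarrow> nat \<Rightarrow> int \<Rightarrow> 'o set" where
  "localized V z d k = {w. \<exists>N. w * z ^ N \<in> V (k + int (N * d))}"

text \<open>Here \<open>w\<close> gets the degree \<open>k\<close>; it will satisfy a monic equation of degree \<open>r\<close>.\<close>

definition adjoin :: "(int \<Rightarrow> 'o set) \<Rightarrow> 'o \<Rightarrow> int \<Rightarrow> nat \<Rightarrow> int \<Rightarrow> 'o set" where
  "adjoin V w k r n = {\<Sum>j<r. v j * w ^ j | v. \<forall>j<r. v j \<in> V (n - int j * k)}"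

context
  fixes V assumes V: "graded_algebra V"
begin

lemma ga_subspace: "vs.subspace (V k)"
  and ga_neg: "k < 0 \<Longrightarrow> V k = {0}"
  and ga_one: "1 \<in> V 0"
  and ga_mult: "u \<in> V i \<Longrightarrow> v \<in> V j \<Longrightarrow> u * v \<in> V (i + j)"
  using V by (auto simp: graded_algebra_def)

lemma ga_mult': "u \<in> V i \<Longrightarrow> v \<in> V j \<Longrightarrow> n = i + j \<Longrightarrow> u * v \<in> V n"
  using ga_mult by blast

lemma ga_zero [simp]: "0 \<in> V k"
  and ga_add: "u \<in> V k \<Longrightarrow> v \<in> V k \<Longrightarrow> u + v \<in> V k"
  and ga_diff: "u \<in> V k \<Longrightarrow> v \<in> V k \<Longrightarrow> u - v \<in> V k"
  and ga_minus: "u \<in> V k \<Longrightarrow> - u \<in> V k"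
  and ga_scale: "u \<in> V k \<Longrightarrow> \<kappa> c * u \<in> V k"
  and ga_sum: "(\<And>i. i \<in> A \<Longrightarrow> f i \<in> V k) \<Longrightarrow> sum f A \<in> V k"
  using ga_subspace[of k]
  by (simp_all add: vs.subspace_0 vs.subspace_add vs.subspace_diff vs.subspace_neg
      vs.subspace_scale vs.subspace_sum)

lemma ga_power: "u \<in> V k \<Longrightarrow> n = int i * k \<Longrightarrow> u ^ i \<in> V n"
proof (induction i arbitrary: n)
  case (Suc i)
  have "u ^ i \<in> V (int i * k)" using Suc by blast
  from ga_mult'[OF Suc.prems(1) this] Suc.prems(2) show ?case by (simp add: algebra_simps)
qed (simp add: ga_one)

lemma subset_localized: "w \<in> V k \<Longrightarrow> w \<in> localized V z d k"
  unfolding localized_def by (auto intro: exI[of _ 0])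

context
  fixes z d assumes z: "z \<in> V (int d)"
begin

lemma localized_witness:
  assumes "w * z ^ N \<in> V (k + int (N * d))" "N \<le> M"
  shows "w * z ^ M \<in> V (k + int (M * d))"
proof -
  have "(w * z ^ N) * z ^ (M - N) \<in> V (k + int (M * d))"
    using assms by (intro ga_mult'[OF assms(1) ga_power[OF z refl]]) (simp add: algebra_simps of_nat_diff)
  then show ?thesis using assms(2) by (simp add: mult.assoc flip: power_add)
qed

lemma localizedE2:
  assumes "u \<in> localized V z d k" "v \<in> localized V z d l"
  obtains N where "u * z ^ N \<in> V (k + int (N * d))" "v * z ^ N \<in> V (l + int (N * d))"
proof -
  from assms obtain M N where *: "u * z ^ M \<in> V (k + int (M * d))" "v * z ^ N \<in> V (l + int (N * d))"
    by (auto simp: localized_def)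
  show ?thesis
    by (rule that[of "max M N"]; rule localized_witness) (use * in auto)
qed

lemma localized_subspace: "vs.subspace (localized V z d k)"
proof (rule subspaceI)
  show "0 \<in> localized V z d k" by (simp add: localized_def)
  fix u v assume "u \<in> localized V z d k" "v \<in> localized V z d k"
  then obtain N where "u * z ^ N \<in> V (k + int (N * d))" "v * z ^ N \<in> V (k + int (N * d))"
    by (rule localizedE2)
  from ga_add[OF this] show "u + v \<in> localized V z d k"
    by (auto simp: localized_def algebra_simps)
next
  fix c u assume "u \<in> localized V z d k"
  then show "\<kappa> c * u \<in> localized V z d k"
    unfolding localized_def using ga_scale[of _ _ c] by (auto simp: mult.assoc)
qed

lemma localized_mult:
  assumes "u \<in> localized V z d k" "v \<in> localized V z d l" "n = k + l"
  shows "u * v \<in> localized V z d n"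
proof -
  from assms(1,2) obtain N
    where "u * z ^ N \<in> V (k + int (N * d))" "v * z ^ N \<in> V (l + int (N * d))"
    by (rule localizedE2)
  from ga_mult'[OF this refl] show ?thesis
    using assms(3) by (auto simp: localized_def algebra_simps power_add intro!: exI[of _ "N + N"])
qed

lemma localized_power: "u \<in> localized V z d k \<Longrightarrow> n = int i * k \<Longrightarrow> u ^ i \<in> localized V z d n"
proof (induction i arbitrary: n)
  case 0
  then show ?case using subset_localized[OF ga_one] by simp
next
  case (Suc i)
  have "u ^ i \<in> localized V z d (int i * k)" using Suc by blast
  from localized_mult[OF Suc.prems(1) this] Suc.prems(2) show ?case by (simp add: algebra_simps)
qed

end

subsection \<open>Adjoining a root of a monic equation\<close>

lemma adjoin_subspace: "vs.subspace (adjoin V w k r n)"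
proof (rule subspaceI)
  show "0 \<in> adjoin V w k r n"
    unfolding adjoin_def by (auto intro!: exI[of _ "\<lambda>_. 0"])
  fix a b assume "a \<in> adjoin V w k r n" "b \<in> adjoin V w k r n"
  then obtain u v where "a = (\<Sum>j<r. u j * w ^ j)" "b = (\<Sum>j<r. v j * w ^ j)"
     "\<forall>j<r. u j \<in> V (n - int j * k)" "\<forall>j<r. v j \<in> V (n - int j * k)" by (auto simp: adjoin_def)
  then show "a + b \<in> adjoin V w k r n"
    unfolding adjoin_def
    by (auto intro!: exI[of _ "\<lambda>j. u j + v j"] ga_add simp: algebra_simps sum.distrib)
next
  fix c a assume "a \<in> adjoin V w k r n"
  then obtain u where "a = (\<Sum>j<r. u j * w ^ j)" "\<forall>j<r. u j \<in> V (n - int j * k)"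
    by (auto simp: adjoin_def)
  then show "\<kappa> c * a \<in> adjoin V w k r n"
    unfolding adjoin_def
    by (auto intro!: exI[of _ "\<lambda>j. \<kappa> c * u j"] ga_scale simp: sum_distrib_left mult.assoc)
qed

lemma adjoin_monom:
  assumes "j < r" "v \<in> V (n - int j * k)"
  shows "v * w ^ j \<in> adjoin V w k r n"
proof -
  have "v * w ^ j = (\<Sum>i<r. (if i = j then v else 0) * w ^ i)"
    using assms by (subst sum.mono_neutral_cong_right[of _ "{j}"]) auto
  then show ?thesis
    unfolding adjoin_def using assms by (auto intro!: exI[of _ "\<lambda>i. if i = j then v else 0"])
qed

context
  fixes w :: 'o and k :: int and r :: nat
  assumes k: "k \<ge> 0" and r: "r \<ge> 1" and root: "w ^ r \<in> adjoin V w k r (int r * k)"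
begin

lemma subset_adjoin: "v \<in> V n \<Longrightarrow> v \<in> adjoin V w k r n"
  using adjoin_monom[of 0 r v n k w] r by simp

lemma adjoin_mult_base:
  assumes "u \<in> V i" "v \<in> adjoin V w k r j" "n = i + j"
  shows "u * v \<in> adjoin V w k r n"
proof -
  from assms(2) obtain f where f: "v = (\<Sum>l<r. f l * w ^ l)" "\<forall>l<r. f l \<in> V (j - int l * k)"
    by (auto simp: adjoin_def)
  have "u * v = (\<Sum>l<r. (u * f l) * w ^ l)" by (simp add: f sum_distrib_left mult.assoc)
  also have "\<dots> \<in> adjoin V w k r n"
    by (intro vs.subspace_sum adjoin_subspace adjoin_monom) (use assms f in \<open>auto intro!: ga_mult'\<close>)
  finally show ?thesis .
qed

text \<open>Shifting the powers of \<open>w\<close> leaves the admissible range only at the top,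
  where \<open>root\<close> rewrites \<open>w ^ r\<close>. The equation is any homogeneous monic
  one, so the first \<open>r\<close> powers span but may be dependent.\<close>

lemma adjoin_mult_gen:
  assumes "v \<in> adjoin V w k r j" "n = j + k"
  shows "w * v \<in> adjoin V w k r n"
proof -
  from assms(1) obtain f where f: "v = (\<Sum>l<r. f l * w ^ l)" "\<forall>l<r. f l \<in> V (j - int l * k)"
    by (auto simp: adjoin_def)
  have "w * v = (\<Sum>l<r. f l * w ^ Suc l)" by (simp add: f sum_distrib_left mult_ac)
  also have "\<dots> \<in> adjoin V w k r n"
  proof (intro vs.subspace_sum adjoin_subspace)
    fix l assume l: "l \<in> {..<r}"
    show "f l * w ^ Suc l \<in> adjoin V w k r n"
    proof (cases "Suc l < r")
      case True
      then show ?thesis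
        using f l assms(2) by (intro adjoin_monom) (auto simp: algebra_simps)
    next
      case False
      with l have "Suc l = r" by simp
      then have "f l * w ^ r \<in> adjoin V w k r n"
        using f l assms(2) by (intro adjoin_mult_base[OF _ root]) (auto simp: algebra_simps)
      with \<open>Suc l = r\<close> show ?thesis by simp
    qed
  qed
  finally show ?thesis .
qed

lemma adjoin_mult:
  assumes "u \<in> adjoin V w k r i" "v \<in> adjoin V w k r j" "n = i + j"
  shows "u * v \<in> adjoin V w k r n"
proof -
  have pow: "w ^ l * v \<in> adjoin V w k r (j + int l * k)" for l
  proof (induction l)
    case (Suc l)
    from adjoin_mult_gen[OF this refl] show ?case by (simp add: algebra_simps)
  qed (use assms in simp)
  from assms(1) obtain f where f: "u = (\<Sum>l<r. f l * w ^ l)" "\<forall>l<r. f l \<in> V (i - int l * k)"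
    by (auto simp: adjoin_def)
  have "u * v = (\<Sum>l<r. f l * (w ^ l * v))" by (simp add: f sum_distrib_right mult.assoc)
  also have "\<dots> \<in> adjoin V w k r n"
    by (intro vs.subspace_sum adjoin_subspace adjoin_mult_base[OF _ pow]) (use assms f in auto)
  finally show ?thesis .
qed

lemma generator_in_adjoin: "w \<in> adjoin V w k r k"
  using adjoin_mult_gen[OF subset_adjoin[OF ga_one], of k] by simp

lemma adjoin_graded_algebra: "graded_algebra (adjoin V w k r)"
  unfolding graded_algebra_def
proof (intro conjI allI impI ballI)
  fix n :: int assume "n < 0"
  \<comment> \<open>Since the generator has degree \<open>k \<ge> 0\<close>, an element of negative
    degree can only have coefficients of negative degree.\<close>
  have V0: "V (n - int j * k) = {0}" for j
  proof (rule ga_neg)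
    have "0 \<le> int j * k" using k by simp
    with \<open>n < 0\<close> show "n - int j * k < 0" by linarith
  qed
  have "a = 0" if "a \<in> adjoin V w k r n" for a
  proof -
    from that obtain f where "a = (\<Sum>l<r. f l * w ^ l)" "\<forall>l<r. f l \<in> V (n - int l * k)"
      by (auto simp: adjoin_def)
    then show ?thesis unfolding V0 by simp
  qed
  with vs.subspace_0[OF adjoin_subspace[of w k r n]] show "adjoin V w k r n = {0}"
    by auto
next
  show "1 \<in> adjoin V w k r 0" by (rule subset_adjoin[OF ga_one])
next
  fix i j u v assume "u \<in> adjoin V w k r i" "v \<in> adjoin V w k r j"
  then show "u * v \<in> adjoin V w k r (i + j)" by (rule adjoin_mult) (rule refl)
next
  show "vs.subspace (adjoin V w k r n)" for n by (rule adjoin_subspace)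
qed

end

end

end

subsection \<open>Finite algebras over two parameters\<close>

text \<open>\<open>x\<close> and \<open>y\<close> will be the values of two of the three forms; the
  ring they generate acts as a Noether normalization. Positive degrees allow descent on the degree
  of a monomial, and positive characteristic makes Frobenius powers additive.\<close>

locale two_parameters = scalar_embedding \<kappa>
  for \<kappa> :: "'k::field \<Rightarrow> 'o::alg_closed_field" +
  fixes x y :: 'o and dx dy :: nat
  assumes x_nz: "x \<noteq> 0" and y_nz: "y \<noteq> 0"
    and dx_pos: "dx > 0" and dy_pos: "dy > 0"
    and char_pos: "CHAR('o) > 0"
begin

text \<open>A spanning set for degree \<open>k\<close> of the K[x,y]-module generated by
  \<open>B\<close>. Generators are stored together with a degree because an element of the field
  does not determine one.\<close>

definition monomials :: "('o \<times> nat) set \<Rightarrow> int \<Rightarrow> 'o set" where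
  "monomials B k = {x ^ i * y ^ j * w | i j w \<delta>. (w, \<delta>) \<in> B \<and> int (i * dx + j * dy + \<delta>) = k}"

definition finite_algebra :: "(int \<Rightarrow> 'o set) \<Rightarrow> bool" where
  "finite_algebra V \<longleftrightarrow> graded_algebra V \<and> x \<in> V (int dx) \<and> y \<in> V (int dy) \<and>
     (\<exists>B. finite B \<and> (\<forall>(w, \<delta>)\<in>B. w \<in> V (int \<delta>)) \<and> (\<forall>k. V k \<subseteq> vs.span (monomials B k)))"

lemma finite_algebraE:
  assumes "finite_algebra V"
  obtains B where "finite B" "\<And>w \<delta>. (w, \<delta>) \<in> B \<Longrightarrow> w \<in> V (int \<delta>)"
    "\<And>k. V k \<subseteq> vs.span (monomials B k)"
  using assms by (auto simp: finite_algebra_def)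

lemma finite_algebraD:
  assumes "finite_algebra V"
  shows "graded_algebra V" "x \<in> V (int dx)" "y \<in> V (int dy)"
  using assms by (auto simp: finite_algebra_def)

lemma monomial_mem:
  assumes V: "graded_algebra V" "x \<in> V (int dx)" "y \<in> V (int dy)"
    and w: "w \<in> V l" "n = int (i * dx + j * dy) + l"
  shows "x ^ i * y ^ j * w \<in> V n"
  by (rule ga_mult'[OF V(1) ga_mult'[OF V(1) ga_power[OF V(1) V(2) refl] ga_power[OF V(1) V(3) refl] refl] w(1)])
     (simp add: w(2))

lemma adjoin_finite_algebra:
  assumes V: "finite_algebra V" and k: "k \<ge> 0" and r: "r \<ge> 1"
    and root: "w ^ r \<in> adjoin V w k r (int r * k)"
  shows "finite_algebra (adjoin V w k r)"
proof -
  note ga = finite_algebraD[OF V]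
  obtain B where B: "finite B" "\<And>w \<delta>. (w, \<delta>) \<in> B \<Longrightarrow> w \<in> V (int \<delta>)"
    "\<And>k. V k \<subseteq> vs.span (monomials B k)" using finite_algebraE[OF V] by metis
  define B' where "B' = (\<lambda>((b, \<delta>), j). (b * w ^ j, \<delta> + j * nat k)) ` (B \<times> {..<r})"
  have "adjoin V w k r n \<subseteq> vs.span (monomials B' n)" for n
  proof
    fix a assume "a \<in> adjoin V w k r n"
    then obtain v where v: "a = (\<Sum>j<r. v j * w ^ j)" "\<And>j. j < r \<Longrightarrow> v j \<in> V (n - int j * k)"
      by (auto simp: adjoin_def)
    show "a \<in> vs.span (monomials B' n)"
      unfolding v(1)
    proof (rule vs.span_sum)
      fix j assume j: "j \<in> {..<r}"
      with v(2) B(3) have "v j \<in> vs.span (monomials B (n - int j * k))" by blast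
      then show "v j * w ^ j \<in> vs.span (monomials B' n)"
      proof (rule span_times)
        fix s assume "s \<in> monomials B (n - int j * k)"
        then obtain i1 i2 b \<delta> where s: "s = x ^ i1 * y ^ i2 * b" "(b, \<delta>) \<in> B"
          "int (i1 * dx + i2 * dy + \<delta>) = n - int j * k" by (auto simp: monomials_def)
        have "(b * w ^ j, \<delta> + j * nat k) \<in> B'" using s j by (force simp: B'_def)
        moreover have "s * w ^ j = x ^ i1 * y ^ i2 * (b * w ^ j)" by (simp add: s)
        moreover have "int (i1 * dx + i2 * dy + (\<delta> + j * nat k)) = n" using s(3) k by simp
        ultimately have "s * w ^ j \<in> monomials B' n" unfolding monomials_def by blast
        then show "s * w ^ j \<in> vs.span (monomials B' n)" by (rule vs.span_base)
      qed simp
    qed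
  qed
  moreover have "finite B'" using B(1) by (simp add: B'_def)
  moreover have "c \<in> adjoin V w k r (int \<delta>)" if "(c, \<delta>) \<in> B'" for c \<delta>
  proof -
    from that obtain b \<delta>' j where "(b, \<delta>') \<in> B" "j < r" "c = b * w ^ j" "\<delta> = \<delta>' + j * nat k"
      by (auto simp: B'_def)
    then show ?thesis
      using adjoin_monom[OF ga(1), of j r b "int \<delta>"] B(2) k by simp
  qed
  ultimately show ?thesis
    unfolding finite_algebra_def
    using adjoin_graded_algebra[OF ga(1) k r root] subset_adjoin[OF ga(1) k r root] ga by blast
qed

subsection \<open>A Cayley--Hamilton argument\<close>

text \<open>In each Leibniz term the shifts \<open>\<epsilon> i\<close> and
  \<open>\<epsilon> (p i)\<close> cancel in total, because \<open>p\<close> permutes the indices.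
  \<open>W\<close> stays abstract so that it can be a grading of polynomials whose variable has a
  degree of its own.\<close>

lemma graded_det:
  fixes M :: "'o poly mat" and W :: "int \<Rightarrow> 'o poly set" and \<epsilon> :: "nat \<Rightarrow> int"
  assumes M: "M \<in> carrier_mat n n"
    and entries: "\<And>i j. i < n \<Longrightarrow> j < n \<Longrightarrow> M $$ (i, j) \<in> W (l + \<epsilon> i - \<epsilon> j)"
    and zero: "\<And>k. 0 \<in> W k" and one: "1 \<in> W 0"
    and add: "\<And>k p q. p \<in> W k \<Longrightarrow> q \<in> W k \<Longrightarrow> p + q \<in> W k"
    and minus: "\<And>k p. p \<in> W k \<Longrightarrow> - p \<in> W k"
    and mult: "\<And>i j p q. p \<in> W i \<Longrightarrow> q \<in> W j \<Longrightarrow> p * q \<in> W (i + j)"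
  shows "det M \<in> W (int n * l)"
proof -
  have sum: "sum f A \<in> W k" if "finite A" "\<And>a. a \<in> A \<Longrightarrow> f a \<in> W k" for f k and A :: "(nat \<Rightarrow> nat) set"
    using that by (induction A rule: finite_induct) (auto intro: zero add)
  have prod: "prod f A \<in> W (sum g A)" if "finite A" "\<And>a. a \<in> A \<Longrightarrow> f a \<in> W (g a)"
    for f g and A :: "nat set"
    using that by (induction A rule: finite_induct) (auto intro: one mult)
  have "signof p * (\<Prod>i = 0..<n. M $$ (i, p i)) \<in> W (int n * l)" if p: "p permutes {0..<n}" for p
  proof -
    have "(\<Prod>i = 0..<n. M $$ (i, p i)) \<in> W (\<Sum>i = 0..<n. l + \<epsilon> i - \<epsilon> (p i))"
      using p by (intro prod entries) (auto dest: permutes_in_image)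
    also have "(\<Sum>i = 0..<n. l + \<epsilon> i - \<epsilon> (p i)) = int n * l"
      using sum.permute[OF p, of \<epsilon>] by (simp add: sum_subtractf sum.distrib)
    finally show ?thesis
      by (cases p rule: sign_cases) (auto intro: minus)
  qed
  then show ?thesis
    unfolding det_def'[OF M] by (intro sum) (auto simp: finite_permutations)
qed

text \<open>\<open>t\<close> is an eigenvalue of the matrix of the \<open>c i j\<close> with
  eigenvector \<open>g\<close>, so its characteristic polynomial is a monic equation for
  \<open>t\<close>; the shifts \<open>\<epsilon>\<close> make that polynomial homogeneous.\<close>

lemma integral_of_stable_module:
  fixes g :: "nat \<Rightarrow> 'o" and \<epsilon> :: "nat \<Rightarrow> int" and c :: "nat \<Rightarrow> nat \<Rightarrow> 'o"
  assumes V: "graded_algebra V"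
    and c: "\<And>i j. i < n \<Longrightarrow> j < n \<Longrightarrow> c i j \<in> V (l + \<epsilon> i - \<epsilon> j)"
    and eq: "\<And>i. i < n \<Longrightarrow> t * g i = (\<Sum>j<n. c i j * g j)"
    and nz: "i0 < n" "g i0 \<noteq> 0"
  shows "t ^ n \<in> adjoin V t l n (int n * l)"
proof -
  define C where "C = mat n n (\<lambda>(i, j). c i j)"
  \<comment> \<open>Polynomials homogeneous of degree \<open>k\<close> when the variable is given
    the degree \<open>l\<close> of \<open>t\<close>.\<close>
  define W where "W k = {q :: 'o poly. \<forall>j. coeff q j \<in> V (k - int j * l)}" for k
  have C: "C \<in> carrier_mat n n" by (simp add: C_def)
  have "eigenvector C (vec n g) t"
    unfolding eigenvector_def
  proof (intro conjI)
    show "vec n g \<in> carrier_vec (dim_row C)" using C by simp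
    show "vec n g \<noteq> 0\<^sub>v (dim_row C)"
      using nz C by (metis carrier_matD(1) index_vec index_zero_vec(1))
    show "C *\<^sub>v vec n g = t \<cdot>\<^sub>v vec n g"
      by (rule eq_vecI) (auto simp: C_def scalar_prod_def eq lessThan_atLeast0)
  qed
  then have "eigenvalue C t" by (auto simp: eigenvalue_def)
  then have root: "poly (char_poly C) t = 0" using eigenvalue_root_char_poly[OF C] by simp
  have deg: "degree (char_poly C) = n" "coeff (char_poly C) n = 1"
    using degree_monic_char_poly[OF C] by auto
  have mult: "p * q \<in> W (i + j)" if "p \<in> W i" "q \<in> W j" for i j p q
  proof -
    have "(\<Sum>a\<le>m. coeff p a * coeff q (m - a)) \<in> V (i + j - int m * l)" for m
    proof (rule ga_sum[OF V])
      fix a assume "a \<in> {..m}"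
      then have "i + j - int m * l = (i - int a * l) + (j - int (m - a) * l)"
        by (simp add: of_nat_diff algebra_simps)
      with that show "coeff p a * coeff q (m - a) \<in> V (i + j - int m * l)"
        unfolding W_def by (auto intro: ga_mult'[OF V])
    qed
    then show ?thesis by (simp add: W_def coeff_mult)
  qed
  have "char_poly C \<in> W (int n * l)"
    unfolding char_poly_def
  proof (rule graded_det[where \<epsilon> = \<epsilon>])
    show "char_poly_matrix C \<in> carrier_mat n n" using C by simp
    fix i j assume ij: "i < n" "j < n"
    have "[:0, 1:] \<in> W l"
      using ga_one[OF V] ga_zero[OF V] by (auto simp: W_def coeff_pCons split: nat.splits)
    moreover have "[:- c i j:] \<in> W (l + \<epsilon> i - \<epsilon> j)"
      using c[OF ij] ga_minus[OF V] ga_zero[OF V] by (auto simp: W_def coeff_pCons split: nat.splits)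
    moreover have "char_poly_matrix C $$ (i, j) = (if i = j then [:0, 1:] else 0) + [:- c i j:]"
      using ij by (simp add: char_poly_matrix_def C_def)
    ultimately show "char_poly_matrix C $$ (i, j) \<in> W (l + \<epsilon> i - \<epsilon> j)"
      using ga_add[OF V] by (auto simp: W_def simp del: add_pCons)
  qed (use ga_zero[OF V] ga_add[OF V] ga_minus[OF V] ga_one[OF V] mult in
      \<open>auto simp: W_def coeff_1\<close>)
  then have co: "coeff (char_poly C) j \<in> V (int n * l - int j * l)" for j by (simp add: W_def)
  have "0 = (\<Sum>j\<le>n. coeff (char_poly C) j * t ^ j)"
    using root deg(1) by (simp add: poly_altdef)
  also have "\<dots> = (\<Sum>j<n. coeff (char_poly C) j * t ^ j) + t ^ n"
    using deg by (simp add: lessThan_Suc_atMost[symmetric])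
  finally have "t ^ n = (\<Sum>j<n. - coeff (char_poly C) j * t ^ j)"
    by (simp add: sum_negf eq_neg_iff_add_eq_0 add.commute)
  then show ?thesis
    unfolding adjoin_def using co ga_minus[OF V] by (auto intro!: exI[of _ "\<lambda>j. - coeff (char_poly C) j"])
qed

text \<open>Such a \<open>t\<close> need not lie in \<open>V\<close>, but it multiplies all
  components of large degree back into \<open>V\<close>. As \<open>l \<ge> 0\<close>, it therefore
  preserves the truncation of \<open>V\<close> to degrees at least \<open>M\<close>. This is a
  finitely generated nonzero module, so Cayley-Hamilton makes \<open>t\<close> integral.\<close>

lemma extend_by_localized_element:
  assumes V: "finite_algebra V" and l: "l \<ge> 0"
    and tx: "t \<in> localized V x dx l" and ty: "t \<in> localized V y dy l"
  obtains V' where "finite_algebra V'" "\<And>k. V k \<subseteq> V' k" "t \<in> V' l"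
proof -
  note ga = finite_algebraD[OF V]
  obtain B where B: "finite B" "\<And>w \<delta>. (w, \<delta>) \<in> B \<Longrightarrow> w \<in> V (int \<delta>)"
    "\<And>k. V k \<subseteq> vs.span (monomials B k)" using finite_algebraE[OF V] by metis
  from tx ty obtain N1 N2 where "t * x ^ N1 \<in> V (l + int (N1 * dx))" "t * y ^ N2 \<in> V (l + int (N2 * dy))"
    by (auto simp: localized_def)
  then obtain N where N: "t * x ^ N \<in> V (l + int (N * dx))" "t * y ^ N \<in> V (l + int (N * dy))"
    using localized_witness[OF ga(1,2), of t N1 l "max N1 N2"]
      localized_witness[OF ga(1,3), of t N2 l "max N1 N2"] by auto
  obtain \<Delta> where \<Delta>: "\<And>w \<delta>. (w, \<delta>) \<in> B \<Longrightarrow> \<delta> \<le> \<Delta>"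
    using finite_nat_set_iff_bounded_le[of "snd ` B"] B(1) by force
  \<comment> \<open>At most \<open>\<Delta>\<close> of the degree of
    \<open>x ^ i * y ^ j * w\<close> comes from \<open>w\<close>. In degree at least
    \<open>M\<close> this forces \<open>N \<le> i\<close> or \<open>N \<le> j\<close>, so
    \<open>t * x ^ N\<close> or \<open>t * y ^ N\<close> can be split off from the product with
    \<open>t\<close>.\<close>
  define M where "M = N * (dx + dy) + \<Delta>"
  \<comment> \<open>Removing one factor \<open>x\<close> or \<open>y\<close> lowers the degree by
    \<open>dx\<close> or \<open>dy\<close>, so the descent from any higher degree ends inside this
    window; its monomials generate the truncation.\<close>
  define G where "G = {(x ^ i * y ^ j * w, i * dx + j * dy + \<delta>) | i j w \<delta>.
    (w, \<delta>) \<in> B \<and> M \<le> i * dx + j * dy + \<delta> \<and> i * dx + j * dy + \<delta> \<le> M + dx + dy}"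
  have "G \<subseteq> (\<lambda>(i, j, w, \<delta>). (x ^ i * y ^ j * w, i * dx + j * dy + \<delta>)) ` ({..M + dx + dy} \<times> {..M + dx + dy} \<times> B)"
  proof
    fix p assume "p \<in> G"
    then obtain i j w \<delta> where p: "p = (x ^ i * y ^ j * w, i * dx + j * dy + \<delta>)" "(w, \<delta>) \<in> B"
      "i * dx + j * dy + \<delta> \<le> M + dx + dy" by (auto simp: G_def)
    have "i * 1 \<le> i * dx" "j * 1 \<le> j * dy" using dx_pos dy_pos by (auto intro!: mult_le_mono2)
    with p(3) have "i \<le> M + dx + dy" "j \<le> M + dx + dy" by linarith+
    with p show "p \<in> (\<lambda>(i, j, w, \<delta>). (x ^ i * y ^ j * w, i * dx + j * dy + \<delta>)) ` ({..M + dx + dy} \<times> {..M + dx + dy} \<times> B)"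
      by (auto intro!: image_eqI[of _ _ "(i, j, w, \<delta>)"])
  qed
  then have "finite G" by (rule finite_subset) (simp add: B(1))
  then obtain xs where xs: "set xs = G" using finite_list by blast
  define n where "n = length xs"
  define g where "g i = fst (xs ! i)" for i
  define \<epsilon> where "\<epsilon> i = int (snd (xs ! i))" for i
  have G_nth: "\<exists>i<n. g i = w \<and> \<epsilon> i = int \<delta>" if "(w, \<delta>) \<in> G" for w \<delta>
    using that unfolding xs[symmetric] by (auto simp: in_set_conv_nth n_def g_def \<epsilon>_def)
  have nth_G: "(g i, nat (\<epsilon> i)) \<in> G" if "i < n" for i
    using that unfolding xs[symmetric] by (auto simp: n_def g_def \<epsilon>_def)
  have decompose: "\<exists>a b i' j'. i = a + i' \<and> j = b + j' \<and> (x ^ i' * y ^ j' * w, i' * dx + j' * dy + \<delta>) \<in> G"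
    if "(w, \<delta>) \<in> B" "M \<le> i * dx + j * dy + \<delta>" for i j w \<delta>
    using that
  proof (induction "i + j" arbitrary: i j rule: less_induct)
    case less
    show ?case
    proof (cases "i * dx + j * dy + \<delta> \<le> M + dx + dy")
      case True
      then show ?thesis using less.prems by (intro exI[of _ 0] exI[of _ i] exI[of _ j]) (auto simp: G_def)
    next
      case False
      show ?thesis
      proof (cases i)
        case (Suc i')
        have "M \<le> i' * dx + j * dy + \<delta>" using False Suc by simp
        from less.hyps[OF _ less.prems(1) this] Suc obtain a b i'' j'' where
          "i' = a + i''" "j = b + j''" "(x ^ i'' * y ^ j'' * w, i'' * dx + j'' * dy + \<delta>) \<in> G" by auto
        with Suc show ?thesis by (intro exI[of _ "Suc a"] exI[of _ b] exI[of _ i''] exI[of _ j'']) auto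
      next
        case 0
        show ?thesis
        proof (cases j)
          case 0
          have "\<delta> \<le> M" using \<Delta>[OF less.prems(1)] by (simp add: M_def)
          with False 0 \<open>i = 0\<close> show ?thesis by simp
        next
          case (Suc j')
          have "M \<le> i * dx + j' * dy + \<delta>" using False Suc by simp
          from less.hyps[OF _ less.prems(1) this] Suc obtain a b i'' j'' where
            "i = a + i''" "j' = b + j''" "(x ^ i'' * y ^ j'' * w, i'' * dx + j'' * dy + \<delta>) \<in> G" by auto
          with Suc show ?thesis by (intro exI[of _ a] exI[of _ "Suc b"] exI[of _ i''] exI[of _ j'']) auto
        qed
      qed
    qed
  qed
  have combination: "\<exists>c. (\<forall>j<n. c j \<in> V (k - \<epsilon> j)) \<and> u = (\<Sum>j<n. c j * g j)" if "u \<in> V k" "k \<ge> int M" for u k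
  proof -
    let ?S = "{u. \<exists>c. (\<forall>j<n. c j \<in> V (k - \<epsilon> j)) \<and> u = (\<Sum>j<n. c j * g j)}"
    have "vs.subspace ?S"
    proof (rule subspaceI)
      show "0 \<in> ?S" using ga_zero[OF ga(1)] by (auto intro!: exI[of _ "\<lambda>_. 0"])
      fix a b assume "a \<in> ?S" "b \<in> ?S"
      then obtain u v where "a = (\<Sum>j<n. u j * g j)" "b = (\<Sum>j<n. v j * g j)"
        "\<forall>j<n. u j \<in> V (k - \<epsilon> j)" "\<forall>j<n. v j \<in> V (k - \<epsilon> j)" by auto
      then show "a + b \<in> ?S"
        by (auto intro!: exI[of _ "\<lambda>j. u j + v j"] ga_add[OF ga(1)] simp: algebra_simps sum.distrib)
    next
      fix c a assume "a \<in> ?S"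
      then obtain u where "a = (\<Sum>j<n. u j * g j)" "\<forall>j<n. u j \<in> V (k - \<epsilon> j)" by auto
      then show "\<kappa> c * a \<in> ?S"
        by (auto intro!: exI[of _ "\<lambda>j. \<kappa> c * u j"] ga_scale[OF ga(1)] simp: sum_distrib_left mult.assoc)
    qed
    moreover have "monomials B k \<subseteq> ?S"
    proof
      fix s assume "s \<in> monomials B k"
      then obtain i j w \<delta> where s: "s = x ^ i * y ^ j * w" "(w, \<delta>) \<in> B" "int (i * dx + j * dy + \<delta>) = k"
        by (auto simp: monomials_def)
      then have "M \<le> i * dx + j * dy + \<delta>" using that(2) by linarith
      from decompose[OF s(2) this] obtain a b i' j' where ab: "i = a + i'" "j = b + j'"
        "(x ^ i' * y ^ j' * w, i' * dx + j' * dy + \<delta>) \<in> G" by blast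
      from G_nth[OF ab(3)] obtain m where m: "m < n" "g m = x ^ i' * y ^ j' * w"
        "\<epsilon> m = int (i' * dx + j' * dy + \<delta>)" by blast
      have "x ^ a * y ^ b * 1 \<in> V (k - \<epsilon> m)"
        using m s(3) ab(1,2) by (intro monomial_mem[OF ga(1,2,3) ga_one[OF ga(1)]]) (auto simp: algebra_simps)
      moreover have "s = (\<Sum>j<n. (if j = m then x ^ a * y ^ b else 0) * g j)"
        using m ab(1,2) s(1)
        by (subst sum.mono_neutral_cong_right[of _ "{m}"]) (auto simp: power_add mult_ac)
      ultimately show "s \<in> ?S"
        using ga_zero[OF ga(1)] by (auto intro!: exI[of _ "\<lambda>j. if j = m then x ^ a * y ^ b else 0"])
    qed
    ultimately have "vs.span (monomials B k) \<subseteq> ?S" by (intro vs.span_minimal)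
    with that(1) B(3) show ?thesis by blast
  qed
  have stable: "g i * t \<in> V (\<epsilon> i + l)" if "i < n" for i
  proof -
    from nth_G[OF that] obtain i1 i2 w \<delta> where w: "(w, \<delta>) \<in> B" "g i = x ^ i1 * y ^ i2 * w"
      "nat (\<epsilon> i) = i1 * dx + i2 * dy + \<delta>" "M \<le> nat (\<epsilon> i)" by (auto simp: G_def)
    have \<epsilon>: "\<epsilon> i = int (i1 * dx + i2 * dy + \<delta>)" using w(3) by (simp add: \<epsilon>_def)
    have "N * dx + N * dy \<le> i1 * dx + i2 * dy"
      using w(3,4) \<Delta>[OF w(1)] by (simp add: M_def algebra_simps)
    then have "N \<le> i1 \<or> N \<le> i2"
      using dx_pos dy_pos by (metis add_strict_mono linorder_not_le mult_less_mono1)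
    then show ?thesis
    proof
      assume "N \<le> i1"
      then obtain a where a: "i1 = a + N" using le_Suc_ex by (metis add.commute)
      have "x ^ a * y ^ i2 * (w * (t * x ^ N)) \<in> V (\<epsilon> i + l)"
        by (rule monomial_mem[OF ga ga_mult[OF ga(1) B(2)[OF w(1)] N(1)]])
           (simp add: \<epsilon> a algebra_simps)
      then show ?thesis by (simp add: w(2) a power_add mult_ac)
    next
      assume "N \<le> i2"
      then obtain a where a: "i2 = a + N" using le_Suc_ex by (metis add.commute)
      have "x ^ i1 * y ^ a * (w * (t * y ^ N)) \<in> V (\<epsilon> i + l)"
        by (rule monomial_mem[OF ga ga_mult[OF ga(1) B(2)[OF w(1)] N(2)]])
           (simp add: \<epsilon> a algebra_simps)
      then show ?thesis by (simp add: w(2) a power_add mult_ac)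
    qed
  qed
  have "\<exists>c. (\<forall>j<n. c j \<in> V (l + \<epsilon> i - \<epsilon> j)) \<and> t * g i = (\<Sum>j<n. c j * g j)" if "i < n" for i
  proof -
    have "M \<le> nat (\<epsilon> i)" using nth_G[OF that] by (auto simp: G_def)
    moreover have "\<epsilon> i \<ge> 0" by (simp add: \<epsilon>_def)
    ultimately have "int M \<le> l + \<epsilon> i" using l by linarith
    then show ?thesis
      using combination[of "g i * t" "l + \<epsilon> i"] stable[OF that] by (simp add: mult.commute add.commute)
  qed
  then obtain c where c: "\<And>i j. i < n \<Longrightarrow> j < n \<Longrightarrow> c i j \<in> V (l + \<epsilon> i - \<epsilon> j)"
    "\<And>i. i < n \<Longrightarrow> t * g i = (\<Sum>j<n. c i j * g j)" by metis
  \<comment> \<open>An eigenvector must be nonzero: \<open>x ^ M\<close> is nonzero, has degree at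
    least \<open>M\<close> because \<open>dx > 0\<close>, and is a combination of the
    \<open>g j\<close>.\<close>
  have "\<exists>i0<n. g i0 \<noteq> 0"
  proof (rule ccontr)
    assume *: "\<not> ?thesis"
    have "int M \<le> int M * int dx" using dx_pos by (simp add: mult_le_cancel_left1)
    from combination[OF ga_power[OF ga(1,2) refl] this] obtain c where "x ^ M = (\<Sum>j<n. c j * g j)" by blast
    also have "\<dots> = 0" using * by (intro sum.neutral) auto
    finally show False using x_nz by simp
  qed
  then obtain i0 where i0: "i0 < n" "g i0 \<noteq> 0" by blast
  have root: "t ^ n \<in> adjoin V t l n (int n * l)"
    by (rule integral_of_stable_module[OF ga(1) c i0])
  have "n \<ge> 1" using i0 by simp
  show ?thesis
    by (rule that[OF adjoin_finite_algebra[OF V l \<open>n \<ge> 1\<close> root]])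
       (use subset_adjoin[OF ga(1) l \<open>n \<ge> 1\<close> root] generator_in_adjoin[OF ga(1) l \<open>n \<ge> 1\<close> root] in auto)
qed

subsection \<open>Killing cohomology classes\<close>

text \<open>A fraction of degree \<open>k\<close> represents a class in \<open>H\<^sup>2\<^sub>(\<^sub>x\<^sub>,\<^sub>y\<^sub>)(V)\<^sub>k\<close>, the quotient of \<open>V\<^sub>x\<^sub>y\<close> by
  \<open>V\<^sub>x + V\<^sub>y\<close>. In nonnegative degrees this space has finite dimension, and it is zero
  in large degrees.\<close>

lemma localized_decomposition:
  assumes V: "finite_algebra V"
  obtains E \<Delta> where "finite E"
    "\<And>k s v. k \<ge> 0 \<Longrightarrow> v \<in> V (k + int (s * (dx + dy))) \<Longrightarrow>
       \<exists>e\<in>vs.span (if k \<le> int \<Delta> then E else {}). \<exists>u\<in>localized V x dx k. \<exists>w\<in>localized V y dy k.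
         v / (x * y) ^ s = e + u + w"
proof -
  note ga = finite_algebraD[OF V]
  obtain B where B: "finite B" "\<And>w \<delta>. (w, \<delta>) \<in> B \<Longrightarrow> w \<in> V (int \<delta>)"
    "\<And>k. V k \<subseteq> vs.span (monomials B k)" using finite_algebraE[OF V] by metis
  obtain \<Delta> where \<Delta>: "\<And>w \<delta>. (w, \<delta>) \<in> B \<Longrightarrow> \<delta> \<le> \<Delta>"
    using finite_nat_set_iff_bounded_le[of "snd ` B"] B(1) by force
  define E where "E = (\<lambda>((w, \<delta>), i, j). w / (x ^ i * y ^ j)) ` (B \<times> {..\<Delta>} \<times> {..\<Delta>})"
  show ?thesis
  proof (rule that[of E \<Delta>])
    show "finite E" using B(1) by (simp add: E_def)
    fix k :: int and s v assume k: "k \<ge> 0" and v: "v \<in> V (k + int (s * (dx + dy)))"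
    define F where "F = (if k \<le> int \<Delta> then E else {})"
    let ?W1 = "localized V x dx k" and ?W2 = "localized V y dy k"
    from v B(3) have "v \<in> vs.span (monomials B (k + int (s * (dx + dy))))" by blast
    then have "v * inverse ((x * y) ^ s) \<in> vs.span (F \<union> (?W1 \<union> ?W2))"
    proof (rule span_times)
      fix m assume "m \<in> monomials B (k + int (s * (dx + dy)))"
      then obtain i j w \<delta> where m: "m = x ^ i * y ^ j * w" "(w, \<delta>) \<in> B"
        "int (i * dx + j * dy + \<delta>) = k + int (s * (dx + dy))" by (auto simp: monomials_def)
      let ?g = "m * inverse ((x * y) ^ s)"
      consider "s \<le> j" | "s \<le> i" | "i < s" "j < s" by linarith
      then have "?g \<in> F \<union> (?W1 \<union> ?W2)"
      proof cases
        case 1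
        then obtain a where a: "j = s + a" using le_Suc_ex by blast
        have "x ^ i * y ^ a * w \<in> V (k + int (s * dx))"
          using m(3) a by (intro monomial_mem[OF ga B(2)[OF m(2)]]) (simp add: algebra_simps)
        moreover have "?g * x ^ s = x ^ i * y ^ a * w"
          using x_nz y_nz by (simp add: m(1) a power_mult_distrib power_add field_simps)
        ultimately have "?g * x ^ s \<in> V (k + int (s * dx))" by simp
        then show ?thesis unfolding localized_def by blast
      next
        case 2
        then obtain a where a: "i = s + a" using le_Suc_ex by blast
        have "x ^ a * y ^ j * w \<in> V (k + int (s * dy))"
          using m(3) a by (intro monomial_mem[OF ga B(2)[OF m(2)]]) (simp add: algebra_simps)
        moreover have "?g * y ^ s = x ^ a * y ^ j * w"
          using x_nz y_nz by (simp add: m(1) a power_mult_distrib power_add field_simps)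
        ultimately have "?g * y ^ s \<in> V (k + int (s * dy))" by simp
        then show ?thesis unfolding localized_def by blast
      next
        \<comment> \<open>Both variables survive in the denominator. The degree equation reads k =
          \<delta> - a dx - b dy, and \<open>k \<ge> 0\<close> then bounds \<open>a\<close>,
          \<open>b\<close> and \<open>k\<close> by \<open>\<Delta>\<close>; only these fractions
          contribute to \<open>E\<close>.\<close>
        case 3
        then obtain a b where ab: "s = i + a" "s = j + b" using less_imp_le_nat le_Suc_ex by metis
        have "s * dx = i * dx + a * dx" "s * dy = j * dy + b * dy"
          using ab by (metis add_mult_distrib)+
        then have \<delta>: "int \<delta> = k + int (a * dx + b * dy)"
          using m(3) by (simp add: algebra_simps)
        have "a * 1 \<le> a * dx" "b * 1 \<le> b * dy" using dx_pos dy_pos by (auto intro!: mult_le_mono2)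
        with \<delta> k \<Delta>[OF m(2)] have "a \<le> \<Delta>" "b \<le> \<Delta>" "k \<le> int \<Delta>" by linarith+
        moreover have "?g = w / (x ^ a * y ^ b)"
        proof -
          have "x ^ s = x ^ i * x ^ a" "y ^ s = y ^ j * y ^ b" using ab by (metis power_add)+
          then show ?thesis using x_nz y_nz by (simp add: m(1) power_mult_distrib field_simps)
        qed
        ultimately have "?g \<in> E" unfolding E_def using m(2)
          by (intro image_eqI[of _ _ "((w, \<delta>), a, b)"]) auto
        with \<open>k \<le> int \<Delta>\<close> show ?thesis by (simp add: F_def)
      qed
      then show "?g \<in> vs.span (F \<union> (?W1 \<union> ?W2))" by (rule vs.span_base)
    qed simp
    then obtain e u w where "e \<in> vs.span F" "u \<in> vs.span ?W1" "w \<in> vs.span ?W2"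
      "v / (x * y) ^ s = e + (u + w)"
      unfolding vs.span_Un by (auto simp: divide_inverse)
    moreover have "vs.span ?W1 = ?W1" "vs.span ?W2 = ?W2"
      using localized_subspace[OF ga(1,2)] localized_subspace[OF ga(1,3)] by (auto simp: vs.span_eq_iff)
    ultimately show "\<exists>e\<in>vs.span (if k \<le> int \<Delta> then E else {}). \<exists>u\<in>?W1. \<exists>w\<in>?W2. v / (x * y) ^ s = e + u + w"
      unfolding F_def by (metis add.assoc)
  qed
qed

text \<open>Each Frobenius power of \<open>c\<close> splits into a cohomology part
  \<open>e i\<close> and two chart parts. A linear relation among the \<open>e i\<close>, applied to
  the powers of \<open>c\<close>, leaves only chart parts. For \<open>l > 0\<close> these powers lie
  in different degrees and no relation with scalar coefficients mixes them homogeneously, hence the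
  condition that all \<open>\<mu> i\<close> vanish.\<close>

lemma additive_equation:
  assumes V: "finite_algebra V" and l: "l \<ge> 0"
    and c: "c * (x * y) ^ s \<in> V (l + int (s * (dx + dy)))"
  shows "\<exists>n \<mu> u v. (l > 0 \<longrightarrow> (\<forall>i. \<mu> i = 0)) \<and>
    c ^ (CHAR('o) ^ n) + (\<Sum>i<n. \<kappa> (\<mu> i) * c ^ (CHAR('o) ^ i)) = u - v \<and>
    u \<in> localized V x dx (int (CHAR('o) ^ n) * l) \<and> v \<in> localized V y dy (int (CHAR('o) ^ n) * l)"
proof -
  let ?p = "CHAR('o)"
  note ga = finite_algebraD[OF V]
  obtain E \<Delta> where E: "finite E"
    "\<And>k s v. k \<ge> 0 \<Longrightarrow> v \<in> V (k + int (s * (dx + dy))) \<Longrightarrow>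
       \<exists>e\<in>vs.span (if k \<le> int \<Delta> then E else {}). \<exists>u\<in>localized V x dx k. \<exists>w\<in>localized V y dy k.
         v / (x * y) ^ s = e + u + w"
    using localized_decomposition[OF V] by metis
  have "\<exists>e\<in>vs.span (if int (?p ^ i) * l \<le> int \<Delta> then E else {}).
      \<exists>u\<in>localized V x dx (int (?p ^ i) * l). \<exists>w\<in>localized V y dy (int (?p ^ i) * l).
        c ^ (?p ^ i) = e + u + w" for i
  proof -
    have "(c * (x * y) ^ s) ^ (?p ^ i) \<in> V (int (?p ^ i) * l + int ((s * ?p ^ i) * (dx + dy)))"
      by (rule ga_power[OF ga(1) c]) (simp add: algebra_simps)
    from E(2)[OF _ this] l
    show ?thesis using x_nz y_nz by (simp add: power_mult_distrib flip: power_mult)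
  qed
  then obtain e u w where *: "\<And>i. e i \<in> vs.span (if int (?p ^ i) * l \<le> int \<Delta> then E else {})"
    "\<And>i. u i \<in> localized V x dx (int (?p ^ i) * l)" "\<And>i. w i \<in> localized V y dy (int (?p ^ i) * l)"
    "\<And>i. c ^ (?p ^ i) = e i + u i + w i" by metis
  show ?thesis
  proof (cases "l = 0")
    case True
    have "e i \<in> vs.span E" for i using *(1)[of i] True by simp
    then obtain n where "e n \<in> vs.span (e ` {..<n})" using dependent_sequence[OF E(1)] by metis
    then obtain m where m: "e n = (\<Sum>i<n. \<kappa> (m i) * e i)" using span_image_lessThan by blast
    note W = localized_subspace[OF ga(1,2)] localized_subspace[OF ga(1,3)]
    show ?thesis
    proof (rule exI[of _ n], rule exI[of _ "\<lambda>i. - m i"],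
        rule exI[of _ "u n - (\<Sum>i<n. \<kappa> (m i) * u i)"],
        rule exI[of _ "- (w n - (\<Sum>i<n. \<kappa> (m i) * w i))"], intro conjI)
      show "u n - (\<Sum>i<n. \<kappa> (m i) * u i) \<in> localized V x dx (int (?p ^ n) * l)"
        using *(2) True by (auto intro!: vs.subspace_diff vs.subspace_sum vs.subspace_scale W)
      show "- (w n - (\<Sum>i<n. \<kappa> (m i) * w i)) \<in> localized V y dy (int (?p ^ n) * l)"
        using *(3) True by (auto intro!: vs.subspace_neg vs.subspace_diff vs.subspace_sum vs.subspace_scale W)
      show "c ^ (?p ^ n) + (\<Sum>i<n. \<kappa> (- m i) * c ^ (?p ^ i)) =
          u n - (\<Sum>i<n. \<kappa> (m i) * u i) - - (w n - (\<Sum>i<n. \<kappa> (m i) * w i))"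
        by (simp add: *(4) m \<kappa>_minus sum_negf sum_subtractf distrib_left sum.distrib)
    qed (use True in simp)
  next
    case False
    \<comment> \<open>With the exponent \<open>Suc \<Delta>\<close> the degree
      \<open>?p ^ Suc \<Delta> * l\<close> exceeds \<open>\<Delta>\<close>, beyond which the
      cohomology part is zero.\<close>
    have "2 ^ Suc \<Delta> \<le> ?p ^ Suc \<Delta>"
      using prime_ge_2_nat[OF prime_CHAR_semidom[OF char_pos]] by (intro power_mono) auto
    then have "\<Delta> < ?p ^ Suc \<Delta>" using less_exp[of "Suc \<Delta>"] by linarith
    moreover have "int (?p ^ Suc \<Delta>) * 1 \<le> int (?p ^ Suc \<Delta>) * l"
      using False l by (intro mult_left_mono) auto
    ultimately have "\<not> int (?p ^ Suc \<Delta>) * l \<le> int \<Delta>" by linarith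
    then have "e (Suc \<Delta>) = 0" using *(1)[of "Suc \<Delta>"] by simp
    show ?thesis
    proof (rule exI[of _ "Suc \<Delta>"], rule exI[of _ "\<lambda>_. 0"],
        rule exI[of _ "u (Suc \<Delta>)"], rule exI[of _ "- w (Suc \<Delta>)"], intro conjI)
      show "- w (Suc \<Delta>) \<in> localized V y dy (int (?p ^ Suc \<Delta>) * l)"
        by (rule vs.subspace_neg[OF localized_subspace[OF ga(1,3)] *(3)])
    qed (use \<open>e (Suc \<Delta>) = 0\<close> *(2,4)[of "Suc \<Delta>"] in simp_all)
  qed
qed

text \<open>A class of nonnegative degree dies in a finite extension: \<open>T\<close> is a root of the additive
  equation satisfied by the class \<open>c\<close>, so \<open>T\<close> is integral over \<open>V\<^sub>x\<close> and \<open>T - c\<close> over \<open>V\<^sub>y\<close>.\<close>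

definition kills :: "(int \<Rightarrow> 'o set) \<Rightarrow> 'o \<Rightarrow> int \<Rightarrow> 'o \<Rightarrow> bool" where
  "kills V c l T \<longleftrightarrow> (\<forall>V' \<gamma> j w. finite_algebra V' \<longrightarrow> (\<forall>k. V k \<subseteq> V' k) \<longrightarrow> \<gamma> \<in> V' j \<longrightarrow> j + l \<ge> 0 \<longrightarrow>
     w \<in> localized V' x dx (j + l) \<longrightarrow> w + \<gamma> * c \<in> localized V' y dy (j + l) \<longrightarrow>
     (\<exists>V''. finite_algebra V'' \<and> (\<forall>k. V' k \<subseteq> V'' k) \<and> \<gamma> * T + w \<in> V'' (j + l)))"

text \<open>\<open>w\<close> and \<open>w + \<gamma> * c\<close> are the expressions of one
  coordinate of a section on the two charts, and \<open>\<gamma> * T\<close> is the correction that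
  glues them. Since \<open>V'\<close> is arbitrary, one \<open>T\<close> serves several coordinates
  in succession, each over the extension made for the previous one.\<close>

lemma killsE:
  assumes "kills V c l T" "finite_algebra V'" "\<And>k. V k \<subseteq> V' k" "\<gamma> \<in> V' j" "n = j + l" "n \<ge> 0"
    "w \<in> localized V' x dx n" "w + \<gamma> * c \<in> localized V' y dy n"
  obtains V'' where "finite_algebra V''" "\<And>k. V' k \<subseteq> V'' k" "\<gamma> * T + w \<in> V'' n"
  using assms unfolding kills_def by blast

text \<open>The element \<open>\<gamma> * T + w\<close> equals
  \<open>\<gamma> * (T - c) + (w + \<gamma> * c)\<close>: the first form shows that it is integral
  over the x-chart, the second over the y-chart. A version of the additive polynomial homogenized by
  \<open>\<gamma>\<close> gives the same monic equation on both.\<close>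

lemma kill_class:
  assumes V: "finite_algebra V" and l: "l \<ge> 0"
    and c: "c * (x * y) ^ s \<in> V (l + int (s * (dx + dy)))"
  shows "\<exists>T. kills V c l T"
proof -
  let ?p = "CHAR('o)"
  note prime = prime_CHAR_semidom[OF char_pos]
  obtain n \<mu> u v where \<mu>: "l > 0 \<longrightarrow> (\<forall>i. \<mu> i = 0)"
    and eq: "c ^ (?p ^ n) + (\<Sum>i<n. \<kappa> (\<mu> i) * c ^ (?p ^ i)) = u - v"
    and u: "u \<in> localized V x dx (int (?p ^ n) * l)" and v: "v \<in> localized V y dy (int (?p ^ n) * l)"
    using additive_equation[OF V l c] by blast
  define q where "q = ?p ^ n"
  have q: "q \<ge> 1" using char_pos by (simp add: q_def Suc_leI)
  have pi: "?p ^ i < q" if "i < n" for i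
    using that prime_ge_2_nat[OF prime] by (simp add: q_def)
  define P where "P z = z ^ q + (\<Sum>i<n. \<kappa> (\<mu> i) * z ^ (?p ^ i))" for z
  \<comment> \<open>\<open>Q \<gamma>\<close> is \<open>P\<close> homogenized by
    \<open>\<gamma>\<close>, so that \<open>Q \<gamma> (\<gamma> * z) = \<gamma> ^ q * P z\<close>.
    Scalars have degree 0, so the mixed terms have the degree of the leading one exactly when
    \<open>l = 0\<close>; for \<open>l > 0\<close> their coefficients vanish.\<close>
  define Q where "Q \<gamma> z = z ^ q + (\<Sum>i<n. \<kappa> (\<mu> i) * \<gamma> ^ (q - ?p ^ i) * z ^ (?p ^ i))" for \<gamma> z
  note additive = freshmans_dream'[OF prime refl]
  have P_add: "P (a + b) = P a + P b" for a b
    by (simp add: P_def q_def additive distrib_left sum.distrib)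
  have Q_add: "Q \<gamma> (\<gamma> * a + b) = \<gamma> ^ q * P a + Q \<gamma> b" for \<gamma> a b
  proof -
    have "\<kappa> (\<mu> i) * \<gamma> ^ (q - ?p ^ i) * (\<gamma> * a + b) ^ (?p ^ i) =
        \<gamma> ^ q * (\<kappa> (\<mu> i) * a ^ (?p ^ i)) + \<kappa> (\<mu> i) * \<gamma> ^ (q - ?p ^ i) * b ^ (?p ^ i)" if "i < n" for i
    proof -
      have "\<gamma> ^ q = \<gamma> ^ (q - ?p ^ i) * \<gamma> ^ (?p ^ i)"
        using pi[OF that] by (simp flip: power_add)
      then show ?thesis by (simp add: additive power_mult_distrib algebra_simps)
    qed
    then have "(\<Sum>i<n. \<kappa> (\<mu> i) * \<gamma> ^ (q - ?p ^ i) * (\<gamma> * a + b) ^ (?p ^ i)) =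
        \<gamma> ^ q * (\<Sum>i<n. \<kappa> (\<mu> i) * a ^ (?p ^ i)) + (\<Sum>i<n. \<kappa> (\<mu> i) * \<gamma> ^ (q - ?p ^ i) * b ^ (?p ^ i))"
      by (simp add: sum.distrib sum_distrib_left)
    then show ?thesis
      by (simp add: P_def Q_def q_def additive power_mult_distrib distrib_left)
  qed
  have "\<exists>T. P T = u"
  proof -
    define f where "f = monom 1 q + (\<Sum>i<n. monom (\<kappa> (\<mu> i)) (?p ^ i)) - [:u:]"
    have ne: "?p ^ i \<noteq> q" if "i < n" for i using pi[OF that] by simp
    have "coeff f q = 1"
      using q ne by (auto simp: f_def coeff_sum coeff_pCons split: nat.splits intro!: sum.neutral)
    then have "degree f > 0" using q le_degree[of f q] by simp
    then obtain T where "poly f T = 0" using alg_closed_imp_poly_has_root by blast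
    then have "P T = u" by (simp add: f_def P_def poly_monom poly_sum)
    then show ?thesis ..
  qed
  then obtain T where T: "P T = u" ..
  have Tc: "P (T - c) = v"
    using P_add[of "T - c" c] T eq by (simp add: P_def[of c] q_def)
  show ?thesis
    unfolding kills_def
  proof (intro exI[of _ T] allI impI)
    fix V' \<gamma> j w
    assume V': "finite_algebra V'" "\<forall>k. V k \<subseteq> V' k" and \<gamma>: "\<gamma> \<in> V' j" and jl: "j + l \<ge> 0"
      and w: "w \<in> localized V' x dx (j + l)" "w + \<gamma> * c \<in> localized V' y dy (j + l)"
    note ga = finite_algebraD[OF V'(1)]
    have loc_mono: "localized V z d k \<subseteq> localized V' z d k" for z d k
      using V'(2) by (auto simp: localized_def)
    have deg: "int (q - ?p ^ i) * j + int (?p ^ i) * (j + l) = int q * (j + l)" if "i < n" "l = 0" for i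
      using pi[OF that(1)] that(2) by (simp add: of_nat_diff algebra_simps)
    have Q_localized: "Q \<gamma> (\<gamma> * a + b) \<in> localized V' z d (int q * (j + l))"
      if z: "z \<in> V' (int d)" and a: "P a \<in> localized V z d (int q * l)"
        and b: "b \<in> localized V' z d (j + l)" for z d a b
    proof -
      note S = localized_subspace[OF ga(1) z]
      have "\<gamma> ^ q * P a \<in> localized V' z d (int q * (j + l))"
        using a loc_mono
        by (intro localized_mult[OF ga(1) z subset_localized[OF ga(1) ga_power[OF ga(1) \<gamma> refl]]])
          (auto simp: algebra_simps)
      moreover have "b ^ q \<in> localized V' z d (int q * (j + l))"
        by (rule localized_power[OF ga(1) z b refl])
      moreover have "\<kappa> (\<mu> i) * \<gamma> ^ (q - ?p ^ i) * b ^ (?p ^ i) \<in> localized V' z d (int q * (j + l))"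
        if "i < n" for i
      proof (cases "l = 0")
        case True
        have "\<gamma> ^ (q - ?p ^ i) * b ^ (?p ^ i) \<in> localized V' z d (int q * (j + l))"
          by (rule localized_mult[OF ga(1) z subset_localized[OF ga(1) ga_power[OF ga(1) \<gamma> refl]]
                localized_power[OF ga(1) z b refl]]) (simp only: deg[OF that True])
        from vs.subspace_scale[OF S this] show ?thesis by (simp add: mult.assoc)
      next
        case False
        with \<mu> l have "\<mu> i = 0" by simp
        then show ?thesis using vs.subspace_0[OF S] by simp
      qed
      ultimately show ?thesis
        unfolding Q_add unfolding Q_def
        by (intro vs.subspace_add[OF S] vs.subspace_sum[OF S]) auto
    qed
    let ?t = "\<gamma> * T + w"
    have Qx: "Q \<gamma> ?t \<in> localized V' x dx (int q * (j + l))"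
      using u by (intro Q_localized[OF ga(2) _ w(1)]) (simp add: T q_def)
    have "Q \<gamma> (\<gamma> * (T - c) + (w + \<gamma> * c)) \<in> localized V' y dy (int q * (j + l))"
      using v by (intro Q_localized[OF ga(3) _ w(2)]) (simp add: Tc q_def)
    then have Qy: "Q \<gamma> ?t \<in> localized V' y dy (int q * (j + l))" by (simp add: algebra_simps)
    have "int q * (j + l) \<ge> 0" using jl by simp
    \<comment> \<open>\<open>Q \<gamma> ?t\<close> is regular on both charts although
      \<open>?t\<close> itself need not be. Once this value has been adjoined, \<open>?t\<close> is
      a root of the monic equation Q \<gamma> Z = Q \<gamma> ?t of degree \<open>q\<close>.\<close>
    from extend_by_localized_element[OF V'(1) this Qx Qy] obtain V1 where V1: "finite_algebra V1" "\<And>k. V' k \<subseteq> V1 k" "Q \<gamma> ?t \<in> V1 (int q * (j + l))"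
      by blast
    note ga1 = finite_algebraD[OF V1(1)]
    let ?A = "adjoin V1 ?t (j + l) q"
    have S: "vs.subspace (?A (int q * (j + l)))" by (rule adjoin_subspace[OF ga1(1)])
    have "Q \<gamma> ?t \<in> ?A (int q * (j + l))"
      using adjoin_monom[OF ga1(1), of 0 q "Q \<gamma> ?t" "int q * (j + l)" "j + l" ?t] q V1(3) by simp
    moreover have "\<kappa> (\<mu> i) * \<gamma> ^ (q - ?p ^ i) * ?t ^ (?p ^ i) \<in> ?A (int q * (j + l))" if "i < n" for i
    proof (cases "l = 0")
      case True
      have "\<gamma> ^ (q - ?p ^ i) \<in> V1 (int q * (j + l) - int (?p ^ i) * (j + l))"
        using deg[OF that True] \<gamma> V1(2) by (intro ga_power[OF ga1(1), of _ j]) auto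
      then have "\<gamma> ^ (q - ?p ^ i) * ?t ^ (?p ^ i) \<in> ?A (int q * (j + l))"
        by (rule adjoin_monom[OF ga1(1) pi[OF that]])
      from vs.subspace_scale[OF S this] show ?thesis by (simp add: mult.assoc)
    next
      case False
      with \<mu> l have "\<mu> i = 0" by simp
      then show ?thesis using vs.subspace_0[OF S] by simp
    qed
    ultimately have "Q \<gamma> ?t - (\<Sum>i<n. \<kappa> (\<mu> i) * \<gamma> ^ (q - ?p ^ i) * ?t ^ (?p ^ i)) \<in> ?A (int q * (j + l))"
      by (intro vs.subspace_diff[OF S] vs.subspace_sum[OF S]) auto
    then have root: "?t ^ q \<in> ?A (int q * (j + l))" by (simp add: Q_def)
    show "\<exists>V''. finite_algebra V'' \<and> (\<forall>k. V' k \<subseteq> V'' k) \<and> ?t \<in> V'' (j + l)"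
      using adjoin_finite_algebra[OF V1(1) jl q root] V1(2) subset_adjoin[OF ga1(1) jl q root]
        generator_in_adjoin[OF ga1(1) jl q root]
      by (intro exI[of _ ?A]) blast
  qed
qed

subsection \<open>The syzygy bundle\<close>

text \<open>The syzygy \<open>g\<close> of \<open>f = (x, y, f3)\<close> gives \<open>0 \<rightarrow> \<O> \<rightarrow> Syz(f)(m) \<rightarrow> \<O>(2m - d1 - d2 - d3) \<rightarrow> 0\<close>. The
  quotient map sends a solution \<open>\<alpha>\<close> of \<open>\<alpha> \<cdot> f = f0\<close> to the cross product \<open>h = \<alpha> \<times> g\<close>, which
  satisfies \<open>h \<cdot> g = 0\<close> and \<open>h \<times> f = f0 g\<close>. So one first kills the class \<open>c\<close> obstructing \<open>h\<close>,
  then the class \<open>c'\<close> obstructing the solution \<open>\<alpha>\<close> of \<open>\<alpha> \<times> g = h\<close>.\<close>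

lemma extend_to_solution:
  fixes m d3 :: int
  assumes V: "finite_algebra V"
    and f3: "f3 \<in> V d3" and g: "g1 \<in> V (m - int dx)" "g2 \<in> V (m - int dy)" "g3 \<in> V (m - d3)"
    and rel: "x * g1 + y * g2 + f3 * g3 = 0"
    and a: "a1 \<in> V (int (N * dx) - (m - int dx))" "a2 \<in> V (int (N * dx) - (m - int dy))"
       "a3 \<in> V (int (N * dx) - (m - d3))" "x ^ N = a1 * g1 + a2 * g2 + a3 * g3"
    and b: "b1 \<in> V (int (N * dy) - (m - int dx))" "b2 \<in> V (int (N * dy) - (m - int dy))"
       "b3 \<in> V (int (N * dy) - (m - d3))" "y ^ N = b1 * g1 + b2 * g2 + b3 * g3"
    and m: "m \<ge> int dx" "m \<ge> int dy" "m \<ge> d3" "2 * m \<ge> int dx + int dy + d3"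
    and f0: "f0 \<in> V m"
  obtains V' \<alpha>1 \<alpha>2 \<alpha>3 where "finite_algebra V'" "\<And>k. V k \<subseteq> V' k"
    "\<alpha>1 \<in> V' (m - int dx)" "\<alpha>2 \<in> V' (m - int dy)" "\<alpha>3 \<in> V' (m - d3)"
    "f0 = \<alpha>1 * x + \<alpha>2 * y + \<alpha>3 * f3"
proof -
  note gaV = finite_algebraD[OF V]
  define l where "l = 2 * m - int dx - int dy - d3"
  \<comment> \<open>On the two charts (f0/x, 0, 0) and (0, f0/y, 0) solve the equation. By
    \<open>rel\<close>, their cross products with g differ by \<open>c\<close> times the vector (x,
    y, f3).\<close>
  define c where "c = f0 * g3 / (x * y)"
  have "c * (x * y) ^ 1 \<in> V (l + int (1 * (dx + dy)))"
    using ga_mult[OF gaV(1) f0 g(3)] x_nz y_nz by (simp add: c_def l_def)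
  moreover have "l \<ge> 0" using m(4) by (simp add: l_def)
  ultimately obtain T where T: "kills V c l T" using kill_class[OF V] by blast
  have divided: "v / z ^ n \<in> localized W z d k" if "v \<in> W (k + int (n * d))" "z \<noteq> 0" for v z n W d k
    using that by (auto simp: localized_def intro!: exI[of _ n])
  \<comment> \<open>h is the cross product of (f0/x, 0, 0) with g, corrected by \<open>T\<close>
    times (x, y, f3). Its coordinates thus have the form \<open>\<gamma> * T + w\<close> with
    \<open>\<gamma>\<close> equal to \<open>x\<close>, \<open>y\<close> and
    \<open>f3\<close>.\<close>
  define h1 where "h1 = x * T"
  define h2 where "h2 = y * T - f0 * g3 / x"
  define h3 where "h3 = f3 * T + f0 * g2 / x"
  have "f0 * g3 / y ^ 1 \<in> localized V y dy (int dx + l)"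
    using ga_mult'[OF gaV(1) f0 g(3)] by (intro divided y_nz) (simp add: l_def)
  then have "0 + x * c \<in> localized V y dy (int dx + l)" using x_nz y_nz by (simp add: c_def)
  moreover have "0 \<in> localized V x dx (int dx + l)"
    using subset_localized[OF gaV(1) ga_zero[OF gaV(1)]] .
  moreover have "int dx + l \<ge> 0" using m by (simp add: l_def)
  ultimately obtain V1 where V1: "finite_algebra V1" "\<And>k. V k \<subseteq> V1 k" "x * T + 0 \<in> V1 (int dx + l)"
    using killsE[OF T V order_refl gaV(2) refl] by metis
  note ga1 = finite_algebraD[OF V1(1)]
  have "f0 * g3 \<in> V1 (m + (m - d3))" using V1(2) ga_mult[OF gaV(1) f0 g(3)] by blast
  then have "- (f0 * g3) / x ^ 1 \<in> localized V1 x dx (int dy + l)"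
    using ga_minus[OF ga1(1)] by (intro divided x_nz) (simp add: l_def)
  moreover have "0 \<in> localized V1 y dy (int dy + l)"
    using subset_localized[OF ga1(1) ga_zero[OF ga1(1)]] .
  then have "- (f0 * g3) / x ^ 1 + y * c \<in> localized V1 y dy (int dy + l)"
    using x_nz y_nz by (simp add: c_def)
  moreover have "int dy + l \<ge> 0" using m by (simp add: l_def)
  ultimately obtain V2 where V2: "finite_algebra V2" "\<And>k. V1 k \<subseteq> V2 k"
    "y * T + - (f0 * g3) / x ^ 1 \<in> V2 (int dy + l)"
    using killsE[OF T V1(1,2) ga1(3) refl] by metis
  note ga2 = finite_algebraD[OF V2(1)]
  have VV2: "V k \<subseteq> V2 k" for k using V1(2) V2(2) by blast
  have "f0 * g2 \<in> V2 (m + (m - int dy))" using VV2 ga_mult[OF gaV(1) f0 g(2)] by blast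
  then have "f0 * g2 / x ^ 1 \<in> localized V2 x dx (d3 + l)"
    by (intro divided x_nz) (simp add: l_def)
  moreover have "f0 * g2 / x ^ 1 + f3 * c \<in> localized V2 y dy (d3 + l)"
  proof -
    have "f0 * g1 \<in> V2 (m + (m - int dx))" using VV2 ga_mult[OF gaV(1) f0 g(1)] by blast
    then have "- (f0 * g1) / y ^ 1 \<in> localized V2 y dy (d3 + l)"
      using ga_minus[OF ga2(1)] by (intro divided y_nz) (simp add: l_def)
    moreover have "f0 * g2 / x ^ 1 + f3 * c = f0 * (y * g2 + f3 * g3) / (x * y)"
      using x_nz y_nz by (simp add: c_def field_simps)
    moreover have "y * g2 + f3 * g3 = - (x * g1)"
      using rel by (simp add: eq_neg_iff_add_eq_0 add_ac)
    ultimately show ?thesis using x_nz y_nz by simp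
  qed
  moreover have "d3 + l \<ge> 0" using m by (simp add: l_def)
  moreover have "f3 \<in> V2 d3" using f3 VV2 by blast
  ultimately obtain V3 where V3: "finite_algebra V3" "\<And>k. V2 k \<subseteq> V3 k"
    "f3 * T + f0 * g2 / x ^ 1 \<in> V3 (d3 + l)"
    using killsE[OF T V2(1) VV2 _ refl] by metis
  note ga3 = finite_algebraD[OF V3(1)]
  have VV3: "v \<in> V k \<Longrightarrow> v \<in> V3 k" for v k using VV2 V3(2) by blast
  have "h1 \<in> V1 (int dx + l)" using V1(3) by (simp add: h1_def)
  moreover have "h2 \<in> V2 (int dy + l)" using V2(3) by (simp add: h2_def)
  moreover have "h3 \<in> V3 (d3 + l)" using V3(3) by (simp add: h3_def)
  ultimately have h: "h1 \<in> V3 (int dx + l)" "h2 \<in> V3 (int dy + l)" "h3 \<in> V3 (d3 + l)"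
    using V2(2) V3(2) by blast+
  have hg: "h1 * g1 + h2 * g2 + h3 * g3 = 0"
  proof -
    have "h1 * g1 + h2 * g2 + h3 * g3 = T * (x * g1 + y * g2 + f3 * g3)"
      by (simp add: h1_def h2_def h3_def algebra_simps)
    then show ?thesis using rel by simp
  qed
  have hf: "h2 * f3 - h3 * y = f0 * g1" "h3 * x - h1 * f3 = f0 * g2" "h1 * y - h2 * x = f0 * g3"
  proof -
    have "h2 * f3 - h3 * y = - f0 * (y * g2 + f3 * g3) / x"
      using x_nz by (simp add: h2_def h3_def field_simps)
    also have "y * g2 + f3 * g3 = - (x * g1)" using rel by (simp add: eq_neg_iff_add_eq_0 algebra_simps)
    finally show "h2 * f3 - h3 * y = f0 * g1" using x_nz by simp
  qed (use x_nz in \<open>simp_all add: h1_def h2_def h3_def field_simps\<close>)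
  \<comment> \<open>Because a dot g is \<open>x ^ N\<close> and h dot g is 0, the vector (a cross h)
    / x^N has cross product h with g; it is the solution on the x-chart, and (b cross h) / y^N is
    the one on the y-chart. They differ by \<open>c'\<close> times g, where the numerator of
    \<open>c'\<close> is the determinant of a, b, h.\<close>
  define c' where "c' = ((a2 * b3 - a3 * b2) * h1 + (a3 * b1 - a1 * b3) * h2 + (a1 * b2 - a2 * b1) * h3) / (x * y) ^ N"
  have ab: "a2 * b3 - a3 * b2 \<in> V3 (int (N * (dx + dy)) - int dx - l)"
    "a3 * b1 - a1 * b3 \<in> V3 (int (N * (dx + dy)) - int dy - l)"
    "a1 * b2 - a2 * b1 \<in> V3 (int (N * (dx + dy)) - d3 - l)"
    by (intro ga_diff[OF ga3(1)]
        ga_mult'[OF ga3(1) VV3[OF a(1)] VV3[OF b(2)]] ga_mult'[OF ga3(1) VV3[OF a(2)] VV3[OF b(1)]]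
        ga_mult'[OF ga3(1) VV3[OF a(1)] VV3[OF b(3)]] ga_mult'[OF ga3(1) VV3[OF a(3)] VV3[OF b(1)]]
        ga_mult'[OF ga3(1) VV3[OF a(2)] VV3[OF b(3)]] ga_mult'[OF ga3(1) VV3[OF a(3)] VV3[OF b(2)]];
       simp add: l_def algebra_simps)+
  have "c' * (x * y) ^ N \<in> V3 (0 + int (N * (dx + dy)))"
  proof -
    have "(a2 * b3 - a3 * b2) * h1 + (a3 * b1 - a1 * b3) * h2 + (a1 * b2 - a2 * b1) * h3 \<in> V3 (int (N * (dx + dy)))"
      by (intro ga_add[OF ga3(1)] ga_mult'[OF ga3(1) ab(1) h(1)] ga_mult'[OF ga3(1) ab(2) h(2)]
          ga_mult'[OF ga3(1) ab(3) h(3)]) simp_all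
    then show ?thesis using x_nz y_nz by (simp add: c'_def)
  qed
  then obtain U where U: "kills V3 c' 0 U" using kill_class[OF V3(1) order_refl] by blast
  define p1 where "p1 = a2 * h3 - a3 * h2"
  define p2 where "p2 = a3 * h1 - a1 * h3"
  define p3 where "p3 = a1 * h2 - a2 * h1"
  define q1 where "q1 = b2 * h3 - b3 * h2"
  define q2 where "q2 = b3 * h1 - b1 * h3"
  define q3 where "q3 = b1 * h2 - b2 * h1"
  have p: "p1 \<in> V3 (m - int dx + int (N * dx))" "p2 \<in> V3 (m - int dy + int (N * dx))" "p3 \<in> V3 (m - d3 + int (N * dx))"
    unfolding p1_def p2_def p3_def
    by (intro ga_diff[OF ga3(1)]
        ga_mult'[OF ga3(1) VV3[OF a(1)] h(2)] ga_mult'[OF ga3(1) VV3[OF a(2)] h(1)]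
        ga_mult'[OF ga3(1) VV3[OF a(1)] h(3)] ga_mult'[OF ga3(1) VV3[OF a(3)] h(1)]
        ga_mult'[OF ga3(1) VV3[OF a(2)] h(3)] ga_mult'[OF ga3(1) VV3[OF a(3)] h(2)];
       simp add: l_def algebra_simps)+
  have q: "q1 \<in> V3 (m - int dx + int (N * dy))" "q2 \<in> V3 (m - int dy + int (N * dy))" "q3 \<in> V3 (m - d3 + int (N * dy))"
    unfolding q1_def q2_def q3_def
    by (intro ga_diff[OF ga3(1)]
        ga_mult'[OF ga3(1) VV3[OF b(1)] h(2)] ga_mult'[OF ga3(1) VV3[OF b(2)] h(1)]
        ga_mult'[OF ga3(1) VV3[OF b(1)] h(3)] ga_mult'[OF ga3(1) VV3[OF b(3)] h(1)]
        ga_mult'[OF ga3(1) VV3[OF b(2)] h(3)] ga_mult'[OF ga3(1) VV3[OF b(3)] h(2)];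
       simp add: l_def algebra_simps)+
  have swap: "p1 / x ^ N + g1 * c' = q1 / y ^ N" "p2 / x ^ N + g2 * c' = q2 / y ^ N" "p3 / x ^ N + g3 * c' = q3 / y ^ N"
  proof -
    let ?s = "h1 * g1 + h2 * g2 + h3 * g3"
      and ?C = "(a2 * b3 - a3 * b2) * h1 + (a3 * b1 - a1 * b3) * h2 + (a1 * b2 - a2 * b1) * h3"
    have "p1 * y ^ N + g1 * ?C = q1 * x ^ N + (a2 * b3 - a3 * b2) * ?s"
      "p2 * y ^ N + g2 * ?C = q2 * x ^ N + (a3 * b1 - a1 * b3) * ?s"
      "p3 * y ^ N + g3 * ?C = q3 * x ^ N + (a1 * b2 - a2 * b1) * ?s"
      unfolding a(4) b(4) p1_def p2_def p3_def q1_def q2_def q3_def by (simp_all add: algebra_simps)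
    then have *: "p1 * y ^ N + g1 * ?C = q1 * x ^ N" "p2 * y ^ N + g2 * ?C = q2 * x ^ N"
      "p3 * y ^ N + g3 * ?C = q3 * x ^ N" by (simp_all add: hg)
    have "p / x ^ N + g * c' = q / y ^ N" if "p * y ^ N + g * ?C = q * x ^ N" for p g q
    proof -
      have "p / x ^ N + g * (C / (x ^ N * y ^ N)) = (p * y ^ N + g * C) / (x ^ N * y ^ N)" for C
        using x_nz y_nz by (simp add: add_divide_distrib)
      from this[of ?C] show ?thesis
        using x_nz y_nz unfolding that c'_def by (simp add: power_mult_distrib)
    qed
    with * show "p1 / x ^ N + g1 * c' = q1 / y ^ N" "p2 / x ^ N + g2 * c' = q2 / y ^ N"
      "p3 / x ^ N + g3 * c' = q3 / y ^ N" by blast+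
  qed
  have step: "\<exists>V''. finite_algebra V'' \<and> (\<forall>k. V' k \<subseteq> V'' k) \<and> g * U + p / x ^ N \<in> V'' j"
    if V': "finite_algebra V'" "\<And>k. V3 k \<subseteq> V' k" and gj: "g \<in> V3 j" "j \<ge> 0"
      and pq: "p \<in> V3 (j + int (N * dx))" "q \<in> V3 (j + int (N * dy))" "p / x ^ N + g * c' = q / y ^ N"
    for V' g p q j
  proof -
    have "p / x ^ N \<in> localized V' x dx j" "q / y ^ N \<in> localized V' y dy j"
      using subsetD[OF V'(2) pq(1)] subsetD[OF V'(2) pq(2)] x_nz y_nz by (auto intro!: divided)
    then obtain V'' where "finite_algebra V''" "\<And>k. V' k \<subseteq> V'' k" "g * U + p / x ^ N \<in> V'' j"
      using killsE[OF U V', of g j j "p / x ^ N"] gj V'(2) pq(3) by auto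
    then show ?thesis by blast
  qed
  obtain V4 where V4: "finite_algebra V4" "\<And>k. V3 k \<subseteq> V4 k" "g1 * U + p1 / x ^ N \<in> V4 (m - int dx)"
    using step[OF V3(1) order_refl VV3[OF g(1)] _ p(1) q(1) swap(1)] m by auto
  obtain V5 where V5: "finite_algebra V5" "\<And>k. V4 k \<subseteq> V5 k" "g2 * U + p2 / x ^ N \<in> V5 (m - int dy)"
    using step[OF V4(1,2) VV3[OF g(2)] _ p(2) q(2) swap(2)] m by auto
  have V35: "V3 k \<subseteq> V5 k" for k using V4(2) V5(2) by blast
  obtain V6 where V6: "finite_algebra V6" "\<And>k. V5 k \<subseteq> V6 k" "g3 * U + p3 / x ^ N \<in> V6 (m - d3)"
    using step[OF V5(1) V35 VV3[OF g(3)] _ p(3) q(3) swap(3)] m by auto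
  show ?thesis
  proof (rule that[of V6 "g1 * U + p1 / x ^ N" "g2 * U + p2 / x ^ N" "g3 * U + p3 / x ^ N"])
    show "V k \<subseteq> V6 k" for k using VV3 V35 V6(2) by blast
    show "g1 * U + p1 / x ^ N \<in> V6 (m - int dx)" "g2 * U + p2 / x ^ N \<in> V6 (m - int dy)"
      using V4(3) V5(2,3) V6(2) by blast+
    \<comment> \<open>The triple product identity: (a cross h) dot f equals a dot (h cross f), which
      is f0 times a dot g. The correction by \<open>U\<close> times g contributes nothing since g
      dot f is 0.\<close>
    have "p1 * x + p2 * y + p3 * f3 = a1 * (h2 * f3 - h3 * y) + a2 * (h3 * x - h1 * f3) + a3 * (h1 * y - h2 * x)"
      unfolding p1_def p2_def p3_def by (simp add: algebra_simps)
    also have "\<dots> = f0 * x ^ N" unfolding hf a(4) by (simp add: algebra_simps)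
    finally have "p1 * x + p2 * y + p3 * f3 = f0 * x ^ N" .
    moreover have "(g1 * U + p1 / x ^ N) * x + (g2 * U + p2 / x ^ N) * y + (g3 * U + p3 / x ^ N) * f3 =
        U * (x * g1 + y * g2 + f3 * g3) + (p1 * x + p2 * y + p3 * f3) / x ^ N"
      by (simp add: algebra_simps add_divide_distrib)
    ultimately show "f0 = (g1 * U + p1 / x ^ N) * x + (g2 * U + p2 / x ^ N) * y + (g3 * U + p3 / x ^ N) * f3"
      using x_nz rel by simp
  qed (use V6 in auto)
qed

end

section \<open>Evaluation of polynomials in three variables\<close>

definition monomial_value :: "(3 \<Rightarrow> 'c::comm_ring_1) \<Rightarrow> (3 \<Rightarrow>\<^sub>0 nat) \<Rightarrow> 'c" where
  "monomial_value b t = (\<Prod>i\<in>UNIV. b i ^ Poly_Mapping.lookup t i)"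

definition total_degree :: "(3 \<Rightarrow>\<^sub>0 nat) \<Rightarrow> nat" where
  "total_degree t = (\<Sum>i\<in>UNIV. Poly_Mapping.lookup t i)"

lemma monomial_value_add: "monomial_value b (t + u) = monomial_value b t * monomial_value b u"
  by (simp add: monomial_value_def lookup_add power_add prod.distrib)

lemma monomial_value_zero [simp]: "monomial_value b 0 = 1"
  by (simp add: monomial_value_def)

lemma total_degree_add: "total_degree (t + u) = total_degree t + total_degree u"
  by (simp add: total_degree_def lookup_add sum.distrib)

lemma total_degree_zero [simp]: "total_degree 0 = 0"
  by (simp add: total_degree_def)

lemma total_degree_single [simp]: "total_degree (Poly_Mapping.single i n) = n"
  by (simp add: total_degree_def lookup_single when_def)

lemma monomial_value_single [simp]: "monomial_value b (Poly_Mapping.single i n) = b i ^ n"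
proof -
  have "monomial_value b (Poly_Mapping.single i n) = (\<Prod>j\<in>UNIV. if i = j then b i ^ n else 1)"
    unfolding monomial_value_def by (intro prod.cong) (auto simp: lookup_single when_def)
  then show ?thesis by simp
qed

lemma monomial_value_monom:
  "monomial_value (\<lambda>i. monom (a i) 1) t = monom (monomial_value a t) (total_degree t)"
proof -
  have "(\<Prod>i\<in>A. monom (a i) 1 ^ Poly_Mapping.lookup t i) =
      monom (\<Prod>i\<in>A. a i ^ Poly_Mapping.lookup t i) (\<Sum>i\<in>A. Poly_Mapping.lookup t i)" for A
    by (induction A rule: infinite_finite_induct) (simp_all add: monom_power mult_monom)
  then show ?thesis by (simp add: monomial_value_def total_degree_def)
qed

lemma poly_mapping_sum_single:
  "p = (\<Sum>t\<in>Poly_Mapping.keys p. Poly_Mapping.single t (Poly_Mapping.lookup p t))"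
proof (rule poly_mapping_eqI)
  fix u
  have "Poly_Mapping.lookup (\<Sum>t\<in>Poly_Mapping.keys p. Poly_Mapping.single t (Poly_Mapping.lookup p t)) u
      = (\<Sum>t\<in>Poly_Mapping.keys p. if t = u then Poly_Mapping.lookup p u else 0)"
    by (auto simp: lookup_sum lookup_single when_def intro!: sum.cong)
  then show "Poly_Mapping.lookup p u =
      Poly_Mapping.lookup (\<Sum>t\<in>Poly_Mapping.keys p. Poly_Mapping.single t (Poly_Mapping.lookup p t)) u"
    by (simp add: in_keys_iff)
qed

lemma finite_total_degree_le: "finite {t. total_degree t \<le> n}"
proof (rule inj_on_finite[of Poly_Mapping.lookup])
  show "inj_on Poly_Mapping.lookup {t. total_degree t \<le> n}"
    by (auto simp: inj_on_def intro: poly_mapping_eqI)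
  have "Poly_Mapping.lookup t i \<le> total_degree t" for t i
    unfolding total_degree_def by (rule member_le_sum) auto
  then show "Poly_Mapping.lookup ` {t. total_degree t \<le> n} \<subseteq> PiE UNIV (\<lambda>_. {..n})"
    by (auto simp: PiE_def intro: order_trans)
qed (rule finite_PiE; simp)

text \<open>The target is an arbitrary commutative ring so that the same facts serve for graded
  evaluation at a point and for rewriting into iterated univariate polynomials.\<close>

locale coefficient_hom =
  fixes h :: "'k::field \<Rightarrow> 'c::comm_ring_1" and b :: "3 \<Rightarrow> 'c"
  assumes h_add: "h (u + v) = h u + h v" and h_mult: "h (u * v) = h u * h v" and h_one: "h 1 = 1"
begin

definition eval_poly3 :: "'k poly3 \<Rightarrow> 'c" where
  "eval_poly3 p = (\<Sum>t\<in>Poly_Mapping.keys p. h (Poly_Mapping.lookup p t) * monomial_value b t)"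

lemma h_zero: "h 0 = 0"
  using h_add[of 0 0] by (metis add.right_neutral add_left_cancel)

lemma eval_superset:
  "finite S \<Longrightarrow> Poly_Mapping.keys p \<subseteq> S \<Longrightarrow>
    eval_poly3 p = (\<Sum>t\<in>S. h (Poly_Mapping.lookup p t) * monomial_value b t)"
  unfolding eval_poly3_def by (rule sum.mono_neutral_left) (auto simp: h_zero in_keys_iff)

lemma eval_add: "eval_poly3 (p + q) = eval_poly3 p + eval_poly3 q"
proof -
  let ?S = "Poly_Mapping.keys p \<union> Poly_Mapping.keys q"
  note S = eval_superset[of ?S]
  show ?thesis
    using S[of "p + q"] S[of p] S[of q] Poly_Mapping.keys_add[of p q]
    by (simp add: lookup_add h_add distrib_right sum.distrib)
qed

lemma eval_zero [simp]: "eval_poly3 0 = 0"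
  by (simp add: eval_poly3_def)

lemma eval_single: "eval_poly3 (Poly_Mapping.single t c) = h c * monomial_value b t"
  using eval_superset[of "{t}" "Poly_Mapping.single t c"] by simp

lemma eval_sum: "eval_poly3 (sum f A) = (\<Sum>a\<in>A. eval_poly3 (f a))"
  by (induction A rule: infinite_finite_induct) (simp_all add: eval_add)

lemma eval_one [simp]: "eval_poly3 1 = 1"
  using eval_single[of 0 1] by (simp add: h_one)

lemma eval_mult: "eval_poly3 (p * q) = eval_poly3 p * eval_poly3 q"
proof -
  have "p * q = (\<Sum>t\<in>Poly_Mapping.keys p. \<Sum>u\<in>Poly_Mapping.keys q.
      Poly_Mapping.single (t + u) (Poly_Mapping.lookup p t * Poly_Mapping.lookup q u))"
    by (subst (1) poly_mapping_sum_single[of p], subst (1) poly_mapping_sum_single[of q])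
      (simp add: sum_product mult_single)
  then have "eval_poly3 (p * q) = (\<Sum>t\<in>Poly_Mapping.keys p. \<Sum>u\<in>Poly_Mapping.keys q.
      (h (Poly_Mapping.lookup p t) * monomial_value b t) * (h (Poly_Mapping.lookup q u) * monomial_value b u))"
    by (simp add: eval_sum eval_single h_mult monomial_value_add mult_ac)
  then show ?thesis by (simp add: eval_poly3_def sum_product)
qed

lemma eval_uminus: "eval_poly3 (- p) = - eval_poly3 p"
  using eval_add[of p "- p"] by (simp add: eq_neg_iff_add_eq_0 add.commute)

lemma eval_diff: "eval_poly3 (p - q) = eval_poly3 p - eval_poly3 q"
  using eval_add[of p "- q"] by (simp add: eval_uminus)

end

subsection \<open>A principal kernel\<close>

text \<open>Let \<open>G\<close> have minimal degree among the nonzero elements of \<open>J\<close>.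
  Pseudo-division gives \<open>smult a F = G * q\<close>, and the prime \<open>F\<close> divides
  \<open>G\<close> or \<open>q\<close>. In the second case \<open>G\<close> would divide a nonzero
  constant, so it would be a constant in \<open>J\<close>, which \<open>const\<close> excludes.
  Hence \<open>F\<close> itself has minimal degree, and pseudo-division of \<open>p\<close> by
  \<open>F\<close> leaves only a constant factor that \<open>F\<close> cannot divide.\<close>

lemma principal_ideal_of_generic_zero:
  fixes J :: "'d::idom poly set" and F :: "'d poly"
  assumes J: "\<And>p q. p \<in> J \<Longrightarrow> q \<in> J \<Longrightarrow> p - q \<in> J" "\<And>p q. p \<in> J \<Longrightarrow> q * p \<in> J"
    and F: "F \<in> J" "degree F > 0" and prime: "\<And>p q. F dvd p * q \<Longrightarrow> F dvd p \<or> F dvd q"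
    and const: "\<And>p. p \<in> J \<Longrightarrow> degree p = 0 \<Longrightarrow> p = 0"
    and p: "p \<in> J"
  shows "F dvd p"
proof -
  have F0: "F \<noteq> 0" using F(2) by auto
  define G where "G = arg_min degree (\<lambda>q. q \<in> J \<and> q \<noteq> 0)"
  have G: "G \<in> J" "G \<noteq> 0" and min: "\<And>q. q \<in> J \<Longrightarrow> q \<noteq> 0 \<Longrightarrow> degree G \<le> degree q"
    using arg_min_natI[of "\<lambda>q. q \<in> J \<and> q \<noteq> 0" F degree] arg_min_nat_le[of "\<lambda>q. q \<in> J \<and> q \<noteq> 0" _ degree] F(1) F0
    by (auto simp: G_def)
  have divide: "\<exists>a q. a \<noteq> 0 \<and> smult a f = g * q"
    if f: "f \<in> J" and g: "g \<in> J" "g \<noteq> 0" "degree g \<le> degree G" for f g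
  proof -
    obtain a q where aq: "a \<noteq> 0" "smult a f = g * q + pseudo_mod f g"
      using pseudo_mod(1)[OF g(2)] by blast
    have "pseudo_mod f g = [:a:] * f - q * g" using aq(2) by (simp add: algebra_simps)
    moreover have "[:a:] * f - q * g \<in> J" by (intro J f g)
    ultimately have "pseudo_mod f g \<in> J" by simp
    moreover have "pseudo_mod f g = 0 \<or> degree (pseudo_mod f g) < degree g"
      by (rule pseudo_mod(2)[OF g(2)])
    ultimately have "pseudo_mod f g = 0" using min[of "pseudo_mod f g"] g(3) by force
    with aq show ?thesis by auto
  qed
  have scalar: "degree F = 0" if "F dvd [:a:]" "a \<noteq> 0" for a
    using dvd_imp_degree_le[OF that(1)] that(2) by simp
  have "F dvd G"
  proof -
    obtain a q where aq: "a \<noteq> 0" "smult a F = G * q" using divide[OF F(1) G order_refl] by blast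
    have "F dvd smult a F" by (rule dvd_smult) simp
    with aq(2) have "F dvd G * q" by simp
    with prime consider "F dvd G" | "F dvd q" by blast
    then show ?thesis
    proof cases
      case 2
      then obtain r where "q = F * r" by (auto simp: dvd_def)
      with aq have "[:a:] * F = (G * r) * F" by (simp add: mult_ac)
      then have "[:a:] = G * r" using F0 mult_right_cancel[of F "[:a:]" "G * r"] by blast
      then have "G dvd [:a:]" by (rule dvdI)
      then have "degree G = 0" using dvd_imp_degree_le[of G "[:a:]"] aq(1) by simp
      with const[OF G(1)] G(2) show ?thesis by simp
    qed
  qed
  then have "degree F \<le> degree G" using G(2) by (rule dvd_imp_degree_le)
  with divide[OF p F(1) F0] obtain a q where aq: "a \<noteq> 0" "smult a p = F * q" by blast
  have "F dvd F * q" by simp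
  with aq(2) have "F dvd [:a:] * p" by simp
  with prime consider "F dvd [:a:]" | "F dvd p" by blast
  then show ?thesis using scalar aq(1) F(2) by cases auto
qed

subsection \<open>Embedding a plane curve into an algebraically closed field\<close>

context scalar_embedding
begin

text \<open>\<open>graded_eval a p\<close> is \<open>p(a t)\<close>, with the variable \<open>t\<close> of \<open>'o poly\<close> recording the degree.\<close>

definition graded_eval :: "(3 \<Rightarrow> 'o) \<Rightarrow> 'k poly3 \<Rightarrow> 'o poly" where
  "graded_eval a = coefficient_hom.eval_poly3 (\<lambda>c. [:\<kappa> c:]) (\<lambda>i. monom (a i) 1)"

lemma coefficient_hom_graded: "coefficient_hom (\<lambda>c. [:\<kappa> c:])"
  by unfold_locales (simp_all add: \<kappa>_add \<kappa>_mult one_pCons)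

lemma graded_eval_add: "graded_eval a (p + q) = graded_eval a p + graded_eval a q"
  and graded_eval_mult: "graded_eval a (p * q) = graded_eval a p * graded_eval a q"
  and graded_eval_one: "graded_eval a 1 = 1"
  and graded_eval_zero: "graded_eval a 0 = 0"
  and graded_eval_diff: "graded_eval a (p - q) = graded_eval a p - graded_eval a q"
  and graded_eval_sum: "graded_eval a (sum f A) = (\<Sum>z\<in>A. graded_eval a (f z))"
  unfolding graded_eval_def
  by (rule coefficient_hom.eval_add coefficient_hom.eval_mult coefficient_hom.eval_one
      coefficient_hom.eval_zero coefficient_hom.eval_diff coefficient_hom.eval_sum,
      rule coefficient_hom_graded)+

lemma graded_eval_eq:
  "graded_eval a p = (\<Sum>t\<in>Poly_Mapping.keys p.
     monom (\<kappa> (Poly_Mapping.lookup p t) * monomial_value a t) (total_degree t))"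
  unfolding graded_eval_def coefficient_hom.eval_poly3_def[OF coefficient_hom_graded]
  unfolding monomial_value_monom by (simp add: smult_monom)

lemma graded_eval_single:
  "graded_eval a (Poly_Mapping.single t c) = monom (\<kappa> c * monomial_value a t) (total_degree t)"
  unfolding graded_eval_def coefficient_hom.eval_single[OF coefficient_hom_graded]
  unfolding monomial_value_monom by (simp add: smult_monom)

lemma coeff_graded_eval:
  "coeff (graded_eval a p) n = (\<Sum>t\<in>Poly_Mapping.keys p.
     if total_degree t = n then \<kappa> (Poly_Mapping.lookup p t) * monomial_value a t else 0)"
  unfolding graded_eval_eq by (auto simp: coeff_sum intro!: sum.cong)

end

section \<open>Ternary polynomials as iterated univariate polynomials\<close>

locale coordinates =
  fixes v b c :: 3
  assumes UNIV_coords: "UNIV = {v, b, c}" and distinct_coords: "v \<noteq> b" "v \<noteq> c" "b \<noteq> c"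
begin

lemma prod_coords: "(\<Prod>i\<in>UNIV. f i) = f v * f b * (f c :: 'z::comm_monoid_mult)"
  using distinct_coords by (simp add: UNIV_coords mult.assoc)

lemma sum_coords: "(\<Sum>i\<in>UNIV. f i) = f v + f b + (f c :: 'z::comm_monoid_add)"
  using distinct_coords by (simp add: UNIV_coords add.assoc)

lemma poly_mapping_coords_eqI:
  assumes "Poly_Mapping.lookup t v = Poly_Mapping.lookup u v"
    "Poly_Mapping.lookup t b = Poly_Mapping.lookup u b" "Poly_Mapping.lookup t c = Poly_Mapping.lookup u c"
  shows "t = u"
proof (rule poly_mapping_eqI)
  fix i have "i \<in> {v, b, c}" using UNIV_coords by blast
  with assms show "Poly_Mapping.lookup t i = Poly_Mapping.lookup u i" by auto
qed

text \<open>The isomorphism with K[b][c][v]. The variable \<open>v\<close> is outermost so that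
  pseudo-division takes place with respect to the variable that will be eliminated.\<close>

definition iterated :: "'k::field poly3 \<Rightarrow> 'k poly poly poly" where
  "iterated = coefficient_hom.eval_poly3 (\<lambda>z. monom (monom (monom z 0) 0) 0)
     (\<lambda>i. if i = v then monom 1 1 else if i = c then monom (monom 1 1) 0 else monom (monom (monom 1 1) 0) 0)"

lemma coefficient_hom_iterated: "coefficient_hom (\<lambda>z::'k::field. monom (monom (monom z 0) 0) 0)"
  by unfold_locales (simp_all add: add_monom mult_monom)

lemma iterated_add: "iterated (p + q) = iterated p + iterated q"
  and iterated_mult: "iterated (p * q) = iterated p * iterated q"
  and iterated_zero: "iterated 0 = 0"
  and iterated_diff: "iterated (p - q) = iterated p - iterated q"
  unfolding iterated_def
  by (rule coefficient_hom.eval_add coefficient_hom.eval_mult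
      coefficient_hom.eval_zero coefficient_hom.eval_diff,
      rule coefficient_hom_iterated)+

lemma monomial_value_iterated:
  "monomial_value (\<lambda>i. if i = v then monom 1 1 else if i = c then monom (monom 1 1) 0
      else monom (monom (monom (1::'k::field) 1) 0) 0) t =
   monom (monom (monom 1 (Poly_Mapping.lookup t b)) (Poly_Mapping.lookup t c)) (Poly_Mapping.lookup t v)"
  unfolding monomial_value_def prod_coords
  using distinct_coords by (simp add: monom_power mult_monom)

lemma iterated_single:
  "iterated (Poly_Mapping.single t z) =
   monom (monom (monom z (Poly_Mapping.lookup t b)) (Poly_Mapping.lookup t c)) (Poly_Mapping.lookup t v)"
  unfolding iterated_def coefficient_hom.eval_single[OF coefficient_hom_iterated] monomial_value_iterated
  by (simp add: mult_monom)

lemma coeff_iterated: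
  fixes p :: "'k::field poly3"
  shows "coeff (coeff (coeff (iterated p) (Poly_Mapping.lookup t v)) (Poly_Mapping.lookup t c)) (Poly_Mapping.lookup t b)
     = Poly_Mapping.lookup p t"
proof -
  have "coeff (coeff (coeff (monom (monom (monom z (Poly_Mapping.lookup u b)) (Poly_Mapping.lookup u c))
      (Poly_Mapping.lookup u v)) (Poly_Mapping.lookup t v)) (Poly_Mapping.lookup t c)) (Poly_Mapping.lookup t b)
      = (if u = t then z else 0)" for u and z :: 'k
    by (cases "u = t") (simp, use poly_mapping_coords_eqI[of u t] in auto)
  then have "coeff (coeff (coeff (iterated p) (Poly_Mapping.lookup t v)) (Poly_Mapping.lookup t c)) (Poly_Mapping.lookup t b)
    = (\<Sum>u\<in>Poly_Mapping.keys p. if u = t then Poly_Mapping.lookup p u else 0)"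
    unfolding iterated_def coefficient_hom.eval_poly3_def[OF coefficient_hom_iterated] monomial_value_iterated
    by (simp add: coeff_sum mult_monom del: coeff_monom)
  then show ?thesis by (simp add: in_keys_iff)
qed

lemma iterated_eq_0_iff: "iterated p = 0 \<longleftrightarrow> p = 0"
  using coeff_iterated[of p] by (auto simp: iterated_zero intro!: poly_mapping_eqI)

lemma iterated_surj:
  fixes q :: "'k::field poly poly poly"
  shows "\<exists>p. iterated p = q"
proof -
  have rep_sum: "\<exists>p. iterated p = sum f A" if "\<And>a. a \<in> A \<Longrightarrow> \<exists>p. iterated p = f a" for f and A :: "nat set"
    using that
  proof (induction A rule: infinite_finite_induct)
    case (insert a A)
    obtain p where p: "iterated p = f a" using insert.prems[of a] by auto
    have "\<exists>p'. iterated p' = sum f A" by (rule insert.IH) (simp add: insert.prems)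
    then obtain p' where "iterated p' = sum f A" ..
    with p insert.hyps have "iterated (p + p') = sum f (insert a A)" by (simp add: iterated_add)
    then show ?case ..
  next
    case (infinite A)
    have "iterated 0 = sum f A" using infinite.hyps by (simp add: iterated_zero)
    then show ?case ..
  next
    case empty
    have "iterated 0 = sum f {}" by (simp add: iterated_zero)
    then show ?case ..
  qed
  have mono: "\<exists>p. iterated p = monom (monom (monom z l) j) i" for z :: 'k and l j i
  proof -
    let ?t = "Poly_Mapping.single v i + Poly_Mapping.single c j + Poly_Mapping.single b l"
    have "Poly_Mapping.lookup ?t v = i" "Poly_Mapping.lookup ?t c = j" "Poly_Mapping.lookup ?t b = l"
      using distinct_coords by (simp_all add: lookup_add lookup_single when_def)
    then show ?thesis by (intro exI[of _ "Poly_Mapping.single ?t z"]) (simp add: iterated_single)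
  qed
  have mono': "\<exists>p. iterated p = monom (monom d j) i" for d :: "'k poly" and j i
    using rep_sum[of "{..degree d}" "\<lambda>l. monom (monom (monom (coeff d l) l) j) i", OF mono]
    unfolding monom_sum[symmetric] poly_as_sum_of_monoms .
  have "\<exists>p. iterated p = monom d i" for d :: "'k poly poly" and i
    using rep_sum[of "{..degree d}" "\<lambda>l. monom (monom (coeff d l) l) i", OF mono']
    unfolding monom_sum[symmetric] poly_as_sum_of_monoms .
  from rep_sum[of "{..degree q}" "\<lambda>l. monom (coeff q l) l", OF this]
  show ?thesis unfolding poly_as_sum_of_monoms .
qed

end

text \<open>The algebraic closure of a rational function field in one variable contains the functions on the
  curve. The second variable serves for the generic point of the plane, which is needed for \<open>F = 0\<close>.\<close>

type_synonym 'k omega = "'k poly poly fract alg_closure"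

definition to_omega :: "'k::field poly poly \<Rightarrow> 'k omega" where
  "to_omega q = to_ac (to_fract q)"

lemma to_omega_add: "to_omega (p + q) = to_omega p + to_omega q"
  and to_omega_mult: "to_omega (p * q) = to_omega p * to_omega q"
  and to_omega_one: "to_omega 1 = 1"
  and to_omega_zero: "to_omega 0 = 0"
  and to_omega_eq_0_iff: "to_omega p = 0 \<longleftrightarrow> p = 0"
  by (simp_all add: to_omega_def)

lemma to_omega_power: "to_omega (p ^ n) = to_omega p ^ n"
  by (induction n) (simp_all add: to_omega_one to_omega_mult)

lemma to_omega_sum: "to_omega (sum f A) = (\<Sum>a\<in>A. to_omega (f a))"
  by (induction A rule: infinite_finite_induct) (simp_all add: to_omega_zero to_omega_add)

definition omega_scalar :: "'k::field \<Rightarrow> 'k omega" where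
  "omega_scalar z = to_omega [:[:z:]:]"

interpretation omega: scalar_embedding omega_scalar
  by unfold_locales
    (simp_all add: omega_scalar_def to_omega_one one_pCons[symmetric] flip: to_omega_add to_omega_mult)

lemma CHAR_omega: "CHAR('k omega) = CHAR('k::field)"
proof (rule CHAR_eqI)
  have *: "of_nat n = omega_scalar (of_nat n :: 'k)" for n
    by (induction n) (simp_all add: omega.\<kappa>_add)
  have inj: "omega_scalar z = 0 \<longleftrightarrow> z = 0" for z :: 'k
    by (simp add: omega_scalar_def to_omega_eq_0_iff)
  show "of_nat CHAR('k) = (0 :: 'k omega)" by (simp add: *)
  show "CHAR('k) dvd n" if "of_nat n = (0 :: 'k omega)" for n
    using that by (simp add: * inj of_nat_eq_0_iff_char_dvd)
qed

section \<open>Generic points of the plane and of a plane curve\<close>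

context coordinates
begin

text \<open>The generic point of the curve: \<open>\<zeta>\<close> will be a root of the dehomogenized equation.\<close>

definition point :: "'k::field omega \<Rightarrow> 3 \<Rightarrow> 'k omega" where
  "point \<zeta> i = (if i = v then \<zeta> else if i = c then to_omega [:[:0, 1:]:] else 1)"

lemma monomial_value_point:
  fixes \<zeta> :: "'k::field omega"
  shows "monomial_value (point \<zeta>) t = \<zeta> ^ Poly_Mapping.lookup t v * to_omega [:monom 1 (Poly_Mapping.lookup t c):]"
proof -
  have "[:[:0, 1:]:] ^ n = [:monom (1::'k) n:]" for n
    by (induction n) (simp_all add: monom_Suc one_pCons)
  then show ?thesis
    using distinct_coords unfolding monomial_value_def prod_coords
    by (simp add: point_def flip: to_omega_power)
qed

lemma scalar_times_point:
  "omega_scalar z * to_omega [:monom 1 n:] = to_omega [:monom z n:]"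
  by (simp add: omega_scalar_def smult_monom flip: to_omega_mult)

lemma scalar_times_monom:
  "omega_scalar z * to_omega (monom (monom 1 n) k) = to_omega (monom (monom z n) k)"
  by (simp add: omega_scalar_def smult_monom flip: to_omega_mult)

text \<open>The grading variable separates the total degrees. Within one degree, the exponents of
  \<open>v\<close> and \<open>c\<close> determine that of \<open>b\<close>, so setting
  \<open>b\<close> to 1 loses nothing, and the values of \<open>v\<close> and \<open>c\<close> are
  algebraically independent.\<close>

lemma generic_injective:
  assumes "omega.graded_eval (point (to_omega [:0, 1:])) p = 0"
  shows "p = 0"
proof (rule ccontr)
  assume "p \<noteq> 0"
  then obtain t where t: "t \<in> Poly_Mapping.keys p" by (metis keys_eq_empty ex_in_conv)
  define q where "q = (\<Sum>u\<in>Poly_Mapping.keys p. if total_degree u = total_degree t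
    then monom (monom (Poly_Mapping.lookup p u) (Poly_Mapping.lookup u c)) (Poly_Mapping.lookup u v) else 0)"
  have power: "[:0, 1:] ^ n = (monom 1 n :: 'z::comm_ring_1 poly)" for n
    by (simp add: monom_altdef)
  have "to_omega q = coeff (omega.graded_eval (point (to_omega [:0, 1:])) p) (total_degree t)"
    unfolding q_def to_omega_sum omega.coeff_graded_eval monomial_value_point
    by (intro sum.cong refl)
      (simp add: to_omega_zero mult.left_commute[of "omega_scalar _"] scalar_times_point scalar_times_monom power mult_monom
        smult_monom flip: to_omega_power to_omega_mult)
  then have "q = 0" using assms by (simp add: to_omega_eq_0_iff)
  then have "0 = coeff (coeff q (Poly_Mapping.lookup t v)) (Poly_Mapping.lookup t c)" by simp
  also have "\<dots> = (\<Sum>u\<in>Poly_Mapping.keys p. if u = t then Poly_Mapping.lookup p t else 0)"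
  proof -
    have "u = t" if "total_degree u = total_degree t" "Poly_Mapping.lookup u v = Poly_Mapping.lookup t v"
      "Poly_Mapping.lookup u c = Poly_Mapping.lookup t c" for u
      using that by (intro poly_mapping_coords_eqI) (simp_all add: total_degree_def sum_coords)
    then show ?thesis
      unfolding q_def coeff_sum by (intro sum.cong refl) (auto split: if_splits)
  qed
  also have "\<dots> = Poly_Mapping.lookup p t" using t by simp
  finally show False using t by (simp add: in_keys_iff)
qed

text \<open>\<open>f\<close> is the dehomogenized equation as a polynomial in the
  \<open>v\<close>-coordinate. Distinct monomials of the form \<open>F\<close> differ in the
  exponent of \<open>v\<close> or of \<open>c\<close>, so nothing cancels and \<open>f\<close> has
  positive degree; its root is the required coordinate.\<close>

lemma exists_zero:
  assumes F: "F \<in> homogeneous_polys m" and t: "t \<in> Poly_Mapping.keys F" "Poly_Mapping.lookup t v > 0"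
  shows "\<exists>\<zeta>. omega.graded_eval (point \<zeta>) F = 0"
proof -
  have deg: "total_degree u = m" if "u \<in> Poly_Mapping.keys F" for u
    using F that by (auto simp: homogeneous_polys_def total_degree_def)
  define f where "f = (\<Sum>u\<in>Poly_Mapping.keys F.
    monom (to_omega [:monom (Poly_Mapping.lookup F u) (Poly_Mapping.lookup u c):]) (Poly_Mapping.lookup u v))"
  define q where "q = (\<Sum>u\<in>Poly_Mapping.keys F. if Poly_Mapping.lookup u v = Poly_Mapping.lookup t v
    then [:monom (Poly_Mapping.lookup F u) (Poly_Mapping.lookup u c):] else 0)"
  have "coeff f (Poly_Mapping.lookup t v) = to_omega q"
    unfolding f_def q_def coeff_sum to_omega_sum by (intro sum.cong refl) (auto simp: to_omega_zero)
  moreover have "coeff (coeff q 0) (Poly_Mapping.lookup t c) =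
      (\<Sum>u\<in>Poly_Mapping.keys F. if u = t then Poly_Mapping.lookup F t else 0)"
  proof -
    have "u = t" if "u \<in> Poly_Mapping.keys F" "Poly_Mapping.lookup u v = Poly_Mapping.lookup t v"
      "Poly_Mapping.lookup u c = Poly_Mapping.lookup t c" for u
      using that deg[OF that(1)] deg[OF t(1)]
      by (intro poly_mapping_coords_eqI) (simp_all add: total_degree_def sum_coords)
    then show ?thesis
      unfolding q_def coeff_sum by (intro sum.cong refl) (auto split: if_splits)
  qed
  then have "q \<noteq> 0" using t by (auto simp: in_keys_iff)
  ultimately have "coeff f (Poly_Mapping.lookup t v) \<noteq> 0" by (simp add: to_omega_eq_0_iff)
  then have "degree f > 0" using le_degree t(2) by fastforce
  then obtain \<zeta> where \<zeta>: "poly f \<zeta> = 0" using alg_closed_imp_poly_has_root by blast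
  have "omega.graded_eval (point \<zeta>) F = monom (poly f \<zeta>) m"
  proof -
    have "omega.graded_eval (point \<zeta>) F = (\<Sum>u\<in>Poly_Mapping.keys F.
        monom (to_omega [:monom (Poly_Mapping.lookup F u) (Poly_Mapping.lookup u c):] * \<zeta> ^ Poly_Mapping.lookup u v) m)"
      unfolding omega.graded_eval_eq monomial_value_point
      by (intro sum.cong refl) (simp add: deg mult.left_commute[of "omega_scalar _"] scalar_times_point mult.commute)
    also have "\<dots> = monom (poly f \<zeta>) m"
      by (simp add: f_def poly_sum monom_sum poly_monom)
    finally show ?thesis .
  qed
  with \<zeta> show ?thesis by auto
qed

text \<open>A kernel element free of \<open>v\<close> does not see \<open>\<zeta>\<close>, so it
  also vanishes at the generic point of the plane and is 0. Thus the kernel contains no nonzero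
  constants with respect to \<open>v\<close>, and the criterion for principal ideals
  applies.\<close>

lemma kernel_point:
  assumes F: "F \<in> homogeneous_polys m" and t: "t \<in> Poly_Mapping.keys F" "Poly_Mapping.lookup t v > 0"
    and prime: "\<And>p q. F dvd p * q \<Longrightarrow> F dvd p \<or> F dvd q"
    and zero: "omega.graded_eval (point \<zeta>) F = 0"
    and p: "omega.graded_eval (point \<zeta>) p = 0"
  shows "F dvd p"
proof -
  let ?\<Phi> = "omega.graded_eval (point \<zeta>)"
  have dvd_iff: "iterated F dvd iterated p \<longleftrightarrow> F dvd p" for p
  proof
    assume "iterated F dvd iterated p"
    then obtain q where "iterated p = iterated F * q" by (auto simp: dvd_def)
    then obtain r where "iterated p = iterated (F * r)"
      using iterated_surj[of q] by (auto simp: iterated_mult)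
    then have "p - F * r = 0"
      using iterated_eq_0_iff[of "p - F * r"] by (simp add: iterated_diff)
    then show "F dvd p" by simp
  qed (auto simp: dvd_def iterated_mult)
  have "iterated F dvd iterated p"
  proof (rule principal_ideal_of_generic_zero[where J = "iterated ` {p. ?\<Phi> p = 0}"])
    show "iterated F \<in> iterated ` {p. ?\<Phi> p = 0}" "iterated p \<in> iterated ` {p. ?\<Phi> p = 0}"
      using zero p by auto
    have "coeff (iterated F) (Poly_Mapping.lookup t v) \<noteq> 0"
      using coeff_iterated[of F t] t(1) by (auto simp: in_keys_iff)
    then show "degree (iterated F) > 0" using le_degree t(2) by fastforce
    fix q r
    show "q - r \<in> iterated ` {p. ?\<Phi> p = 0}"
      if "q \<in> iterated ` {p. ?\<Phi> p = 0}" "r \<in> iterated ` {p. ?\<Phi> p = 0}"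
      using that by (auto simp: omega.graded_eval_diff simp flip: iterated_diff)
    show "r * q \<in> iterated ` {p. ?\<Phi> p = 0}" if "q \<in> iterated ` {p. ?\<Phi> p = 0}"
      using that iterated_surj[of r] by (auto simp: omega.graded_eval_mult simp flip: iterated_mult)
    show "iterated F dvd q \<or> iterated F dvd r" if "iterated F dvd q * r"
    proof -
      obtain q' r' where "q = iterated q'" "r = iterated r'" using iterated_surj by metis
      with that prime show ?thesis by (simp add: dvd_iff flip: iterated_mult)
    qed
    show "q = 0" if q: "q \<in> iterated ` {p. ?\<Phi> p = 0}" "degree q = 0"
    proof -
      from q(1) obtain p where p: "q = iterated p" "?\<Phi> p = 0" by auto
      have "Poly_Mapping.lookup u v = 0" if "u \<in> Poly_Mapping.keys p" for u
      proof -
        have "coeff q (Poly_Mapping.lookup u v) \<noteq> 0"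
          using coeff_iterated[of p u] that p(1) by (auto simp: in_keys_iff)
        then show ?thesis using le_degree q(2) by fastforce
      qed
      then have "omega.graded_eval (point (to_omega [:0, 1:])) p = ?\<Phi> p"
        unfolding omega.graded_eval_eq monomial_value_point by simp
      with p generic_injective have "p = 0" by simp
      then show ?thesis using p(1) by (simp add: iterated_zero)
    qed
  qed
  then show ?thesis by (simp add: dvd_iff)
qed

end

lemma exists_coordinates: "\<exists>b c. coordinates v b c"
proof -
  have "card (UNIV - {v}) = 2" by (simp add: card_Diff_singleton)
  from card_2_iff[THEN iffD1, OF this] obtain b c where bc: "UNIV - {v} = {b, c}" "b \<noteq> c" by iprover
  have "b \<in> UNIV - {v}" "c \<in> UNIV - {v}" unfolding bc(1) by simp_all
  moreover have "UNIV = insert v (UNIV - {v})" by auto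
  ultimately have "coordinates v b c" using bc unfolding coordinates_def by auto
  then show ?thesis by iprover
qed

theorem plane_curve_embedding:
  fixes F :: "'k::field poly3"
  assumes F: "F \<in> homogeneous_polys m" and m: "F \<noteq> 0 \<Longrightarrow> m > 0"
    and prime: "\<And>p q. F dvd p * q \<Longrightarrow> F dvd p \<or> F dvd q"
  shows "\<exists>a :: 3 \<Rightarrow> 'k omega. (\<exists>i. a i \<noteq> 0) \<and> (\<forall>p. omega.graded_eval a p = 0 \<longleftrightarrow> F dvd p)"
proof (cases "F = 0")
  case True
  obtain b c where "coordinates 0 b c" using exists_coordinates by blast
  then interpret coordinates 0 b c .
  show ?thesis
  proof (rule exI[of _ "point (to_omega [:0, 1:])"], intro conjI allI)
    show "\<exists>i. point (to_omega [:0, 1:] :: 'k omega) i \<noteq> 0"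
      using distinct_coords by (intro exI[of _ b]) (simp add: point_def)
    show "omega.graded_eval (point (to_omega [:0, 1:])) p = 0 \<longleftrightarrow> F dvd p" for p
      using generic_injective[of p] True by (auto simp: omega.graded_eval_zero)
  qed
next
  case False
  then obtain t where t: "t \<in> Poly_Mapping.keys F" by (metis keys_eq_empty ex_in_conv)
  then have "(\<Sum>i\<in>UNIV. Poly_Mapping.lookup t i) > 0"
    using F m[OF False] by (auto simp: homogeneous_polys_def)
  then obtain v where v: "Poly_Mapping.lookup t v > 0" by (metis gr0I sum.neutral)
  obtain b c where "coordinates v b c" using exists_coordinates by blast
  then interpret coordinates v b c .
  obtain \<zeta> where \<zeta>: "omega.graded_eval (point \<zeta>) F = 0" using exists_zero[OF F t v] by blast
  show ?thesis
  proof (rule exI[of _ "point \<zeta>"], intro conjI allI)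
    show "\<exists>i. point \<zeta> i \<noteq> 0"
      using distinct_coords by (intro exI[of _ b]) (simp add: point_def)
    show "omega.graded_eval (point \<zeta>) p = 0 \<longleftrightarrow> F dvd p" for p
    proof
      assume p: "omega.graded_eval (point \<zeta>) p = 0"
      show "F dvd p" by (rule kernel_point[OF F t v _ \<zeta> p]) (rule prime)
    next
      assume "F dvd p"
      then obtain q where "p = F * q" ..
      with \<zeta> show "omega.graded_eval (point \<zeta>) p = 0" by (simp add: omega.graded_eval_mult)
    qed
  qed
qed

subsection \<open>The graded algebra of a point\<close>

lemma split_exponent:
  assumes "m \<le> total_degree t"
  shows "\<exists>s u. t = s + u \<and> total_degree s = m"
  using assms
proof (induction m)
  case 0
  then show ?case by (intro exI[of _ 0] exI[of _ t]) simp
next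
  case (Suc m)
  then obtain s u where su: "t = s + u" "total_degree s = m" by auto
  with Suc.prems have "total_degree u > 0" by (simp add: total_degree_add)
  then obtain i where i: "Poly_Mapping.lookup u i > 0"
    unfolding total_degree_def by (metis gr0I sum.neutral)
  have "u = Poly_Mapping.single i 1 + (u - Poly_Mapping.single i 1)"
    using i by (intro poly_mapping_eqI) (auto simp: lookup_add lookup_minus lookup_single when_def)
  with su have "t = (s + Poly_Mapping.single i 1) + (u - Poly_Mapping.single i 1)"
    by (metis add.assoc)
  moreover have "total_degree (s + Poly_Mapping.single i 1) = Suc m"
    by (simp add: total_degree_add su)
  ultimately show ?case by iprover
qed

text \<open>The graded ring recovered from its dehomogenized components: the power of the variable
  separates components that overlap in the field.\<close>

definition section_ring :: "(int \<Rightarrow> 'o::zero set) \<Rightarrow> 'o poly set" where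
  "section_ring V = {q. \<forall>n. coeff q n \<in> V (int n)}"

context scalar_embedding
begin

text \<open>The values of all forms of degree \<open>k\<close> at the point; for the generic point
  of the curve this is a copy of the degree \<open>k\<close> component of R.\<close>

definition evaluated :: "(3 \<Rightarrow> 'o) \<Rightarrow> int \<Rightarrow> 'o set" where
  "evaluated a k = vs.span {monomial_value a t | t. int (total_degree t) = k}"

lemma monomial_value_evaluated: "monomial_value a t \<in> evaluated a (int (total_degree t))"
  unfolding evaluated_def by (rule vs.span_base) auto

lemma evaluated_subspace: "vs.subspace (evaluated a k)"
  by (simp add: evaluated_def)

lemma evaluated_graded_algebra: "graded_algebra (evaluated a)"
  unfolding graded_algebra_def
proof (intro conjI allI impI ballI)
  show "vs.subspace (evaluated a k)" for k by (rule evaluated_subspace)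
  show "evaluated a k = {0}" if "k < 0" for k
  proof -
    have "{monomial_value a t | t. int (total_degree t) = k} = {}" using that by auto
    then show ?thesis by (simp add: evaluated_def)
  qed
  show "1 \<in> evaluated a 0" using monomial_value_evaluated[of a 0] by simp
  fix i j u w assume u: "u \<in> evaluated a i" and w: "w \<in> evaluated a j"
  show "u * w \<in> evaluated a (i + j)"
    using u unfolding evaluated_def[of a i]
  proof (rule span_times)
    fix s assume "s \<in> {monomial_value a t | t. int (total_degree t) = i}"
    then obtain t where t: "s = monomial_value a t" "int (total_degree t) = i" by auto
    have "w * s \<in> evaluated a (i + j)"
      using w unfolding evaluated_def[of a j]
    proof (rule span_times)
      fix s' assume "s' \<in> {monomial_value a t | t. int (total_degree t) = j}"
      then obtain t' where t': "s' = monomial_value a t'" "int (total_degree t') = j" by auto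
      have "s' * s = monomial_value a (t + t')"
        by (simp add: t t' monomial_value_add mult.commute)
      moreover have "int (total_degree (t + t')) = i + j" by (simp add: t t' total_degree_add)
      ultimately show "s' * s \<in> evaluated a (i + j)" using monomial_value_evaluated[of a "t + t'"] by simp
    qed (rule evaluated_subspace)
    then show "s * w \<in> evaluated a (i + j)" by (simp add: mult.commute)
  qed (rule evaluated_subspace)
qed

lemma coeff_graded_eval_evaluated: "coeff (graded_eval a p) n \<in> evaluated a (int n)"
proof -
  have "\<kappa> c * monomial_value a t \<in> evaluated a (int n)" if "total_degree t = n" for c t
    using vs.subspace_scale[OF evaluated_subspace monomial_value_evaluated[of a t]] that by simp
  then show ?thesis
    unfolding coeff_graded_eval
    by (intro vs.subspace_sum[OF evaluated_subspace]) (simp add: vs.subspace_0[OF evaluated_subspace])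
qed

lemma graded_eval_homogeneous:
  assumes "p \<in> homogeneous_polys n"
  shows "graded_eval a p = monom (coeff (graded_eval a p) n) n"
proof (rule poly_eqI)
  fix k
  have "total_degree t = n" if "t \<in> Poly_Mapping.keys p" for t
    using assms that by (auto simp: homogeneous_polys_def total_degree_def)
  then show "coeff (graded_eval a p) k = coeff (monom (coeff (graded_eval a p) n) n) k"
    by (simp add: coeff_graded_eval)
qed

lemma evaluated_homogeneous:
  assumes "w \<in> evaluated a (int n)"
  shows "\<exists>p\<in>homogeneous_polys n. graded_eval a p = monom w n"
proof -
  let ?S = "{w. \<exists>p\<in>homogeneous_polys n. graded_eval a p = monom w n}"
  have "vs.subspace ?S"
  proof (rule subspaceI)
    have "0 \<in> homogeneous_polys n" by (simp add: homogeneous_polys_def)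
    then show "0 \<in> ?S" by (auto intro!: bexI[of _ 0] simp: graded_eval_zero)
  next
    fix u w assume "u \<in> ?S" "w \<in> ?S"
    then obtain p q where pq: "p \<in> homogeneous_polys n" "q \<in> homogeneous_polys n"
      "graded_eval a p = monom u n" "graded_eval a q = monom w n" by auto
    then have "p + q \<in> homogeneous_polys n"
      using Poly_Mapping.keys_add[of p q] by (auto simp: homogeneous_polys_def)
    then show "u + w \<in> ?S"
      using pq by (auto intro!: bexI[of _ "p + q"] simp: graded_eval_add add_monom)
  next
    fix z u assume "u \<in> ?S"
    then obtain p where p: "p \<in> homogeneous_polys n" "graded_eval a p = monom u n" by auto
    have "Poly_Mapping.single 0 z * p \<in> homogeneous_polys n"
      using p(1) keys_mult[of "Poly_Mapping.single 0 z" p]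
      by (auto simp: homogeneous_polys_def split: if_splits)
    moreover have "graded_eval a (Poly_Mapping.single 0 z * p) = monom (\<kappa> z * u) n"
      by (simp add: graded_eval_mult graded_eval_single p(2) mult_monom)
    ultimately show "\<kappa> z * u \<in> ?S" by auto
  qed
  moreover have "{monomial_value a t | t. int (total_degree t) = int n} \<subseteq> ?S"
  proof
    fix w assume "w \<in> {monomial_value a t | t. int (total_degree t) = int n}"
    then obtain t where t: "w = monomial_value a t" "n = total_degree t" by auto
    have "Poly_Mapping.single t 1 \<in> homogeneous_polys n"
      by (simp add: t(2) homogeneous_polys_def total_degree_def)
    moreover have "graded_eval a (Poly_Mapping.single t 1) = monom w n"
      by (simp add: t graded_eval_single)
    ultimately show "w \<in> ?S" by auto
  qed
  ultimately have "evaluated a (int n) \<subseteq> ?S" unfolding evaluated_def by (intro vs.span_minimal)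
  with assms show ?thesis by auto
qed

lemma range_graded_eval: "range (graded_eval a) = section_ring (evaluated a)"
proof (intro equalityI subsetI)
  fix q assume "q \<in> section_ring (evaluated a)"
  then have "coeff q n \<in> evaluated a (int n)" for n by (simp add: section_ring_def)
  then have "\<exists>p\<in>homogeneous_polys n. graded_eval a p = monom (coeff q n) n" for n
    by (rule evaluated_homogeneous)
  then obtain p where "\<And>n. graded_eval a (p n) = monom (coeff q n) n" by metis
  then have "q = graded_eval a (\<Sum>n\<le>degree q. p n)"
    by (simp add: graded_eval_sum poly_as_sum_of_monoms)
  then show "q \<in> range (graded_eval a)" by (rule range_eqI)
qed (auto simp: section_ring_def coeff_graded_eval_evaluated)

text \<open>Every monomial of degree at least \<open>m\<close> has a factor of degree exactly
  \<open>m\<close>. This reduces solving for all of degree at least \<open>m\<close> to the finitely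
  many monomials of degree \<open>m\<close>.\<close>

lemma evaluated_split:
  assumes "k \<ge> int m"
  shows "evaluated a k \<subseteq> vs.span {u * w | u w. u \<in> evaluated a (k - int m) \<and>
    w \<in> monomial_value a ` {t. total_degree t = m}}"
proof -
  have "monomial_value a t \<in> {u * w | u w. u \<in> evaluated a (k - int m) \<and>
    w \<in> monomial_value a ` {t. total_degree t = m}}" if t: "int (total_degree t) = k" for t
  proof -
    have "m \<le> total_degree t" using t assms by simp
    from split_exponent[OF this] obtain s u where su: "t = s + u" "total_degree s = m" by blast
    then have "int (total_degree u) = k - int m" using t by (simp add: total_degree_add)
    moreover have "monomial_value a t = monomial_value a u * monomial_value a s"
      by (simp add: su monomial_value_add mult.commute)
    ultimately show ?thesis using su(2) monomial_value_evaluated[of a u] by auto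
  qed
  then show ?thesis unfolding evaluated_def[of a k] by (intro vs.span_mono) auto
qed

end

section \<open>Primary pairs as parameters, and solving in all large degrees\<close>

context two_parameters
begin

text \<open>A graded Nakayama argument. A monomial of degree above the sum of the \<open>n i\<close>
  contains some \<open>a i ^ n i\<close>, which lies in the ideal of \<open>x\<close> and
  \<open>y\<close>; the cofactors have smaller degree because \<open>dx\<close> and
  \<open>dy\<close> are positive. So the monomials up to that bound generate over K[x,y].\<close>

lemma evaluated_finite_algebra:
  assumes xy: "x \<in> evaluated a (int dx)" "y \<in> evaluated a (int dy)"
    and primary: "\<And>i. \<exists>n. \<exists>u\<in>evaluated a (int n - int dx). \<exists>w\<in>evaluated a (int n - int dy). a i ^ n = u * x + w * y"
  shows "finite_algebra (evaluated a)"
proof -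
  note ga = evaluated_graded_algebra[of a]
  obtain n where n: "\<And>i. \<exists>u\<in>evaluated a (int (n i) - int dx). \<exists>w\<in>evaluated a (int (n i) - int dy).
      a i ^ n i = u * x + w * y"
    using primary by metis
  define M where "M = (\<Sum>i\<in>UNIV. n i)"
  define B where "B = (\<lambda>t. (monomial_value a t, total_degree t)) ` {t. total_degree t \<le> M}"
  have reduce: "\<exists>u\<in>evaluated a (int k - int dx). \<exists>w\<in>evaluated a (int k - int dy). monomial_value a t = u * x + w * y"
    if t: "total_degree t = k" "k > M" for t k
  proof -
    obtain i where i: "n i \<le> Poly_Mapping.lookup t i"
    proof (rule ccontr)
      assume "\<not> thesis"
      with that have "\<And>i. Poly_Mapping.lookup t i \<le> n i" by (meson nat_le_linear)
      then have "total_degree t \<le> M" unfolding total_degree_def M_def by (intro sum_mono)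
      with t show False by simp
    qed
    let ?s = "Poly_Mapping.single i (n i)"
    have ts: "t = ?s + (t - ?s)"
      using i by (intro poly_mapping_eqI) (auto simp: lookup_add lookup_minus lookup_single when_def)
    then have deg: "int k = int (n i) + int (total_degree (t - ?s))"
      using t(1) by (metis of_nat_add total_degree_add total_degree_single)
    have val: "monomial_value a t = a i ^ n i * monomial_value a (t - ?s)"
      using ts by (metis monomial_value_add monomial_value_single)
    from n[of i] obtain u w where uw: "u \<in> evaluated a (int (n i) - int dx)"
      "w \<in> evaluated a (int (n i) - int dy)" "a i ^ n i = u * x + w * y" by auto
    show ?thesis
    proof (intro bexI)
      show "monomial_value a t = (u * monomial_value a (t - ?s)) * x + (w * monomial_value a (t - ?s)) * y"
        by (simp add: val uw(3) algebra_simps)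
      show "u * monomial_value a (t - ?s) \<in> evaluated a (int k - int dx)"
        "w * monomial_value a (t - ?s) \<in> evaluated a (int k - int dy)"
        using deg by (auto intro!: ga_mult'[OF ga uw(1) monomial_value_evaluated]
            ga_mult'[OF ga uw(2) monomial_value_evaluated])
    qed
  qed
  have mult_mono: "v * z \<in> vs.span (monomials B (k + int d))"
    if "v \<in> vs.span (monomials B k)" "z = x \<and> d = dx \<or> z = y \<and> d = dy" for v z k d
    using that(1)
  proof (rule span_times)
    fix s assume "s \<in> monomials B k"
    then obtain i j b \<delta> where s: "s = x ^ i * y ^ j * b" "(b, \<delta>) \<in> B" "int (i * dx + j * dy + \<delta>) = k"
      by (auto simp: monomials_def)
    from that(2) have "s * z \<in> monomials B (k + int d)"
    proof
      assume "z = x \<and> d = dx"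
      then show ?thesis unfolding monomials_def using s
        by (intro CollectI exI[of _ "Suc i"] exI[of _ j] exI[of _ b] exI[of _ \<delta>]) auto
    next
      assume "z = y \<and> d = dy"
      then show ?thesis unfolding monomials_def using s
        by (intro CollectI exI[of _ i] exI[of _ "Suc j"] exI[of _ b] exI[of _ \<delta>]) auto
    qed
    then show "s * z \<in> vs.span (monomials B (k + int d))" by (rule vs.span_base)
  qed simp
  have "evaluated a (int k) \<subseteq> vs.span (monomials B (int k))" for k
  proof (induction k rule: less_induct)
    case (less k)
    have sub: "v * z \<in> vs.span (monomials B (int k))"
      if "v \<in> evaluated a (int k - int d)" "z = x \<and> d = dx \<or> z = y \<and> d = dy" for v z d
    proof (cases "d \<le> k")
      case True
      have "d > 0" using that(2) dx_pos dy_pos by auto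
      with True have "k - d < k" by simp
      moreover have "v \<in> evaluated a (int (k - d))" using that(1) True by (simp add: of_nat_diff)
      ultimately have "v \<in> vs.span (monomials B (int (k - d)))" using less by blast
      from mult_mono[OF this that(2)] True show ?thesis by (simp add: of_nat_diff)
    next
      case False
      then have "v = 0" using that(1) ga_neg[OF ga, of "int k - int d"] by auto
      then show ?thesis by (simp add: vs.span_zero)
    qed
    have "monomial_value a t \<in> vs.span (monomials B (int k))" if t: "total_degree t = k" for t
    proof (cases "k > M")
      case True
      from reduce[OF t True] obtain u w where "u \<in> evaluated a (int k - int dx)"
        "w \<in> evaluated a (int k - int dy)" "monomial_value a t = u * x + w * y" by auto
      then show ?thesis using sub[of u dx x] sub[of w dy y] by (auto intro: vs.span_add)
    next
      case False
      then have "(monomial_value a t, k) \<in> B" using t by (auto simp: B_def)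
      then have "monomial_value a t \<in> monomials B (int k)"
        unfolding monomials_def
        by (intro CollectI exI[of _ 0] exI[of _ "monomial_value a t"] exI[of _ k]) simp
      then show ?thesis by (rule vs.span_base)
    qed
    then show ?case unfolding evaluated_def[of a "int k"] by (intro vs.span_minimal) auto
  qed
  moreover have "evaluated a k \<subseteq> vs.span (monomials B k)" if "k < 0" for k
    using ga_neg[OF ga that] by (simp add: vs.span_zero)
  ultimately have "evaluated a k \<subseteq> vs.span (monomials B k)" for k
    by (cases "k < 0") (simp, metis int_nat_eq linorder_not_less)
  moreover have "finite B" unfolding B_def using finite_total_degree_le by simp
  moreover have "w \<in> evaluated a (int \<delta>)" if "(w, \<delta>) \<in> B" for w \<delta>
    using that monomial_value_evaluated by (auto simp: B_def)
  ultimately show ?thesis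
    unfolding finite_algebra_def using ga xy by (intro conjI exI[of _ B]) auto
qed

text \<open>Solutions persist in larger algebras, so induction over the finitely many monomials of
  degree \<open>m\<close> gives one extension for all of them, and higher degrees follow by
  linearity and multiplication.\<close>

lemma extend_to_degree_ge:
  fixes m d3 :: nat
  assumes V: "finite_algebra (evaluated a)"
    and f3: "f3 \<in> evaluated a (int d3)"
    and g: "g1 \<in> evaluated a (int m - int dx)" "g2 \<in> evaluated a (int m - int dy)" "g3 \<in> evaluated a (int m - int d3)"
    and rel: "x * g1 + y * g2 + f3 * g3 = 0"
    and r: "r1 \<in> evaluated a (int (N * dx) - (int m - int dx))" "r2 \<in> evaluated a (int (N * dx) - (int m - int dy))"
       "r3 \<in> evaluated a (int (N * dx) - (int m - int d3))" "x ^ N = r1 * g1 + r2 * g2 + r3 * g3"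
    and s: "s1 \<in> evaluated a (int (N * dy) - (int m - int dx))" "s2 \<in> evaluated a (int (N * dy) - (int m - int dy))"
       "s3 \<in> evaluated a (int (N * dy) - (int m - int d3))" "y ^ N = s1 * g1 + s2 * g2 + s3 * g3"
    and m: "m \<ge> dx" "m \<ge> dy" "m \<ge> d3" "2 * m \<ge> dx + dy + d3"
  shows "\<exists>V'. finite_algebra V' \<and> (\<forall>k. evaluated a k \<subseteq> V' k) \<and>
    (\<forall>k\<ge>int m. \<forall>z\<in>evaluated a k. \<exists>\<alpha>1\<in>V' (k - int dx). \<exists>\<alpha>2\<in>V' (k - int dy). \<exists>\<alpha>3\<in>V' (k - int d3).
       z = \<alpha>1 * x + \<alpha>2 * y + \<alpha>3 * f3)"
proof -
  define solvable where "solvable V k z \<longleftrightarrow>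
    (\<exists>\<alpha>1\<in>V (k - int dx). \<exists>\<alpha>2\<in>V (k - int dy). \<exists>\<alpha>3\<in>V (k - int d3). z = \<alpha>1 * x + \<alpha>2 * y + \<alpha>3 * f3)"
    for V :: "int \<Rightarrow> 'o set" and k z
  have "\<exists>V'. finite_algebra V' \<and> (\<forall>k. evaluated a k \<subseteq> V' k) \<and> (\<forall>z\<in>A. solvable V' (int m) z)"
    if "finite A" "A \<subseteq> evaluated a (int m)" for A
    using that
  proof (induction A rule: finite_induct)
    case empty
    then show ?case using V by auto
  next
    case (insert f0 A)
    have "A \<subseteq> evaluated a (int m)" using insert.prems by simp
    from insert.IH[OF this] obtain V1 where V1: "finite_algebra V1" "\<And>k. evaluated a k \<subseteq> V1 k"
      "\<And>z. z \<in> A \<Longrightarrow> solvable V1 (int m) z" by auto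
    note up = subsetD[OF V1(2)]
    have m': "int m \<ge> int dx" "int m \<ge> int dy" "int m \<ge> int d3" "2 * int m \<ge> int dx + int dy + int d3"
      using m by linarith+
    have "f0 \<in> V1 (int m)" using insert.prems up by simp
    from extend_to_solution[OF V1(1) up[OF f3] up[OF g(1)] up[OF g(2)] up[OF g(3)] rel
        up[OF r(1)] up[OF r(2)] up[OF r(3)] r(4) up[OF s(1)] up[OF s(2)] up[OF s(3)] s(4) m' this]
    obtain V2 \<alpha>1 \<alpha>2 \<alpha>3 where V2: "finite_algebra V2" "\<And>k. V1 k \<subseteq> V2 k"
      and \<alpha>: "\<alpha>1 \<in> V2 (int m - int dx)" "\<alpha>2 \<in> V2 (int m - int dy)" "\<alpha>3 \<in> V2 (int m - int d3)"
        "f0 = \<alpha>1 * x + \<alpha>2 * y + \<alpha>3 * f3" by blast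
    have "solvable V2 (int m) z" if "z \<in> insert f0 A" for z
    proof (cases "z = f0")
      case True
      then show ?thesis unfolding solvable_def using \<alpha> by auto
    next
      case False
      then have "solvable V1 (int m) z" using that V1(3) by simp
      then show ?thesis unfolding solvable_def using V2(2) by (meson subsetD)
    qed
    moreover have "evaluated a k \<subseteq> V2 k" for k using V1(2) V2(2) by (rule order_trans)
    ultimately show ?case using V2(1) by auto
  qed
  moreover have "finite {t. total_degree t = m}"
    by (rule finite_subset[OF _ finite_total_degree_le[of m]]) auto
  moreover have "monomial_value a ` {t. total_degree t = m} \<subseteq> evaluated a (int m)"
    using monomial_value_evaluated by auto
  ultimately obtain V' where V': "finite_algebra V'" "\<And>k. evaluated a k \<subseteq> V' k"
    "\<And>z. z \<in> monomial_value a ` {t. total_degree t = m} \<Longrightarrow> solvable V' (int m) z"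
    by (metis finite_imageI)
  note ga = finite_algebraD[OF V'(1)]
  have "solvable V' k z" if k: "k \<ge> int m" and z: "z \<in> evaluated a k" for k z
  proof -
    have "vs.subspace {z. solvable V' k z}"
    proof (rule subspaceI)
      show "0 \<in> {z. solvable V' k z}"
        using ga_zero[OF ga(1)] by (auto simp: solvable_def intro!: bexI[of _ 0])
      fix u w assume "u \<in> {z. solvable V' k z}" "w \<in> {z. solvable V' k z}"
      then obtain \<alpha>1 \<alpha>2 \<alpha>3 \<beta>1 \<beta>2 \<beta>3 where
        \<alpha>: "\<alpha>1 \<in> V' (k - int dx)" "\<alpha>2 \<in> V' (k - int dy)" "\<alpha>3 \<in> V' (k - int d3)" "u = \<alpha>1 * x + \<alpha>2 * y + \<alpha>3 * f3"
        and \<beta>: "\<beta>1 \<in> V' (k - int dx)" "\<beta>2 \<in> V' (k - int dy)" "\<beta>3 \<in> V' (k - int d3)" "w = \<beta>1 * x + \<beta>2 * y + \<beta>3 * f3"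
        by (auto simp: solvable_def)
      have "u + w = (\<alpha>1 + \<beta>1) * x + (\<alpha>2 + \<beta>2) * y + (\<alpha>3 + \<beta>3) * f3"
        by (simp add: \<alpha> \<beta> algebra_simps)
      then show "u + w \<in> {z. solvable V' k z}"
        unfolding solvable_def mem_Collect_eq using ga_add[OF ga(1) \<alpha>(1) \<beta>(1)] ga_add[OF ga(1) \<alpha>(2) \<beta>(2)]
          ga_add[OF ga(1) \<alpha>(3) \<beta>(3)] by (intro bexI)
    next
      fix c u assume "u \<in> {z. solvable V' k z}"
      then obtain \<alpha>1 \<alpha>2 \<alpha>3 where
        \<alpha>: "\<alpha>1 \<in> V' (k - int dx)" "\<alpha>2 \<in> V' (k - int dy)" "\<alpha>3 \<in> V' (k - int d3)" "u = \<alpha>1 * x + \<alpha>2 * y + \<alpha>3 * f3"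
        by (auto simp: solvable_def)
      have "\<kappa> c * u = (\<kappa> c * \<alpha>1) * x + (\<kappa> c * \<alpha>2) * y + (\<kappa> c * \<alpha>3) * f3"
        by (simp add: \<alpha> algebra_simps)
      then show "\<kappa> c * u \<in> {z. solvable V' k z}"
        unfolding solvable_def mem_Collect_eq using ga_scale[OF ga(1) \<alpha>(1)] ga_scale[OF ga(1) \<alpha>(2)]
          ga_scale[OF ga(1) \<alpha>(3)] by (intro bexI)
    qed
    moreover have "{u * w | u w. u \<in> evaluated a (k - int m) \<and> w \<in> monomial_value a ` {t. total_degree t = m}}
        \<subseteq> {z. solvable V' k z}"
    proof
      fix z assume "z \<in> {u * w | u w. u \<in> evaluated a (k - int m) \<and> w \<in> monomial_value a ` {t. total_degree t = m}}"
      then obtain u w where uw: "z = u * w" "u \<in> V' (k - int m)" "solvable V' (int m) w"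
        using V'(2,3) by blast
      from uw(3) obtain \<alpha>1 \<alpha>2 \<alpha>3 where
        \<alpha>: "\<alpha>1 \<in> V' (int m - int dx)" "\<alpha>2 \<in> V' (int m - int dy)" "\<alpha>3 \<in> V' (int m - int d3)"
          "w = \<alpha>1 * x + \<alpha>2 * y + \<alpha>3 * f3"
        by (auto simp: solvable_def)
      have "z = (u * \<alpha>1) * x + (u * \<alpha>2) * y + (u * \<alpha>3) * f3" by (simp add: uw \<alpha> algebra_simps)
      moreover have "u * \<alpha>1 \<in> V' (k - int dx)" "u * \<alpha>2 \<in> V' (k - int dy)" "u * \<alpha>3 \<in> V' (k - int d3)"
        by (auto intro!: ga_mult'[OF ga(1) uw(2) \<alpha>(1)] ga_mult'[OF ga(1) uw(2) \<alpha>(2)] ga_mult'[OF ga(1) uw(2) \<alpha>(3)])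
      ultimately show "z \<in> {z. solvable V' k z}" unfolding solvable_def mem_Collect_eq by (intro bexI)
    qed
    ultimately have "evaluated a k \<subseteq> {z. solvable V' k z}"
      using evaluated_split[OF k] vs.span_minimal by (meson order_trans)
    with z show ?thesis by auto
  qed
  with V'(1,2) show ?thesis unfolding solvable_def by (intro exI[of _ V']) blast
qed

end

section \<open>Graded rings modelled by polynomials\<close>

lemma ring_of_type_algebra_simps [simp]:
  "carrier ring_of_type_algebra = UNIV" "\<one>\<^bsub>ring_of_type_algebra\<^esub> = 1" "\<zero>\<^bsub>ring_of_type_algebra\<^esub> = 0"
  "p \<otimes>\<^bsub>ring_of_type_algebra\<^esub> q = p * q" "p \<oplus>\<^bsub>ring_of_type_algebra\<^esub> q = p + q"
  by (simp_all add: ring_of_type_algebra_def)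

text \<open>Bridge between abstract graded rings and families of subspaces: \<open>\<psi>\<close>
  identifies \<open>S\<close> with the section ring of \<open>V\<close>, so homogeneous components
  can be read off as coefficients. It is instantiated both for R and for its extension on
  lists.\<close>

locale graded_model = cring S for S (structure) +
  fixes G :: "nat \<Rightarrow> 'a set" and \<psi> :: "'a \<Rightarrow> 'o::field poly" and V :: "int \<Rightarrow> 'o set"
  assumes \<psi>_hom: "\<psi> \<in> Ring.ring_hom S ring_of_type_algebra"
    and \<psi>_inj: "inj_on \<psi> (carrier S)"
    and \<psi>_image: "\<psi> ` carrier S = section_ring V"
    and G_eq: "G k = {r \<in> carrier S. \<exists>w\<in>V (int k). \<psi> r = Polynomial.monom w k}"
    and V_zero: "0 \<in> V l" and V_add: "u \<in> V l \<Longrightarrow> w \<in> V l \<Longrightarrow> u + w \<in> V l"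
    and V_minus: "u \<in> V l \<Longrightarrow> - u \<in> V l" and V_one: "1 \<in> V 0"
    and V_mult: "u \<in> V i \<Longrightarrow> w \<in> V j \<Longrightarrow> u * w \<in> V (i + j)"
begin

lemma \<psi>_add: "r \<in> carrier S \<Longrightarrow> s \<in> carrier S \<Longrightarrow> \<psi> (r \<oplus> s) = \<psi> r + \<psi> s"
  and \<psi>_mult: "r \<in> carrier S \<Longrightarrow> s \<in> carrier S \<Longrightarrow> \<psi> (r \<otimes> s) = \<psi> r * \<psi> s"
  and \<psi>_one: "\<psi> \<one> = 1"
  using ring_hom_add[OF \<psi>_hom] ring_hom_mult[OF \<psi>_hom] ring_hom_one[OF \<psi>_hom] by simp_all

lemma \<psi>_zero: "\<psi> \<zero> = 0"
  using \<psi>_add[OF zero_closed zero_closed] unfolding l_zero[OF zero_closed]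
  by (metis add.right_neutral add_left_cancel)

lemma \<psi>_minus: "r \<in> carrier S \<Longrightarrow> \<psi> (\<ominus> r) = - \<psi> r"
  using \<psi>_add[of r "\<ominus> r"] by (simp add: \<psi>_zero r_neg eq_neg_iff_add_eq_0 add.commute)

lemma \<psi>_eq_iff: "r \<in> carrier S \<Longrightarrow> s \<in> carrier S \<Longrightarrow> \<psi> r = \<psi> s \<longleftrightarrow> r = s"
  using \<psi>_inj by (auto simp: inj_on_def)

lemma \<psi>_pow: "r \<in> carrier S \<Longrightarrow> \<psi> (r [^] (n::nat)) = \<psi> r ^ n"
  by (induction n) (simp_all add: \<psi>_one \<psi>_mult mult.commute)

lemma \<psi>_finsum:
  assumes "\<And>k. k \<in> A \<Longrightarrow> c k \<in> carrier S"
  shows "\<psi> (finsum S c A) = (\<Sum>k\<in>A. \<psi> (c k))"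
  using assms
  by (induction A rule: infinite_finite_induct) (simp_all add: \<psi>_zero \<psi>_add finsum_insert Pi_def)

lemma \<psi>_preimage: "q \<in> section_ring V \<Longrightarrow> \<exists>r\<in>carrier S. \<psi> r = q"
  using \<psi>_image by (metis imageE)

lemma \<psi>_coeff: "r \<in> carrier S \<Longrightarrow> poly.coeff (\<psi> r) n \<in> V (int n)"
  using \<psi>_image unfolding section_ring_def by blast

lemma decomposes_coeff:
  assumes c: "decomposes S G x c"
  shows "x \<in> carrier S" "\<psi> (c k) = Polynomial.monom (poly.coeff (\<psi> x) k) k"
proof -
  have "c k \<in> carrier S" for k using c by (auto simp: decomposes_def G_eq)
  then show "x \<in> carrier S" using c by (auto simp: decomposes_def intro!: finsum_closed)
  from c have "\<exists>w. \<psi> (c k) = Polynomial.monom w k" for k by (auto simp: decomposes_def G_eq)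
  then obtain w where w: "\<And>k. \<psi> (c k) = Polynomial.monom (w k) k" by metis
  let ?A = "{k. c k \<noteq> \<zero>}"
  have "\<psi> x = (\<Sum>k\<in>?A. Polynomial.monom (w k) k)"
    using c \<open>\<And>k. c k \<in> carrier S\<close> by (simp add: decomposes_def \<psi>_finsum w)
  moreover have "w k = 0" if "k \<notin> ?A" for k
    using w[of k] that by (simp add: \<psi>_zero)
  moreover have "finite ?A" using c by (simp add: decomposes_def)
  ultimately have "poly.coeff (\<psi> x) k = w k"
    by (cases "k \<in> ?A") (auto simp: coeff_sum)
  then show "\<psi> (c k) = Polynomial.monom (poly.coeff (\<psi> x) k) k" by (simp add: w)
qed

lemma ex_decomposes:
  assumes x: "x \<in> carrier S"
  shows "\<exists>c. decomposes S G x c"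
proof -
  have "Polynomial.monom (poly.coeff (\<psi> x) k) k \<in> section_ring V" for k
    using \<psi>_coeff[OF x] by (auto simp: section_ring_def V_zero)
  then have "\<exists>r\<in>carrier S. \<psi> r = Polynomial.monom (poly.coeff (\<psi> x) k) k" for k by (rule \<psi>_preimage)
  then obtain c where c: "\<And>k. c k \<in> carrier S" "\<And>k. \<psi> (c k) = Polynomial.monom (poly.coeff (\<psi> x) k) k" by metis
  have zero: "c k = \<zero> \<longleftrightarrow> poly.coeff (\<psi> x) k = 0" for k
    using \<psi>_eq_iff[OF c(1)[of k], of \<zero>] by (simp add: \<psi>_zero c(2))
  have fin: "finite {k. poly.coeff (\<psi> x) k \<noteq> 0}"
    by (rule finite_subset[of _ "{..degree (\<psi> x)}"]) (auto intro: le_degree)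
  have "\<psi> (finsum S c {k. c k \<noteq> \<zero>}) = (\<Sum>k | poly.coeff (\<psi> x) k \<noteq> 0. Polynomial.monom (poly.coeff (\<psi> x) k) k)"
    by (simp add: \<psi>_finsum c zero)
  also have "\<dots> = (\<Sum>k\<le>Polynomial.degree (\<psi> x). Polynomial.monom (poly.coeff (\<psi> x) k) k)"
    by (rule sum.mono_neutral_left) (auto intro: le_degree)
  also have "\<dots> = \<psi> x" by (rule poly_as_sum_of_monoms)
  finally have "x = finsum S c {k. c k \<noteq> \<zero>}"
    using \<psi>_eq_iff[OF x, of "finsum S c {k. c k \<noteq> \<zero>}"] c(1) by auto
  moreover have "c k \<in> G k" for k using c \<psi>_coeff[OF x, of k] by (auto simp: G_eq)
  ultimately show ?thesis using fin by (intro exI[of _ c]) (simp add: decomposes_def zero)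
qed

lemma graded_ring: "graded_ring S G"
proof (intro graded_ring.intro graded_ring_axioms.intro)
  show "cring S" by (rule is_cring)
  show "additive_subgroup (G k) S" for k
  proof (rule additive_subgroupI, rule group.subgroupI[OF a_group])
    show "G k \<subseteq> carrier (add_monoid S)" by (auto simp: G_eq)
    have "\<zero> \<in> G k" by (auto simp: G_eq \<psi>_zero V_zero intro!: bexI[of _ 0])
    then show "G k \<noteq> {}" by auto
    fix r assume "r \<in> G k"
    then obtain w where w: "r \<in> carrier S" "w \<in> V (int k)" "\<psi> r = Polynomial.monom w k" by (auto simp: G_eq)
    then have "\<ominus> r \<in> G k"
      using V_minus[OF w(2)] by (auto simp: G_eq \<psi>_minus minus_monom intro!: bexI[of _ "- w"])
    then show "inv\<^bsub>add_monoid S\<^esub> r \<in> G k" by (simp add: a_inv_def)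
    fix s assume "s \<in> G k"
    then obtain u where u: "s \<in> carrier S" "u \<in> V (int k)" "\<psi> s = Polynomial.monom u k" by (auto simp: G_eq)
    then have "r \<oplus> s \<in> G k"
      using w V_add[OF w(2) u(2)] by (auto simp: G_eq \<psi>_add add_monom intro!: bexI[of _ "w + u"])
    then show "r \<otimes>\<^bsub>add_monoid S\<^esub> s \<in> G k" by simp
  qed
  show "\<one> \<in> G 0" by (auto simp: G_eq \<psi>_one V_one intro!: bexI[of _ 1])
  fix r s i j assume "r \<in> G i" "s \<in> G j"
  then obtain w u where wu: "r \<in> carrier S" "w \<in> V (int i)" "\<psi> r = Polynomial.monom w i"
    "s \<in> carrier S" "u \<in> V (int j)" "\<psi> s = Polynomial.monom u j" by (auto simp: G_eq)
  then show "r \<otimes> s \<in> G (i + j)"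
    using V_mult[OF wu(2) wu(5)] by (auto simp: G_eq \<psi>_mult mult_monom intro!: bexI[of _ "w * u"])
next
  fix x assume x: "x \<in> carrier S"
  show "\<exists>!c. decomposes S G x c"
  proof (rule ex_ex1I[OF ex_decomposes[OF x]])
    fix c c' assume cc: "decomposes S G x c" "decomposes S G x c'"
    show "c = c'"
    proof
      fix k
      have "c k \<in> carrier S" "c' k \<in> carrier S" using cc by (auto simp: decomposes_def G_eq)
      then show "c k = c' k"
        using decomposes_coeff(2)[OF cc(1), of k] decomposes_coeff(2)[OF cc(2), of k] \<psi>_eq_iff by metis
    qed
  qed
qed

lemma degree_ge_iff: "x \<in> degree_ge S G n \<longleftrightarrow> x \<in> carrier S \<and> (\<forall>k<n. poly.coeff (\<psi> x) k = 0)"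
proof -
  have "c k = \<zero> \<longleftrightarrow> poly.coeff (\<psi> x) k = 0" if "decomposes S G x c" for c k
  proof -
    have "c k \<in> carrier S" using that by (auto simp: decomposes_def G_eq)
    then show ?thesis
      using decomposes_coeff(2)[OF that, of k] \<psi>_eq_iff[of "c k" \<zero>] by (simp add: \<psi>_zero)
  qed
  note zero = this
  show ?thesis
  proof
    assume "x \<in> degree_ge S G n"
    then obtain c where c: "decomposes S G x c" "\<And>k. k < n \<Longrightarrow> c k = \<zero>" by (auto simp: degree_ge_def)
    then show "x \<in> carrier S \<and> (\<forall>k<n. poly.coeff (\<psi> x) k = 0)"
      using zero[OF c(1)] decomposes_coeff(1)[OF c(1)] by simp
  next
    assume x: "x \<in> carrier S \<and> (\<forall>k<n. poly.coeff (\<psi> x) k = 0)"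
    then obtain c where c: "decomposes S G x c" using ex_decomposes by iprover
    then show "x \<in> degree_ge S G n"
      unfolding degree_ge_def using zero[OF c] x by (auto intro!: exI[of _ c])
  qed
qed

end

section \<open>Membership in ideals with two or three generators\<close>

lemma (in cring) mem_genideal_triple:
  assumes abc: "a \<in> carrier R" "b \<in> carrier R" "c \<in> carrier R" and z: "z \<in> Idl {a, b, c}"
  shows "\<exists>u\<in>carrier R. \<exists>v\<in>carrier R. \<exists>w\<in>carrier R. z = u \<otimes> a \<oplus> v \<otimes> b \<oplus> w \<otimes> c"
proof -
  let ?J = "set_add R (set_add R (PIdl a) (PIdl b)) (PIdl c)"
  have mem: "z \<in> ?J \<longleftrightarrow> (\<exists>u\<in>carrier R. \<exists>v\<in>carrier R. \<exists>w\<in>carrier R. z = u \<otimes> a \<oplus> v \<otimes> b \<oplus> w \<otimes> c)" for z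
    unfolding set_add_def' cgenideal_def by auto
  have "ideal ?J R" by (intro add_ideals cgenideal_ideal abc)
  moreover have "a \<in> ?J"
    unfolding mem using abc by (intro bexI[of _ \<one>] bexI[of _ \<zero>]) simp_all
  moreover have "b \<in> ?J"
    unfolding mem
    by (rule bexI[of _ \<zero>], rule bexI[of _ \<one>], rule bexI[of _ \<zero>]) (use abc in simp_all)
  moreover have "c \<in> ?J"
    unfolding mem
    by (rule bexI[of _ \<zero>], rule bexI[of _ \<zero>], rule bexI[of _ \<one>]) (use abc in simp_all)
  ultimately have "Idl {a, b, c} \<subseteq> ?J" by (intro genideal_minimal) simp_all
  with z have "z \<in> ?J" by (rule subsetD[rotated])
  then show ?thesis unfolding mem .
qed

lemma (in cring) mem_genideal_pair:
  assumes ab: "a \<in> carrier R" "b \<in> carrier R" and z: "z \<in> Idl {a, b}"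
  shows "\<exists>u\<in>carrier R. \<exists>w\<in>carrier R. z = u \<otimes> a \<oplus> w \<otimes> b"
proof -
  have "z \<in> Idl {a, b, b}" using z by simp
  from mem_genideal_triple[OF ab ab(2) this] obtain u v w where
    uvw: "u \<in> carrier R" "v \<in> carrier R" "w \<in> carrier R" "z = u \<otimes> a \<oplus> v \<otimes> b \<oplus> w \<otimes> b" by auto
  then have "z = u \<otimes> a \<oplus> (v \<oplus> w) \<otimes> b" using ab by (simp add: l_distr a_assoc)
  then show ?thesis using uvw by (intro bexI[of _ u] bexI[of _ "v \<oplus> w"]) simp_all
qed

subsection \<open>Realizing a finite extension on lists\<close>

text \<open>A module with generators \<open>us\<close> over \<open>carrier S\<close> is realized on coefficient lists: an element is
  represented by one chosen list of coefficients.\<close>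

locale list_extension = graded_model S G \<psi> V
  for S :: "('a, 'm) ring_scheme" (structure) and G and \<psi> :: "'a \<Rightarrow> 'o::field poly" and V +
  fixes V' :: "int \<Rightarrow> 'o set" and us :: "'o poly list"
  assumes V'_zero: "0 \<in> V' k" and V'_add: "u \<in> V' k \<Longrightarrow> w \<in> V' k \<Longrightarrow> u + w \<in> V' k"
    and V'_minus: "u \<in> V' k \<Longrightarrow> - u \<in> V' k" and V'_one: "1 \<in> V' 0"
    and V'_mult: "u \<in> V' i \<Longrightarrow> w \<in> V' j \<Longrightarrow> u * w \<in> V' (i + j)"
    and V_subset: "V k \<subseteq> V' k"
    and us: "set us \<subseteq> section_ring V'"
    and generated: "q \<in> section_ring V' \<Longrightarrow>
      \<exists>ls. length ls = length us \<and> set ls \<subseteq> carrier S \<and> q = (\<Sum>(l, u)\<leftarrow>zip ls us. \<psi> l * u)"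
begin

abbreviation T :: "'o poly set" where "T \<equiv> section_ring V'"

definition dec :: "'a list \<Rightarrow> 'o poly" where
  "dec ls = (\<Sum>(l, u)\<leftarrow>zip ls us. \<psi> l * u)"

definition enc :: "'o poly \<Rightarrow> 'a list" where
  "enc q = (SOME ls. dec ls = q)"

definition list_ring :: "'a list ring" where
  "list_ring = \<lparr>carrier = enc ` T, monoid.mult = (\<lambda>a b. enc (dec a * dec b)), one = enc 1,
     ring.zero = enc 0, add = (\<lambda>a b. enc (dec a + dec b))\<rparr>"

definition list_grading :: "nat \<Rightarrow> 'a list set" where
  "list_grading k = {r \<in> carrier list_ring. \<exists>w\<in>V' (int k). dec r = Polynomial.monom w k}"

lemma dec_enc: "q \<in> T \<Longrightarrow> dec (enc q) = q"
  unfolding enc_def by (rule someI_ex) (use generated[of q] in \<open>auto simp: dec_def\<close>)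

lemma T_add: "p \<in> T \<Longrightarrow> q \<in> T \<Longrightarrow> p + q \<in> T"
  and T_minus: "p \<in> T \<Longrightarrow> - p \<in> T"
  and T_zero: "0 \<in> T" and T_one: "1 \<in> T"
  by (auto simp: section_ring_def V'_add V'_minus V'_zero V'_one coeff_1)

lemma T_mult:
  assumes "p \<in> T" "q \<in> T" shows "p * q \<in> T"
proof -
  have sum: "(\<Sum>i\<in>A. f i) \<in> V' k" if "\<And>i. i \<in> A \<Longrightarrow> f i \<in> V' k" for A :: "nat set" and f k
    using that by (induction A rule: infinite_finite_induct) (auto intro: V'_zero V'_add)
  have "poly.coeff p i * poly.coeff q (n - i) \<in> V' (int n)" if "i \<le> n" for i n
  proof -
    have "poly.coeff p i \<in> V' (int i)" "poly.coeff q (n - i) \<in> V' (int (n - i))"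
      using assms unfolding section_ring_def by blast+
    from V'_mult[OF this] show ?thesis using that by simp
  qed
  then show ?thesis
    unfolding section_ring_def mem_Collect_eq coeff_mult by (intro allI sum) simp
qed

lemma carrier_list_ring: "a \<in> carrier list_ring \<longleftrightarrow> (\<exists>q\<in>T. a = enc q)"
  by (auto simp: list_ring_def)

lemma dec_in_T: "a \<in> carrier list_ring \<Longrightarrow> dec a \<in> T"
  and enc_dec: "a \<in> carrier list_ring \<Longrightarrow> enc (dec a) = a"
  by (auto simp: carrier_list_ring dec_enc)

lemma enc_in: "q \<in> T \<Longrightarrow> enc q \<in> carrier list_ring"
  by (auto simp: carrier_list_ring)

lemma list_ring_ops:
  "a \<otimes>\<^bsub>list_ring\<^esub> b = enc (dec a * dec b)" "a \<oplus>\<^bsub>list_ring\<^esub> b = enc (dec a + dec b)"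
  "\<one>\<^bsub>list_ring\<^esub> = enc 1" "\<zero>\<^bsub>list_ring\<^esub> = enc 0"
  by (simp_all add: list_ring_def)

lemma cring_list_ring: "cring list_ring"
proof (rule cringI)
  show "abelian_group list_ring"
  proof (rule abelian_groupI)
    fix a assume a: "a \<in> carrier list_ring"
    show "\<exists>b\<in>carrier list_ring. b \<oplus>\<^bsub>list_ring\<^esub> a = \<zero>\<^bsub>list_ring\<^esub>"
      by (rule bexI[of _ "enc (- dec a)"]) (use dec_in_T[OF a] in \<open>simp_all add: list_ring_ops dec_enc T_minus enc_in\<close>)
  qed (simp_all add: list_ring_ops dec_enc enc_dec enc_in dec_in_T T_add T_zero add_ac)
  show "comm_monoid list_ring"
    by (rule comm_monoidI)
      (simp_all add: list_ring_ops dec_enc enc_dec enc_in dec_in_T T_mult T_one mult_ac)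
qed (simp add: list_ring_ops dec_enc dec_in_T T_mult T_add distrib_right)

lemma graded_model_list_ring: "graded_model list_ring list_grading dec V'"
proof (intro graded_model.intro graded_model_axioms.intro)
  show "cring list_ring" by (rule cring_list_ring)
  show "dec \<in> Ring.ring_hom list_ring ring_of_type_algebra"
    by (rule ring_hom_memI) (simp_all add: list_ring_ops dec_enc dec_in_T T_mult T_add T_one)
  show "inj_on dec (carrier list_ring)" by (rule inj_on_inverseI[where g = enc]) (rule enc_dec)
  show "dec ` carrier list_ring = T"
    using dec_enc by (force simp: list_ring_def image_image)
qed (use V'_zero V'_add V'_minus V'_one V'_mult in \<open>auto simp: list_grading_def\<close>)

sublocale L: graded_model list_ring list_grading dec V'
  by (rule graded_model_list_ring)

definition inclusion :: "'a \<Rightarrow> 'a list" where "inclusion r = enc (\<psi> r)"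

lemma \<psi>_in_T: "r \<in> carrier S \<Longrightarrow> \<psi> r \<in> T"
  using \<psi>_coeff V_subset unfolding section_ring_def by blast

lemma dec_inclusion: "r \<in> carrier S \<Longrightarrow> dec (inclusion r) = \<psi> r"
  by (simp add: inclusion_def dec_enc \<psi>_in_T)

lemma inclusion_in: "r \<in> carrier S \<Longrightarrow> inclusion r \<in> carrier list_ring"
  by (simp add: inclusion_def enc_in \<psi>_in_T)

lemma combination_in_span:
  assumes "length ls = length vs" "set ls \<subseteq> carrier S" "set vs \<subseteq> T"
  shows "(\<Sum>(l, u)\<leftarrow>zip ls vs. \<psi> l * u) \<in> T \<and>
    enc (\<Sum>(l, u)\<leftarrow>zip ls vs. \<psi> l * u) \<in> L.Span (inclusion ` carrier S) (map enc vs)"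
  using assms
proof (induction ls vs rule: list_induct2)
  case Nil
  then show ?case by (simp add: list_ring_ops T_zero)
next
  case (Cons l ls u vs)
  let ?q = "\<Sum>(l, u)\<leftarrow>zip ls vs. \<psi> l * u"
  have q: "?q \<in> T" "enc ?q \<in> L.Span (inclusion ` carrier S) (map enc vs)" using Cons by auto
  have lu: "l \<in> carrier S" "u \<in> T" "\<psi> l * u \<in> T" using Cons.prems by (auto intro: T_mult \<psi>_in_T)
  have "enc (\<psi> l * u + ?q) = inclusion l \<otimes>\<^bsub>list_ring\<^esub> enc u \<oplus>\<^bsub>list_ring\<^esub> enc ?q"
    using q lu by (simp add: list_ring_ops dec_enc dec_inclusion)
  with q lu have "enc (\<psi> l * u + ?q) \<in> L.line_extension (inclusion ` carrier S) (enc u)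
      (L.Span (inclusion ` carrier S) (map enc vs))"
    unfolding L.line_extension_mem_iff by blast
  then show ?case using T_add[OF lu(3) q(1)] by simp
qed

lemma finite_graded_extension_inclusion:
  "finite_graded_extension S G list_ring list_grading inclusion"
  unfolding finite_graded_extension_def
proof (intro conjI allI)
  show "graded_ring S G" by (rule graded_ring)
  show "graded_ring list_ring list_grading" by (rule L.graded_ring)
  show "inclusion \<in> Ring.ring_hom S list_ring"
    by (rule ring_hom_memI)
      (simp_all add: inclusion_in list_ring_ops dec_inclusion \<psi>_mult \<psi>_add inclusion_def[of "_ \<otimes> _"]
        inclusion_def[of "_ \<oplus> _"] inclusion_def[of \<one>] \<psi>_one)
  show "inj_on inclusion (carrier S)"
    by (rule inj_onI) (metis dec_inclusion \<psi>_eq_iff)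
  show "inclusion ` G k \<subseteq> list_grading k" for k
    using V_subset[of "int k"] by (auto simp: G_eq list_grading_def inclusion_in dec_inclusion)
  show "\<exists>Us. set Us \<subseteq> carrier list_ring \<and> L.Span (inclusion ` carrier S) Us = carrier list_ring"
  proof (intro exI[of _ "map enc us"] conjI equalityI)
    show Us: "set (map enc us) \<subseteq> carrier list_ring" using us enc_in by auto
    show "L.Span (inclusion ` carrier S) (map enc us) \<subseteq> carrier list_ring"
      by (rule L.Span_in_carrier[OF _ Us]) (auto simp: inclusion_in)
    show "carrier list_ring \<subseteq> L.Span (inclusion ` carrier S) (map enc us)"
    proof
      fix a assume "a \<in> carrier list_ring"
      then obtain q where q: "q \<in> T" "a = enc q" by (auto simp: carrier_list_ring)
      from generated[OF q(1)] obtain ls where ls: "length ls = length us" "set ls \<subseteq> carrier S"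
        "q = (\<Sum>(l, u)\<leftarrow>zip ls us. \<psi> l * u)" by auto
      from combination_in_span[OF ls(1,2) us] show "a \<in> L.Span (inclusion ` carrier S) (map enc us)"
        by (simp only: q(2) ls(3))
    qed
  qed
qed

lemma plus_closureI:
  assumes x: "x \<in> carrier S" and H: "b1 \<in> carrier S" "b2 \<in> carrier S" "b3 \<in> carrier S"
    and q: "q1 \<in> T" "q2 \<in> T" "q3 \<in> T" "\<psi> x = q1 * \<psi> b1 + q2 * \<psi> b2 + q3 * \<psi> b3"
  shows "x \<in> graded_plus_closure S G {b1, b2, b3}"
proof -
  let ?I = "Idl\<^bsub>list_ring\<^esub> (inclusion ` {b1, b2, b3})"
  have sub: "inclusion ` {b1, b2, b3} \<subseteq> carrier list_ring" using H inclusion_in by auto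
  then interpret I: ideal ?I list_ring by (rule L.genideal_ideal)
  have gen: "enc (q * \<psi> b) \<in> ?I" if "q \<in> T" "b \<in> {b1, b2, b3}" for q b
  proof -
    have b: "b \<in> carrier S" using that(2) H by auto
    have "inclusion b \<in> ?I" using L.genideal_self[OF sub] that(2) by auto
    from I.I_l_closed[OF this enc_in[OF that(1)]]
    show ?thesis by (simp add: list_ring_ops dec_enc that(1) dec_inclusion b)
  qed
  have T: "q1 * \<psi> b1 \<in> T" "q2 * \<psi> b2 \<in> T" "q3 * \<psi> b3 \<in> T"
    using q H by (auto intro: T_mult \<psi>_in_T)
  have "enc (q1 * \<psi> b1) \<oplus>\<^bsub>list_ring\<^esub> enc (q2 * \<psi> b2) \<oplus>\<^bsub>list_ring\<^esub> enc (q3 * \<psi> b3) \<in> ?I"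
    using gen q by (intro I.a_closed) auto
  then have "inclusion x \<in> ?I" using T by (simp add: inclusion_def q(4) list_ring_ops dec_enc T_add)
  then show ?thesis
    unfolding graded_plus_closure_def using x finite_graded_extension_inclusion by blast
qed

end

section \<open>The homogeneous coordinate ring of a plane curve\<close>

interpretation poly3: cring "poly3_ring :: 'k::field poly3 ring"
  by (rule cring_from_type_algebra)

lemma homogeneous_add: "p \<in> homogeneous_polys n \<Longrightarrow> q \<in> homogeneous_polys n \<Longrightarrow> p + q \<in> homogeneous_polys n"
  using Poly_Mapping.keys_add[of p q] by (auto simp: homogeneous_polys_def)

lemma homogeneous_mult:
  assumes "p \<in> homogeneous_polys i" "q \<in> homogeneous_polys j"
  shows "p * q \<in> homogeneous_polys (i + j)"
proof -
  have "(\<Sum>z\<in>UNIV. Poly_Mapping.lookup t z) = i + j" if "t \<in> Poly_Mapping.keys (p * q)" for t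
  proof -
    from that keys_mult[of p q] obtain u w where "t = u + w" "u \<in> Poly_Mapping.keys p" "w \<in> Poly_Mapping.keys q"
      by blast
    then show ?thesis using assms by (simp add: homogeneous_polys_def lookup_add sum.distrib)
  qed
  then show ?thesis by (simp add: homogeneous_polys_def)
qed

lemma homogeneous_0_single:
  assumes "p \<in> homogeneous_polys 0"
  shows "p = Poly_Mapping.single 0 (Poly_Mapping.lookup p 0)"
proof (rule poly_mapping_eqI)
  fix t
  have "t = 0" if "t \<in> Poly_Mapping.keys p"
    using assms that by (intro poly_mapping_eqI) (simp add: homogeneous_polys_def)
  then show "Poly_Mapping.lookup p t = Poly_Mapping.lookup (Poly_Mapping.single 0 (Poly_Mapping.lookup p 0)) t"
    by (auto simp: lookup_single when_def in_keys_iff)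
qed

lemma homogeneous_degree_ge:
  assumes p: "p \<in> homogeneous_polys d" and "d \<ge> n"
  shows "p \<in> degree_ge poly3_ring homogeneous_polys n"
proof -
  let ?c = "\<lambda>k. if k = d then p else 0"
  have "{k. ?c k \<noteq> \<zero>\<^bsub>poly3_ring\<^esub>} = (if p = 0 then {} else {d})" by auto
  then have "decomposes poly3_ring homogeneous_polys p ?c"
    using p poly3.finsum_insert[of "{}" d ?c]
    by (auto simp: decomposes_def homogeneous_polys_def[of _] simp del: One_nat_def)
  then show ?thesis unfolding degree_ge_def using assms(2) by (auto intro!: exI[of _ ?c])
qed

lemma genideal_dvd: "Idl\<^bsub>poly3_ring\<^esub> {F} = {p. F dvd p}"
  using poly3.cgenideal_eq_genideal[of F]
  by (auto simp: cgenideal_def dvd_def mult.commute)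

text \<open>Taking degree \<open>n\<close> parts turns the arbitrary cofactors of an ideal
  membership into homogeneous ones. For \<open>n < d\<close> the coefficient vanishes and the
  witness is 0, which every component contains.\<close>

lemma coeff_mult_homogeneous:
  assumes V: "0 \<in> V (int n - int d)" and q: "q \<in> section_ring V"
  shows "\<exists>u\<in>V (int n - int d). poly.coeff (q * Polynomial.monom w d) n = u * w"
proof (cases "n < d")
  case True
  then have "poly.coeff (q * Polynomial.monom w d) n = 0 * w"
    unfolding mult.commute[of q] by (simp add: coeff_monom_mult)
  with V show ?thesis by (intro bexI)
next
  case False
  then have "poly.coeff (q * Polynomial.monom w d) n = w * poly.coeff q (n - d)"
    unfolding mult.commute[of q] by (simp add: coeff_monom_mult)
  then have "poly.coeff (q * Polynomial.monom w d) n = poly.coeff q (n - d) * w"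
    by (simp only: mult.commute)
  moreover have "poly.coeff q (n - d) \<in> V (int n - int d)"
  proof -
    have "poly.coeff q (n - d) \<in> V (int (n - d))" using q by (simp only: section_ring_def mem_Collect_eq)
    with False show ?thesis by (simp add: of_nat_diff)
  qed
  ultimately show ?thesis by (intro bexI)
qed

locale curve_embedding =
  fixes I :: "'k::field poly3 set" and a :: "3 \<Rightarrow> 'k omega"
  assumes I: "ideal I poly3_ring" and kernel: "omega.graded_eval a p = 0 \<longleftrightarrow> p \<in> I"
    and a_nz: "\<exists>i. a i \<noteq> 0"
begin

abbreviation "R \<equiv> poly3_ring Quot I"
abbreviation "coset p \<equiv> I +>\<^bsub>poly3_ring\<^esub> p"
abbreviation "G \<equiv> quotient_grading poly3_ring homogeneous_polys I"
abbreviation "V \<equiv> omega.evaluated a"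

text \<open>Evaluation is constant on a coset, since its kernel is \<open>I\<close>; the image of a
  coset is therefore a singleton, and its element gives the induced embedding of R.\<close>

definition value_poly :: "'k poly3 set \<Rightarrow> 'k omega poly" where
  "value_poly A = the_elem (omega.graded_eval a ` A)"

lemma carrier_R: "A \<in> carrier R \<longleftrightarrow> (\<exists>p. A = coset p)"
  by (auto simp: FactRing_def A_RCOSETS_def')

lemma mem_coset: "q \<in> coset p \<longleftrightarrow> omega.graded_eval a q = omega.graded_eval a p"
proof
  assume "q \<in> coset p"
  then obtain i where "i \<in> I" "q = i + p" by (auto simp: a_r_coset_def')
  then show "omega.graded_eval a q = omega.graded_eval a p"
    using kernel[of i] by (simp add: omega.graded_eval_add)
next
  assume "omega.graded_eval a q = omega.graded_eval a p"
  then have "q - p \<in> I" using kernel[of "q - p"] by (simp add: omega.graded_eval_diff)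
  then show "q \<in> coset p" by (force simp: a_r_coset_def')
qed

lemma value_poly_coset: "value_poly (coset p) = omega.graded_eval a p"
proof -
  have "omega.graded_eval a ` coset p = {omega.graded_eval a p}"
    using mem_coset[of _ p] by (auto intro!: image_eqI[of _ _ p])
  then show ?thesis by (simp add: value_poly_def)
qed

lemma coset_eq_iff: "coset p = coset q \<longleftrightarrow> omega.graded_eval a p = omega.graded_eval a q"
  using mem_coset[of _ p] mem_coset[of _ q] by (metis subset_antisym subsetI)

lemma graded_model_R: "graded_model R G value_poly V"
proof (intro graded_model.intro graded_model_axioms.intro)
  note hom = ideal.rcos_ring_hom[OF I]
  note ga = omega.evaluated_graded_algebra[of a]
  show "cring R" by (rule ideal.quotient_is_cring[OF I poly3.is_cring])
  show "value_poly \<in> Ring.ring_hom R ring_of_type_algebra"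
  proof (rule ring_hom_memI)
    fix A B assume "A \<in> carrier R" "B \<in> carrier R"
    then obtain p q where [simp]: "A = coset p" "B = coset q" by (auto simp: carrier_R)
    show "value_poly (A \<otimes>\<^bsub>R\<^esub> B) = value_poly A \<otimes>\<^bsub>ring_of_type_algebra\<^esub> value_poly B"
      using ring_hom_mult[OF hom, of p q] value_poly_coset[of "p * q"] by (simp add: value_poly_coset omega.graded_eval_mult)
    show "value_poly (A \<oplus>\<^bsub>R\<^esub> B) = value_poly A \<oplus>\<^bsub>ring_of_type_algebra\<^esub> value_poly B"
      using ring_hom_add[OF hom, of p q] value_poly_coset[of "p + q"] by (simp add: value_poly_coset omega.graded_eval_add)
  next
    show "value_poly \<one>\<^bsub>R\<^esub> = \<one>\<^bsub>ring_of_type_algebra\<^esub>"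
      using ring_hom_one[OF hom] value_poly_coset[of 1] by (simp add: omega.graded_eval_one)
  qed simp
  show "inj_on value_poly (carrier R)"
  proof (rule inj_onI)
    fix A B assume "A \<in> carrier R" "B \<in> carrier R" "value_poly A = value_poly B"
    then obtain p q where pq: "A = coset p" "B = coset q" "value_poly (coset p) = value_poly (coset q)"
      by (auto simp: carrier_R)
    then show "A = B" unfolding value_poly_coset pq(1,2) coset_eq_iff by simp
  qed
  have "value_poly ` carrier R = range (omega.graded_eval a)"
    by (force simp: carrier_R value_poly_coset image_iff)
  then show "value_poly ` carrier R = section_ring V" by (simp add: omega.range_graded_eval)
  show "G k = {r \<in> carrier R. \<exists>w\<in>V (int k). value_poly r = Polynomial.monom w k}" for k
  proof (intro equalityI subsetI)
    fix A assume "A \<in> G k"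
    then obtain p where p: "p \<in> homogeneous_polys k" "A = coset p" by (auto simp: quotient_grading_def)
    then show "A \<in> {r \<in> carrier R. \<exists>w\<in>V (int k). value_poly r = Polynomial.monom w k}"
      using omega.graded_eval_homogeneous[OF p(1), of a] omega.coeff_graded_eval_evaluated[of a p k]
      by (auto simp: carrier_R value_poly_coset)
  next
    fix A assume "A \<in> {r \<in> carrier R. \<exists>w\<in>V (int k). value_poly r = Polynomial.monom w k}"
    then obtain p w where p: "A = coset p" "w \<in> V (int k)" "omega.graded_eval a p = Polynomial.monom w k"
      by (auto simp: carrier_R value_poly_coset)
    from omega.evaluated_homogeneous[OF p(2)] obtain q where
      "q \<in> homogeneous_polys k" "omega.graded_eval a q = Polynomial.monom w k" by auto
    then show "A \<in> G k" using p coset_eq_iff[of p q] by (auto simp: quotient_grading_def)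
  qed
  show "0 \<in> V k" "1 \<in> V 0" for k using omega.ga_zero[OF ga] omega.ga_one[OF ga] by simp_all
  show "u + w \<in> V k" if "u \<in> V k" "w \<in> V k" for u w k using omega.ga_add[OF ga] that .
  show "- u \<in> V k" if "u \<in> V k" for u k using omega.ga_minus[OF ga] that .
  show "u * w \<in> V (i + j)" if "u \<in> V i" "w \<in> V j" for u w i j using omega.ga_mult[OF ga] that .
qed

sublocale M: graded_model R G value_poly V
  by (rule graded_model_R)

section \<open>Values of forms at the generic point\<close>

definition form_value :: "nat \<Rightarrow> 'k poly3 \<Rightarrow> 'k omega" where
  "form_value d p = poly.coeff (omega.graded_eval a p) d"

lemma form_value_in: "form_value d p \<in> V (int d)"
  by (simp add: form_value_def omega.coeff_graded_eval_evaluated)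

lemma graded_eval_form: "p \<in> homogeneous_polys d \<Longrightarrow> omega.graded_eval a p = Polynomial.monom (form_value d p) d"
  unfolding form_value_def by (rule omega.graded_eval_homogeneous)

text \<open>The class of a variable lies in the irrelevant ideal, so one of its powers lies in the
  ideal of the two forms. Comparing coefficients in degree \<open>n\<close> makes the cofactors
  homogeneous.\<close>

lemma primary_pair_value:
  assumes f: "f1 \<in> homogeneous_polys d1" "f2 \<in> homogeneous_polys d2"
    and primary: "primary R G {coset f1, coset f2}"
  shows "\<exists>n. \<exists>u\<in>V (int n - int d1). \<exists>w\<in>V (int n - int d2).
    a i ^ n = u * form_value d1 f1 + w * form_value d2 f2"
proof -
  let ?A = "coset (Poly_Mapping.single (Poly_Mapping.single i (Suc 0)) 1)"
  have A: "?A \<in> carrier R" "value_poly ?A = Polynomial.monom (a i) (Suc 0)"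
    by (auto simp: carrier_R value_poly_coset omega.graded_eval_single)
  have "?A \<in> irrelevant_ideal R G" unfolding M.degree_ge_iff by (simp add: A)
  with primary obtain n where n: "?A [^]\<^bsub>R\<^esub> (n::nat) \<in> Idl\<^bsub>R\<^esub> {coset f1, coset f2}"
    unfolding primary_def radical_def by auto
  have c: "coset f1 \<in> carrier R" "coset f2 \<in> carrier R" by (auto simp: carrier_R)
  from M.mem_genideal_pair[OF c n] obtain U W where UW: "U \<in> carrier R" "W \<in> carrier R"
    "?A [^]\<^bsub>R\<^esub> n = U \<otimes>\<^bsub>R\<^esub> coset f1 \<oplus>\<^bsub>R\<^esub> W \<otimes>\<^bsub>R\<^esub> coset f2" by auto
  have "Polynomial.monom (a i) (Suc 0) ^ n = value_poly U * Polynomial.monom (form_value d1 f1) d1 + value_poly W * Polynomial.monom (form_value d2 f2) d2"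
    using arg_cong[OF UW(3), of value_poly] c UW(1,2)
    by (simp add: M.\<psi>_pow A omega.graded_eval_single M.\<psi>_add M.\<psi>_mult value_poly_coset graded_eval_form[OF f(1)] graded_eval_form[OF f(2)])
  from arg_cong[OF this, of "\<lambda>q. poly.coeff q n"]
  have eq: "a i ^ n = poly.coeff (value_poly U * Polynomial.monom (form_value d1 f1) d1) n
      + poly.coeff (value_poly W * Polynomial.monom (form_value d2 f2) d2) n"
    by (simp add: monom_power)
  have S: "value_poly U \<in> section_ring V" "value_poly W \<in> section_ring V" using UW M.\<psi>_image by blast+
  obtain u where "u \<in> V (int n - int d1)"
    "poly.coeff (value_poly U * Polynomial.monom (form_value d1 f1) d1) n = u * form_value d1 f1"
    using coeff_mult_homogeneous[OF M.V_zero S(1)] by blast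
  moreover obtain w where "w \<in> V (int n - int d2)"
    "poly.coeff (value_poly W * Polynomial.monom (form_value d2 f2) d2) n = w * form_value d2 f2"
    using coeff_mult_homogeneous[OF M.V_zero S(2)] by blast
  ultimately show ?thesis
    using eq by (intro exI[of _ n] bexI[of _ u] bexI[of _ w]) simp_all
qed

text \<open>A form of positive degree lies in the irrelevant ideal, hence in the radical of the
  ideal of the g_i. Allowing every exponent beyond \<open>n\<close> makes it possible to use one
  exponent for two different forms.\<close>

lemma form_power_value:
  assumes f: "f \<in> homogeneous_polys d" "d > 0"
    and g: "g1 \<in> homogeneous_polys e1" "g2 \<in> homogeneous_polys e2" "g3 \<in> homogeneous_polys e3"
    and primary: "primary poly3_ring homogeneous_polys {g1, g2, g3}"
  shows "\<exists>n. \<forall>N\<ge>n. \<exists>u1\<in>V (int (N * d) - int e1). \<exists>u2\<in>V (int (N * d) - int e2). \<exists>u3\<in>V (int (N * d) - int e3).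
    form_value d f ^ N = u1 * form_value e1 g1 + u2 * form_value e2 g2 + u3 * form_value e3 g3"
proof -
  have "f \<in> irrelevant_ideal poly3_ring homogeneous_polys"
    using f by (intro homogeneous_degree_ge) auto
  with primary obtain n where "f [^]\<^bsub>poly3_ring\<^esub> (n::nat) \<in> Idl\<^bsub>poly3_ring\<^esub> {g1, g2, g3}"
    unfolding primary_def radical_def by auto
  then obtain r1 r2 r3 where r: "f [^]\<^bsub>poly3_ring\<^esub> n = r1 * g1 + r2 * g2 + r3 * g3"
    using poly3.mem_genideal_triple[of g1 g2 g3 "f [^]\<^bsub>poly3_ring\<^esub> n"] by auto
  have "f [^]\<^bsub>poly3_ring\<^esub> k = f ^ k" for k :: nat
    by (induction k) (simp_all add: mult.commute)
  with r have r': "f ^ n = r1 * g1 + r2 * g2 + r3 * g3" by simp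
  have pow: "omega.graded_eval a (f ^ k) = Polynomial.monom (form_value d f ^ k) (d * k)" for k
    by (induction k) (simp_all add: omega.graded_eval_one omega.graded_eval_mult graded_eval_form[OF f(1)] mult_monom)
  have "\<exists>u1\<in>V (int (N * d) - int e1). \<exists>u2\<in>V (int (N * d) - int e2). \<exists>u3\<in>V (int (N * d) - int e3).
    form_value d f ^ N = u1 * form_value e1 g1 + u2 * form_value e2 g2 + u3 * form_value e3 g3" if "N \<ge> n" for N
  proof -
    have "f ^ N = f ^ (N - n) * f ^ n" using that by (simp flip: power_add)
    also have "\<dots> = (f ^ (N - n) * r1) * g1 + (f ^ (N - n) * r2) * g2 + (f ^ (N - n) * r3) * g3"
      by (simp add: r' algebra_simps)
    finally obtain s1 s2 s3 where s: "f ^ N = s1 * g1 + s2 * g2 + s3 * g3" by blast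
    let ?\<Phi> = "omega.graded_eval a"
    have "form_value d f ^ N = poly.coeff (?\<Phi> (f ^ N)) (N * d)" by (simp add: pow mult.commute)
    also have "?\<Phi> (f ^ N) = ?\<Phi> s1 * Polynomial.monom (form_value e1 g1) e1 +
        ?\<Phi> s2 * Polynomial.monom (form_value e2 g2) e2 + ?\<Phi> s3 * Polynomial.monom (form_value e3 g3) e3"
      by (simp add: s omega.graded_eval_add omega.graded_eval_mult graded_eval_form[OF g(1)]
          graded_eval_form[OF g(2)] graded_eval_form[OF g(3)])
    finally have eq: "form_value d f ^ N = poly.coeff (?\<Phi> s1 * Polynomial.monom (form_value e1 g1) e1) (N * d) +
        poly.coeff (?\<Phi> s2 * Polynomial.monom (form_value e2 g2) e2) (N * d) +
        poly.coeff (?\<Phi> s3 * Polynomial.monom (form_value e3 g3) e3) (N * d)"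
      by simp
    have S: "?\<Phi> s \<in> section_ring V" for s using omega.range_graded_eval[of a] by blast
    obtain u1 where "u1 \<in> V (int (N * d) - int e1)" "poly.coeff (?\<Phi> s1 * Polynomial.monom (form_value e1 g1) e1) (N * d) = u1 * form_value e1 g1"
      using coeff_mult_homogeneous[OF M.V_zero S[of s1]] by blast
    moreover obtain u2 where "u2 \<in> V (int (N * d) - int e2)" "poly.coeff (?\<Phi> s2 * Polynomial.monom (form_value e2 g2) e2) (N * d) = u2 * form_value e2 g2"
      using coeff_mult_homogeneous[OF M.V_zero S[of s2]] by blast
    moreover obtain u3 where "u3 \<in> V (int (N * d) - int e3)" "poly.coeff (?\<Phi> s3 * Polynomial.monom (form_value e3 g3) e3) (N * d) = u3 * form_value e3 g3"
      using coeff_mult_homogeneous[OF M.V_zero S[of s3]] by blast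
    ultimately show ?thesis using eq by (intro bexI[of _ u1] bexI[of _ u2] bexI[of _ u3]) simp_all
  qed
  then show ?thesis by (intro exI[of _ n]) simp
qed

text \<open>The K[x,y]-module generators of \<open>V'\<close>, placed in their degrees, generate its
  section ring over R, since \<open>x\<close> and \<open>y\<close> already come from R.
  \<open>Q\<close> is the module they generate; it is enough that it contains every monomial with
  coefficient in the corresponding component of \<open>V'\<close>.\<close>

lemma exists_list_extension:
  assumes tp: "two_parameters omega_scalar x y dx dy"
    and xy: "x \<in> V (int dx)" "y \<in> V (int dy)"
    and V': "two_parameters.finite_algebra omega_scalar x y dx dy V'" and sub: "\<And>k. V k \<subseteq> V' k"
  shows "\<exists>us. list_extension R G value_poly V V' us"
proof -
  interpret tp: two_parameters omega_scalar x y dx dy by (rule tp)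
  note ga = tp.finite_algebraD(1)[OF V']
  note gaV = omega.evaluated_graded_algebra[of a]
  obtain B where B: "finite B" "\<And>w \<delta>. (w, \<delta>) \<in> B \<Longrightarrow> w \<in> V' (int \<delta>)"
    "\<And>k. V' k \<subseteq> omega.vs.span (tp.monomials B k)" using tp.finite_algebraE[OF V'] by metis
  from finite_list[OF B(1)] obtain bs where bs: "set bs = B" by blast
  define us where "us = map (\<lambda>(w, \<delta>). Polynomial.monom w \<delta>) bs"
  define Q where "Q = {q. \<exists>c. (\<forall>i<length us. c i \<in> carrier R) \<and> q = (\<Sum>i<length us. value_poly (c i) * us ! i)}"
  have Q_zero: "0 \<in> Q"
    unfolding Q_def by (auto intro!: exI[of _ "\<lambda>_. \<zero>\<^bsub>R\<^esub>"] simp: M.\<psi>_zero)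
  have Q_add: "p + q \<in> Q" if p: "p \<in> Q" and q: "q \<in> Q" for p q
  proof -
    from p obtain c where c: "\<forall>i<length us. c i \<in> carrier R" "p = (\<Sum>i<length us. value_poly (c i) * us ! i)"
      by (auto simp: Q_def)
    from q obtain c' where c': "\<forall>i<length us. c' i \<in> carrier R" "q = (\<Sum>i<length us. value_poly (c' i) * us ! i)"
      by (auto simp: Q_def)
    have "p + q = (\<Sum>i<length us. value_poly (c i \<oplus>\<^bsub>R\<^esub> c' i) * us ! i)"
      using c c' by (simp add: M.\<psi>_add distrib_right sum.distrib)
    then show ?thesis using c(1) c'(1) unfolding Q_def by (auto intro!: exI[of _ "\<lambda>i. c i \<oplus>\<^bsub>R\<^esub> c' i"])
  qed
  have Q_mult: "value_poly r * q \<in> Q" if r: "r \<in> carrier R" and q: "q \<in> Q" for r q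
  proof -
    from q obtain c where c: "\<forall>i<length us. c i \<in> carrier R" "q = (\<Sum>i<length us. value_poly (c i) * us ! i)"
      by (auto simp: Q_def)
    have "value_poly r * q = (\<Sum>i<length us. value_poly (r \<otimes>\<^bsub>R\<^esub> c i) * us ! i)"
      using c r by (simp add: M.\<psi>_mult sum_distrib_left mult.assoc)
    then show ?thesis using c(1) r unfolding Q_def by (auto intro!: exI[of _ "\<lambda>i. r \<otimes>\<^bsub>R\<^esub> c i"])
  qed
  have Q_gen: "u \<in> Q" if "u \<in> set us" for u
  proof -
    from that obtain i where i: "i < length us" "u = us ! i" by (auto simp: in_set_conv_nth)
    have "(\<Sum>j<length us. value_poly (if j = i then \<one>\<^bsub>R\<^esub> else \<zero>\<^bsub>R\<^esub>) * us ! j) = (\<Sum>j<length us. if j = i then us ! i else 0)"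
      by (intro sum.cong) (auto simp: M.\<psi>_one M.\<psi>_zero)
    then have "u = (\<Sum>j<length us. value_poly (if j = i then \<one>\<^bsub>R\<^esub> else \<zero>\<^bsub>R\<^esub>) * us ! j)"
      using i by simp
    then show ?thesis unfolding Q_def by (intro CollectI exI[of _ "\<lambda>j. if j = i then \<one>\<^bsub>R\<^esub> else \<zero>\<^bsub>R\<^esub>"]) simp
  qed
  have homogeneous_Q: "Polynomial.monom v k * q \<in> Q" if "v \<in> V (int k)" "q \<in> Q" for v k q
  proof -
    have "Polynomial.monom v k \<in> section_ring V" using that(1) by (auto simp: section_ring_def M.V_zero)
    then obtain r where "r \<in> carrier R" "value_poly r = Polynomial.monom v k" using M.\<psi>_preimage by blast
    with Q_mult[OF this(1) that(2)] show ?thesis by simp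
  qed
  have monom_Q: "Polynomial.monom w n \<in> Q" if "w \<in> V' (int n)" for w n
  proof -
    have "omega.vs.subspace {w. Polynomial.monom w n \<in> Q}"
    proof (rule omega.subspaceI)
      show "0 \<in> {w. Polynomial.monom w n \<in> Q}" by (simp add: Q_zero)
      show "u + w \<in> {w. Polynomial.monom w n \<in> Q}"
        if "u \<in> {w. Polynomial.monom w n \<in> Q}" "w \<in> {w. Polynomial.monom w n \<in> Q}" for u w
        using Q_add that by (simp flip: add_monom)
      fix z u assume u: "u \<in> {w. Polynomial.monom w n \<in> Q}"
      have "omega_scalar z * 1 \<in> V (int 0)" using omega.ga_scale[OF gaV omega.ga_one[OF gaV]] by simp
      from homogeneous_Q[OF this, of "Polynomial.monom u n"] u
      show "omega_scalar z * u \<in> {w. Polynomial.monom w n \<in> Q}" by (simp add: mult_monom)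
    qed
    moreover have "tp.monomials B (int n) \<subseteq> {w. Polynomial.monom w n \<in> Q}"
    proof
      fix s assume "s \<in> tp.monomials B (int n)"
      then obtain i j w \<delta> where s: "s = x ^ i * y ^ j * w" "(w, \<delta>) \<in> B" "int (i * dx + j * dy + \<delta>) = int n"
        by (auto simp: tp.monomials_def)
      have "x ^ i * y ^ j * 1 \<in> V (int (i * dx + j * dy))"
        by (rule tp.monomial_mem[OF gaV xy omega.ga_one[OF gaV]]) simp
      moreover have "Polynomial.monom w \<delta> \<in> Q"
        using s(2) bs by (intro Q_gen) (auto simp: us_def intro!: image_eqI[of _ _ "(w, \<delta>)"])
      ultimately have "Polynomial.monom (x ^ i * y ^ j * 1) (i * dx + j * dy) * Polynomial.monom w \<delta> \<in> Q"
        by (rule homogeneous_Q)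
      moreover have "i * dx + j * dy + \<delta> = n" using s(3) by (simp only: of_nat_eq_iff)
      ultimately show "s \<in> {w. Polynomial.monom w n \<in> Q}" by (simp add: mult_monom s(1))
    qed
    ultimately have "omega.vs.span (tp.monomials B (int n)) \<subseteq> {w. Polynomial.monom w n \<in> Q}"
      by (intro omega.vs.span_minimal)
    then show ?thesis using that B(3) by blast
  qed
  have generated: "\<exists>ls. length ls = length us \<and> set ls \<subseteq> carrier R \<and> q = (\<Sum>(l, u)\<leftarrow>zip ls us. value_poly l * u)"
    if "q \<in> section_ring V'" for q
  proof -
    have "(\<Sum>n\<in>A. Polynomial.monom (poly.coeff q n) n) \<in> Q" for A
      using that by (induction A rule: infinite_finite_induct) (auto simp: Q_zero section_ring_def intro: Q_add monom_Q)
    then have "q \<in> Q" using poly_as_sum_of_monoms[of q] by metis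
    then obtain c where c: "\<And>i. i < length us \<Longrightarrow> c i \<in> carrier R" "q = (\<Sum>i<length us. value_poly (c i) * us ! i)"
      by (auto simp: Q_def)
    have "(\<Sum>(l, u)\<leftarrow>zip (map c [0..<length us]) us. value_poly l * u) = q"
      by (simp add: c(2) sum_list_sum_nth lessThan_atLeast0)
    then show ?thesis using c(1) by (intro exI[of _ "map c [0..<length us]"]) auto
  qed
  have "set us \<subseteq> section_ring V'"
    using B(2) bs omega.ga_zero[OF ga] by (auto simp: us_def section_ring_def)
  then have "list_extension R G value_poly V V' us"
    using graded_model_R sub omega.ga_zero[OF ga] omega.ga_add[OF ga] omega.ga_minus[OF ga]
      omega.ga_one[OF ga] omega.ga_mult[OF ga] generated
    by (intro list_extension.intro list_extension_axioms.intro)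
  then show ?thesis by (rule exI)
qed

lemma degree_ge_subset_closure:
  assumes ext: "list_extension R G value_poly V V' us"
    and f: "f1 \<in> homogeneous_polys d1" "f2 \<in> homogeneous_polys d2" "f3 \<in> homogeneous_polys d3"
    and m: "m \<ge> d1" "m \<ge> d2" "m \<ge> d3"
    and solve: "\<forall>k\<ge>int m. \<forall>z\<in>V k. \<exists>\<alpha>1\<in>V' (k - int d1). \<exists>\<alpha>2\<in>V' (k - int d2). \<exists>\<alpha>3\<in>V' (k - int d3).
       z = \<alpha>1 * form_value d1 f1 + \<alpha>2 * form_value d2 f2 + \<alpha>3 * form_value d3 f3"
  shows "degree_ge R G m \<subseteq> graded_plus_closure R G {coset f1, coset f2, coset f3}"
proof
  interpret E: list_extension R G value_poly V V' us by (rule ext)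
  fix A assume "A \<in> degree_ge R G m"
  then have A: "A \<in> carrier R" "\<And>k. k < m \<Longrightarrow> poly.coeff (value_poly A) k = 0"
    by (auto simp: M.degree_ge_iff)
  \<comment> \<open>The three coefficients form one triple so that a single choice selects them in
    each degree. Below \<open>m\<close> nothing is demanded, as \<open>A\<close> has no components
    there; from \<open>m\<close> on, the subtractions of degrees are exact.\<close>
  define P where "P n t \<longleftrightarrow> (n \<ge> m \<longrightarrow> fst t \<in> V' (int (n - d1)) \<and> fst (snd t) \<in> V' (int (n - d2)) \<and>
      snd (snd t) \<in> V' (int (n - d3)) \<and> poly.coeff (value_poly A) n =
        fst t * form_value d1 f1 + fst (snd t) * form_value d2 f2 + snd (snd t) * form_value d3 f3)" for n t
  have ex: "\<exists>t. P n t" for n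
  proof (cases "n \<ge> m")
    case True
    then have "int n \<ge> int m" by simp
    from solve[rule_format, OF this M.\<psi>_coeff[OF A(1)]] obtain \<alpha>1 where
      "\<alpha>1 \<in> V' (int n - int d1)" "\<exists>\<alpha>2\<in>V' (int n - int d2). \<exists>\<alpha>3\<in>V' (int n - int d3).
        poly.coeff (value_poly A) n = \<alpha>1 * form_value d1 f1 + \<alpha>2 * form_value d2 f2 + \<alpha>3 * form_value d3 f3" ..
    moreover from this(2) obtain \<alpha>2 where
      "\<alpha>2 \<in> V' (int n - int d2)" "\<exists>\<alpha>3\<in>V' (int n - int d3).
        poly.coeff (value_poly A) n = \<alpha>1 * form_value d1 f1 + \<alpha>2 * form_value d2 f2 + \<alpha>3 * form_value d3 f3" ..
    moreover from this(2) obtain \<alpha>3 where "\<alpha>3 \<in> V' (int n - int d3)"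
      "poly.coeff (value_poly A) n = \<alpha>1 * form_value d1 f1 + \<alpha>2 * form_value d2 f2 + \<alpha>3 * form_value d3 f3" ..
    moreover have "int (n - d1) = int n - int d1" "int (n - d2) = int n - int d2" "int (n - d3) = int n - int d3"
      using True m by simp_all
    ultimately have "P n (\<alpha>1, \<alpha>2, \<alpha>3)" by (simp add: P_def)
    then show ?thesis ..
  qed (simp add: P_def)
  define t where "t n = (SOME t. P n t)" for n
  define \<alpha>1 \<alpha>2 \<alpha>3 where "\<alpha>1 n = fst (t n)" and "\<alpha>2 n = fst (snd (t n))" and "\<alpha>3 n = snd (snd (t n))" for n
  have "P n (t n)" for n unfolding t_def by (rule someI_ex[OF ex])
  then have \<alpha>: "\<And>n. n \<ge> m \<Longrightarrow> \<alpha>1 n \<in> V' (int (n - d1))" "\<And>n. n \<ge> m \<Longrightarrow> \<alpha>2 n \<in> V' (int (n - d2))"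
    "\<And>n. n \<ge> m \<Longrightarrow> \<alpha>3 n \<in> V' (int (n - d3))"
    "\<And>n. n \<ge> m \<Longrightarrow> poly.coeff (value_poly A) n =
       \<alpha>1 n * form_value d1 f1 + \<alpha>2 n * form_value d2 f2 + \<alpha>3 n * form_value d3 f3"
    by (simp_all add: P_def \<alpha>1_def \<alpha>2_def \<alpha>3_def del: of_nat_diff)
  let ?N = "Polynomial.degree (value_poly A)"
  have sum_T: "(\<Sum>n\<in>{m..?N}. Polynomial.monom (\<alpha> n) (n - d)) \<in> section_ring V'"
    if "\<And>n. n \<ge> m \<Longrightarrow> \<alpha> n \<in> V' (int (n - d))" for \<alpha> d
  proof -
    have "Polynomial.monom (\<alpha> n) (n - d) \<in> section_ring V'" if "n \<ge> m" for n
      using \<open>\<And>n. n \<ge> m \<Longrightarrow> \<alpha> n \<in> V' (int (n - d))\<close>[OF that] E.V'_zero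
      by (simp add: section_ring_def del: of_nat_diff)
    then have "N \<subseteq> {m..} \<Longrightarrow> (\<Sum>n\<in>N. Polynomial.monom (\<alpha> n) (n - d)) \<in> section_ring V'" for N
      by (induction N rule: infinite_finite_induct) (simp_all add: E.T_zero E.T_add)
    then show ?thesis by simp
  qed
  have split: "Polynomial.monom (\<alpha> * form_value d f) n = Polynomial.monom \<alpha> (n - d) * value_poly (coset f)"
    if "f \<in> homogeneous_polys d" "n \<ge> d" for \<alpha> d f n
    using that by (simp add: value_poly_coset graded_eval_form mult_monom)
  have "value_poly A = (\<Sum>n\<in>{m..?N}. Polynomial.monom (poly.coeff (value_poly A) n) n)"
    by (subst poly_as_sum_of_monoms[symmetric], rule sum.mono_neutral_right) (auto simp: A(2))
  also have "\<dots> = (\<Sum>n\<in>{m..?N}. Polynomial.monom (\<alpha>1 n) (n - d1) * value_poly (coset f1) +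
      Polynomial.monom (\<alpha>2 n) (n - d2) * value_poly (coset f2) + Polynomial.monom (\<alpha>3 n) (n - d3) * value_poly (coset f3))"
    using m by (intro sum.cong refl) (simp add: \<alpha>(4) split[OF f(1)] split[OF f(2)] split[OF f(3)] flip: add_monom)
  also have "\<dots> = (\<Sum>n\<in>{m..?N}. Polynomial.monom (\<alpha>1 n) (n - d1)) * value_poly (coset f1) +
      (\<Sum>n\<in>{m..?N}. Polynomial.monom (\<alpha>2 n) (n - d2)) * value_poly (coset f2) +
      (\<Sum>n\<in>{m..?N}. Polynomial.monom (\<alpha>3 n) (n - d3)) * value_poly (coset f3)"
    by (simp add: sum.distrib sum_distrib_right)
  finally have eq: "value_poly A = (\<Sum>n\<in>{m..?N}. Polynomial.monom (\<alpha>1 n) (n - d1)) * value_poly (coset f1) +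
      (\<Sum>n\<in>{m..?N}. Polynomial.monom (\<alpha>2 n) (n - d2)) * value_poly (coset f2) +
      (\<Sum>n\<in>{m..?N}. Polynomial.monom (\<alpha>3 n) (n - d3)) * value_poly (coset f3)" .
  have c: "coset f \<in> carrier R" for f by (auto simp: carrier_R)
  show "A \<in> graded_plus_closure R G {coset f1, coset f2, coset f3}"
    by (rule E.plus_closureI[OF A(1) c c c sum_T[OF \<alpha>(1)] sum_T[OF \<alpha>(2)] sum_T[OF \<alpha>(3)] eq])
qed

text \<open>A nonzero constant among the forms generates the unit ideal already in R, so R itself,
  with the single generator 1, is a sufficient extension.\<close>

lemma constant_closure:
  assumes f: "f1 \<in> homogeneous_polys 0" "form_value 0 f1 \<noteq> 0"
  shows "degree_ge R G m \<subseteq> graded_plus_closure R G {coset f1, coset f2, coset f3}"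
proof
  have "\<exists>ls. length ls = length [1] \<and> set ls \<subseteq> carrier R \<and> q = (\<Sum>(l, u)\<leftarrow>zip ls [1]. value_poly l * u)"
    if "q \<in> section_ring V" for q
  proof -
    from M.\<psi>_preimage[OF that] obtain r where "r \<in> carrier R" "value_poly r = q" by blast
    then show ?thesis by (intro exI[of _ "[r]"]) simp
  qed
  moreover have "set [1] \<subseteq> section_ring V" by (auto simp: section_ring_def M.V_one M.V_zero coeff_1)
  ultimately interpret E: list_extension R G value_poly V V "[1]"
    using M.V_zero M.V_add M.V_minus M.V_one M.V_mult
    by (intro list_extension.intro graded_model_R list_extension_axioms.intro order_refl)
  fix A assume "A \<in> degree_ge R G m"
  then have A: "A \<in> carrier R" by (simp add: M.degree_ge_iff)
  define z where "z = Poly_Mapping.lookup f1 0"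
  have f1: "f1 = Poly_Mapping.single 0 z" unfolding z_def by (rule homogeneous_0_single[OF f(1)])
  have "z \<noteq> 0" using f(2) by (auto simp: f1 form_value_def omega.graded_eval_zero)
  then have "omega_scalar (inverse z) * omega_scalar z = 1" by (simp flip: omega.\<kappa>_mult)
  then have inv: "omega.graded_eval a (Poly_Mapping.single 0 (inverse z)) * omega.graded_eval a f1 = 1"
    by (simp add: f1 omega.graded_eval_single mult_monom monom_eq_1)
  have c: "coset f \<in> carrier R" for f by (auto simp: carrier_R)
  let ?U = "A \<otimes>\<^bsub>R\<^esub> coset (Poly_Mapping.single 0 (inverse z))"
  have U: "value_poly ?U \<in> section_ring V" using M.\<psi>_image A c by blast
  have "value_poly A = value_poly ?U * value_poly (coset f1) + 0 * value_poly (coset f2) + 0 * value_poly (coset f3)"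
    by (simp add: M.\<psi>_mult[OF A c] value_poly_coset mult.assoc inv)
  from E.plus_closureI[OF A c c c U E.T_zero E.T_zero this]
  show "A \<in> graded_plus_closure R G {coset f1, coset f2, coset f3}" .
qed

lemma curve_closure:
  assumes char: "CHAR('k) > 0"
    and f: "f1 \<in> homogeneous_polys d1" "f2 \<in> homogeneous_polys d2" "f3 \<in> homogeneous_polys d3"
    and g: "g1 \<in> homogeneous_polys e1" "g2 \<in> homogeneous_polys e2" "g3 \<in> homogeneous_polys e3"
    and m: "m = e1 + d1" "m = e2 + d2" "m = e3 + d3" "2 * m \<ge> d1 + d2 + d3"
    and rel: "f1 * g1 + f2 * g2 + f3 * g3 \<in> I"
    and primary_g: "primary poly3_ring homogeneous_polys {g1, g2, g3}"
    and primary_f: "primary R G {coset f1, coset f2}"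
    and nz: "form_value d1 f1 \<noteq> 0" "form_value d2 f2 \<noteq> 0"
  shows "degree_ge R G m \<subseteq> graded_plus_closure R G {coset f1, coset f2, coset f3}"
proof (cases "d1 = 0 \<or> d2 = 0")
  \<comment> \<open>The parameters need positive degree; a nonzero form of degree 0 is a
    unit.\<close>
  case True
  then show ?thesis
    using constant_closure[of f1 m f2 f3] constant_closure[of f2 m f1 f3] f nz by (auto simp: insert_commute)
next
  case False
  let ?x = "form_value d1 f1" and ?y = "form_value d2 f2"
  interpret tp: two_parameters omega_scalar ?x ?y d1 d2
  proof unfold_locales
    show "CHAR('k omega) > 0" unfolding CHAR_omega by (rule char)
  qed (use False nz in simp_all)
  have fa: "tp.finite_algebra V"
    by (rule tp.evaluated_finite_algebra[OF form_value_in form_value_in primary_pair_value[OF f(1,2) primary_f]])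
  obtain n1 where n1: "\<And>N. N \<ge> n1 \<Longrightarrow> \<exists>u1\<in>V (int (N * d1) - int e1). \<exists>u2\<in>V (int (N * d1) - int e2). \<exists>u3\<in>V (int (N * d1) - int e3).
    ?x ^ N = u1 * form_value e1 g1 + u2 * form_value e2 g2 + u3 * form_value e3 g3"
    using form_power_value[OF f(1) _ g primary_g] False by auto
  obtain n2 where n2: "\<And>N. N \<ge> n2 \<Longrightarrow> \<exists>u1\<in>V (int (N * d2) - int e1). \<exists>u2\<in>V (int (N * d2) - int e2). \<exists>u3\<in>V (int (N * d2) - int e3).
    ?y ^ N = u1 * form_value e1 g1 + u2 * form_value e2 g2 + u3 * form_value e3 g3"
    using form_power_value[OF f(2) _ g primary_g] False by auto
  \<comment> \<open>A common exponent, because the two chart solutions are compared over the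
    denominator \<open>(x * y) ^ N\<close>.\<close>
  define N where "N = max n1 n2"
  have e: "int e1 = int m - int d1" "int e2 = int m - int d2" "int e3 = int m - int d3"
    using m by linarith+
  obtain r1 r2 r3 where r: "r1 \<in> V (int (N * d1) - (int m - int d1))" "r2 \<in> V (int (N * d1) - (int m - int d2))"
    "r3 \<in> V (int (N * d1) - (int m - int d3))" "?x ^ N = r1 * form_value e1 g1 + r2 * form_value e2 g2 + r3 * form_value e3 g3"
    using n1[of N] unfolding e by (auto simp: N_def)
  obtain s1 s2 s3 where s: "s1 \<in> V (int (N * d2) - (int m - int d1))" "s2 \<in> V (int (N * d2) - (int m - int d2))"
    "s3 \<in> V (int (N * d2) - (int m - int d3))" "?y ^ N = s1 * form_value e1 g1 + s2 * form_value e2 g2 + s3 * form_value e3 g3"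
    using n2[of N] unfolding e by (auto simp: N_def)
  have "Polynomial.monom (?x * form_value e1 g1 + ?y * form_value e2 g2 + form_value d3 f3 * form_value e3 g3) m
      = omega.graded_eval a (f1 * g1 + f2 * g2 + f3 * g3)"
    using m by (simp add: omega.graded_eval_add omega.graded_eval_mult graded_eval_form[OF f(1)] graded_eval_form[OF f(2)]
        graded_eval_form[OF f(3)] graded_eval_form[OF g(1)] graded_eval_form[OF g(2)] graded_eval_form[OF g(3)]
        mult_monom add_monom add.commute)
  also have "\<dots> = 0" using rel kernel by blast
  finally have rel': "?x * form_value e1 g1 + ?y * form_value e2 g2 + form_value d3 f3 * form_value e3 g3 = 0" by simp
  have md: "m \<ge> d1" "m \<ge> d2" "m \<ge> d3" using m by linarith+
  have gV: "form_value e1 g1 \<in> V (int m - int d1)" "form_value e2 g2 \<in> V (int m - int d2)"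
    "form_value e3 g3 \<in> V (int m - int d3)"
    using form_value_in[of e1 g1] form_value_in[of e2 g2] form_value_in[of e3 g3] unfolding e .
  from tp.extend_to_degree_ge[OF fa form_value_in gV rel' r s md m(4)]
  obtain V' where V': "tp.finite_algebra V'" "\<And>k. V k \<subseteq> V' k"
    "\<forall>k\<ge>int m. \<forall>z\<in>V k. \<exists>\<alpha>1\<in>V' (k - int d1). \<exists>\<alpha>2\<in>V' (k - int d2). \<exists>\<alpha>3\<in>V' (k - int d3).
       z = \<alpha>1 * ?x + \<alpha>2 * ?y + \<alpha>3 * form_value d3 f3" by blast
  from exists_list_extension[OF tp.two_parameters_axioms form_value_in form_value_in V'(1,2)]
  obtain us where "list_extension R G value_poly V V' us" by blast
  from degree_ge_subset_closure[OF this f md V'(3)] show ?thesis .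
qed

end

theorem corollary10p8:
  fixes f g :: "nat \<Rightarrow> ('k::alg_closed_field) poly3"
    and d e :: "nat \<Rightarrow> nat" and m :: nat
    and F :: "'k poly3" and I :: "'k poly3 set"
    and R :: "'k poly3 set ring" and G :: "nat \<Rightarrow> 'k poly3 set set"
    and fR :: "nat \<Rightarrow> 'k poly3 set"
  assumes "CHAR('k) > 0"
    and "\<And>i. i \<in> {1..3} \<Longrightarrow> f i \<in> homogeneous_polys (d i)"
    and "\<And>i. i \<in> {1..3} \<Longrightarrow> g i \<in> homogeneous_polys (e i)"
    and "primary poly3_ring homogeneous_polys (g ` {1..3})"
    and "\<And>i. i \<in> {1..3} \<Longrightarrow> m = e i + d i"
    and "2 * m \<ge> d 1 + d 2 + d 3"
    and "F = f 1 * g 1 + f 2 * g 2 + f 3 * g 3"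
    and "I = Idl\<^bsub>poly3_ring\<^esub> {F}"
    and "R = poly3_ring Quot I"
    and "G = quotient_grading poly3_ring homogeneous_polys I"
    and "\<And>i. fR i = I +>\<^bsub>poly3_ring\<^esub> f i"
    and "normal_ring R"
    and "\<And>i j. i \<in> {1..3} \<Longrightarrow> j \<in> {1..3} \<Longrightarrow> i \<noteq> j \<Longrightarrow> primary R G {fR i, fR j}"
  shows "degree_ge R G m \<subseteq> graded_plus_closure R G (fR ` {1..3})"
proof -
  note f = assms(2) and g = assms(3) and m = assms(5)
  have index: "{1..3} = {1, 2, 3::nat}" by auto
  have I: "ideal I poly3_ring" unfolding assms(8) by (rule poly3.genideal_ideal) simp
  have I_dvd: "p \<in> I \<longleftrightarrow> F dvd p" for p unfolding assms(8) genideal_dvd by simp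
  \<comment> \<open>A normal ring is a domain, so \<open>I\<close> is prime; this gives
    \<open>F\<close> the divisibility property from which the generic point is built.\<close>
  have dom: "domain (poly3_ring Quot I)" using assms(9,12) by (simp add: normal_ring_def)
  have "primeideal I poly3_ring" by (rule poly3.quot_domain_imp_primeideal[OF I dom])
  then interpret P: primeideal I poly3_ring .
  have prime: "F dvd p \<or> F dvd q" if "F dvd p * q" for p q
    using P.I_prime[of p q] that by (simp add: I_dvd)
  have "f i * g i \<in> homogeneous_polys m" if "i \<in> {1..3}" for i
    using homogeneous_mult[OF f[OF that] g[OF that]] m[OF that] by (simp add: add.commute)
  then have F: "F \<in> homogeneous_polys m" unfolding assms(7) by (intro homogeneous_add) auto
  \<comment> \<open>A nonzero form of degree 0 is a unit, and then \<open>I\<close> would not be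
    proper.\<close>
  have "m > 0" if "F \<noteq> 0"
  proof (rule ccontr)
    assume "\<not> m > 0"
    with F have "F = Poly_Mapping.single 0 (Poly_Mapping.lookup F 0)" by (intro homogeneous_0_single) simp
    then obtain z where z: "F = Poly_Mapping.single 0 z" by iprover
    then have "z \<noteq> 0" using that by auto
    then have "1 = F * Poly_Mapping.single 0 (inverse z)" by (simp add: z mult_single)
    then have "F dvd 1" by (rule dvdI)
    then have "F dvd p" for p using dvd_trans[of F 1 p] by simp
    then have "I = carrier poly3_ring" using I_dvd by auto
    with P.I_notcarr show False by simp
  qed
  then obtain a where a: "\<exists>i. a i \<noteq> 0" "\<And>p. omega.graded_eval a p = 0 \<longleftrightarrow> F dvd p"
    using plane_curve_embedding[OF F _ prime] by iprover
  interpret C: curve_embedding I a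
    by (rule curve_embedding.intro[OF I _ a(1)]) (simp add: a(2) I_dvd)
  have primary: "primary C.R C.G {C.coset (f i), C.coset (f j)}" if "i \<in> {1..3}" "j \<in> {1..3}" "i \<noteq> j" for i j
    using assms(13)[OF that] by (simp only: assms(9-11))
  \<comment> \<open>If two of the forms vanished at the point, their being primary would make a
    power of each coordinate vanish, although some coordinate is nonzero. So at most one form
    vanishes there, and two others can serve as \<open>x\<close> and \<open>y\<close>.\<close>
  have nz: "C.form_value (d i) (f i) \<noteq> 0 \<or> C.form_value (d j) (f j) \<noteq> 0"
    if ij: "i \<in> {1..3}" "j \<in> {1..3}" "i \<noteq> j" for i j
  proof (rule ccontr)
    assume *: "\<not> ?thesis"
    obtain v where "a v \<noteq> 0" using a(1) by blast
    from C.primary_pair_value[OF f[OF ij(1)] f[OF ij(2)] primary[OF ij], of v] * have "\<exists>n. a v ^ n = 0" by auto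
    with \<open>a v \<noteq> 0\<close> show False by simp
  qed
  \<comment> \<open>Stated for any arrangement of the indices, because which two forms are nonzero
    at the point depends on the curve; \<open>sums\<close> carries the symmetry of the degree bound
    and of \<open>F\<close>.\<close>
  have main: "degree_ge C.R C.G m \<subseteq> graded_plus_closure C.R C.G {C.coset (f i), C.coset (f j), C.coset (f k)}"
    if ijk: "{i, j, k} = {1, 2, 3}" "i \<noteq> j" and nz: "C.form_value (d i) (f i) \<noteq> 0" "C.form_value (d j) (f j) \<noteq> 0"
      and sums: "d i + d j + d k = d 1 + d 2 + d 3" "f i * g i + f j * g j + f k * g k = F" for i j k
  proof -
    have mem: "i \<in> {1..3}" "j \<in> {1..3}" "k \<in> {1..3}" unfolding index ijk(1)[symmetric] by simp_all
    have "primary poly3_ring homogeneous_polys {g i, g j, g k}"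
      using assms(4) unfolding index ijk(1)[symmetric] by simp
    moreover have "f i * g i + f j * g j + f k * g k \<in> I" by (simp add: sums(2) I_dvd)
    moreover have "2 * m \<ge> d i + d j + d k" using assms(6) sums(1) by simp
    ultimately show ?thesis
      using C.curve_closure[OF assms(1) f[OF mem(1)] f[OF mem(2)] f[OF mem(3)] g[OF mem(1)] g[OF mem(2)] g[OF mem(3)]
          m[OF mem(1)] m[OF mem(2)] m[OF mem(3)]] primary[OF mem(1,2) ijk(2)] nz by simp
  qed
  consider "C.form_value (d 1) (f 1) \<noteq> 0" "C.form_value (d 2) (f 2) \<noteq> 0"
    | "C.form_value (d 1) (f 1) \<noteq> 0" "C.form_value (d 3) (f 3) \<noteq> 0"
    | "C.form_value (d 2) (f 2) \<noteq> 0" "C.form_value (d 3) (f 3) \<noteq> 0"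
    using nz[of 1 2] nz[of 1 3] nz[of 2 3] by auto
  then have "degree_ge C.R C.G m \<subseteq> graded_plus_closure C.R C.G {C.coset (f 1), C.coset (f 2), C.coset (f 3)}"
  proof cases
    case 1
    then show ?thesis using main[of 1 2 3] by (simp add: assms(7))
  next
    case 2
    then show ?thesis using main[of 1 3 2]
      by (simp add: assms(7) insert_commute add.commute add.left_commute)
  next
    case 3
    then show ?thesis using main[of 2 3 1]
      by (simp add: assms(7) insert_commute add.commute add.left_commute)
  qed
  then show ?thesis unfolding index by (simp add: assms(9-11))
qed

end
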